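(* Let $\alpha<\beta$ be real, let $H$ be a Hilbert space, let $V:H\to H$ be unitary, and let $P_V$ be the associated selfadjoint extension of $P_0$ in $L^2([\alpha,\beta])\otimes H$. Suppose $P_V=\int_{\mathbb{R}}\lambda\,F(d\lambda)$, where $F(d\lambda)$ is the projection-valued measure of $P_V$. Then for all $-\infty<\mu<\nu<+\infty$, $$\tfrac12\bigl(F((\mu,\nu))+F([\mu,\nu])\bigr)=\int_{[0,1)}\sum_{m\in\mathbb{Z}}\chi_{(\mu,\nu)}\bigl(\tfrac{\lambda+m}{\beta-\alpha}\bigr)\,E_{\frac{\lambda+m}{\beta-\alpha}}\otimes E_V(d\lambda).$$
   Context: All Hilbert spaces are complex, inner products are conjugate-linear in the first variable, $e(r):=e^{i2\pi r}$, $e_r(x):=e(rx)$, and $\chi_S$ is the indicator function of $S$. Let $\mathscr{H}=L^2([\alpha,\beta],H)=L^2([\alpha,\beta])\otimes H$. The operator $P_0f=\frac{1}{i2\pi}f'$ has domain $\{f\in\mathscr{H}\mid f'\in\mathscr{H},\ f(\alpha)=f(\beta)=0\}$ (distributional derivative; such $f$ have continuous representatives, so endpoint values in $H$ make sense). For a unitary $V$ on $H$, $P_Vf=\frac{1}{i2\pi}f'$ with domain $\{f\in\mathscr{H}\mid f'\in\mathscr{H},\ f(\beta)=Vf(\alpha)\}$; it is a selfadjoint extension of $P_0$. $E_V$ is the spectral resolution of $V$ on the Borel sets of $[0,1)$ (with values projections in $H$), written $V=\int_{[0,1)}e(\lambda)E_V(d\lambda)$; if $1$ is an eigenvalue of $V$,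 the corresponding atom of $E_V$ is located at $0$. For $\lambda\in\mathbb{R}$, $m\in\mathbb{Z}$, $E_{\frac{\lambda+m}{\beta-\alpha}}$ is the orthogonal projection in $L^2([\alpha,\beta])$ onto the span of the function $e_{\frac{\lambda+m}{\beta-\alpha}}$, i.e. $E_{\frac{\lambda+m}{\beta-\alpha}}f=(\beta-\alpha)^{-1}\Bigl(\int_\alpha^\beta f(t)\,e\bigl(-\tfrac{\lambda+m}{\beta-\alpha}t\bigr)dt\Bigr)e_{\frac{\lambda+m}{\beta-\alpha}}$. The integral $\int_{[0,1)}K(\lambda)\otimes E_V(d\lambda)$ of an operator-valued function $K$ on $L^2([\alpha,\beta])$ is understood weakly: its matrix element between $f\otimes g$ and $f'\otimes g'$ is $\int_{[0,1)}\langle f,K(\lambda)f'\rangle\,\langle g,E_V(d\lambda)g'\rangle$.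
   Formalization: The printed formula fails when μ or ν is an eigenvalue of P_V (H=ℂ, V=1, [α,β]=[0,1], μ=0, ν=1); proved instead with χ taking value 1/2 at μ and ν, for all μ<ν, and as printed when F({μ})=F({ν})=0. *)

theory Defs
  imports "HOL-Analysis.Analysis" "HOL-Library.Function_Algebras"
begin

section \<open>Complex vector spaces and complex Hilbert spaces\<close>

class complex_vector = ab_group_add +
  fixes scaleC :: "complex \<Rightarrow> 'a \<Rightarrow> 'a" (infixr "*\<^sub>C" 75)
  assumes scaleC_add_right: "a *\<^sub>C (x + y) = a *\<^sub>C x + a *\<^sub>C y"
    and scaleC_add_left: "(a + b) *\<^sub>C x = a *\<^sub>C x + b *\<^sub>C x"
    and scaleC_scaleC: "a *\<^sub>C b *\<^sub>C x = (a * b) *\<^sub>C x"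
    and scaleC_one: "1 *\<^sub>C x = x"

text \<open>
  The inner product is conjugate-linear in the first variable.  The norm is the one of the inner
  product and \<^class>\<open>banach\<close> gives completeness; separability is not assumed.
\<close>

class chilbert = complex_vector + banach +
  fixes cinner :: "'a \<Rightarrow> 'a \<Rightarrow> complex"
  assumes scaleR_scaleC: "scaleR r x = complex_of_real r *\<^sub>C x"
    and cinner_commute: "cinner x y = cnj (cinner y x)"
    and cinner_add_right: "cinner x (y + z) = cinner x y + cinner x z"
    and cinner_scaleC_right: "cinner x (a *\<^sub>C y) = a * cinner x y"
    and cinner_self: "cinner x x = complex_of_real ((norm x)\<^sup>2)"

instantiation complex :: chilbert
begin
definition scaleC_complex :: "complex \<Rightarrow> complex \<Rightarrow> complex"
  where "scaleC_complex a x = a * x"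
definition cinner_complex :: "complex \<Rightarrow> complex \<Rightarrow> complex"
  where "cinner_complex x y = cnj x * y"
instance
proof
  show "cinner x x = complex_of_real ((norm x)\<^sup>2)" for x :: complex
    unfolding cinner_complex_def by (metis complex_norm_square mult.commute of_real_power)
qed (auto simp: scaleC_complex_def cinner_complex_def scaleR_conv_of_real algebra_simps)
end

instantiation "fun" :: (type, complex_vector) complex_vector
begin
definition scaleC_fun :: "complex \<Rightarrow> ('a \<Rightarrow> 'b) \<Rightarrow> 'a \<Rightarrow> 'b"
  where "scaleC_fun a f = (\<lambda>t. a *\<^sub>C f t)"
instance
  by standard
    (auto simp: scaleC_fun_def plus_fun_def fun_eq_iff scaleC_add_right scaleC_add_left
      scaleC_scaleC scaleC_one)
end

definition unitary :: "('h::chilbert \<Rightarrow> 'h) \<Rightarrow> bool" where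
  "unitary V \<longleftrightarrow>
     (\<forall>x y. V (x + y) = V x + V y) \<and> (\<forall>a x. V (a *\<^sub>C x) = a *\<^sub>C V x) \<and>
     (\<forall>x y. cinner (V x) (V y) = cinner x y) \<and> surj V"


section \<open>Projection-valued measures\<close>

text \<open>
  The definitions of this section are used for \<open>H\<close>, with carrier \<open>UNIV\<close> and inner product
  \<^const>\<open>cinner\<close>, and for \<open>L\<^sup>2([\<alpha>,\<beta>],H)\<close>, whose elements are represented by functions.  In the
  second case \<open>ip\<close> is only semidefinite (two vectors of \<open>X\<close> represent the same element iff they have
  the same inner product with every vector of \<open>X\<close>, i.e. iff they agree almost everywhere), so all
  operator identities are expressed by matrix elements.  Linearity of an orthogonal projection, and
  its compatibility with this identification, follow from symmetry.
\<close>

definition orth_projection ::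
  "'v set \<Rightarrow> ('v \<Rightarrow> 'v \<Rightarrow> complex) \<Rightarrow> ('v \<Rightarrow> 'v) \<Rightarrow> bool" where
  "orth_projection X ip P \<longleftrightarrow>
     P ` X \<subseteq> X \<and>
     (\<forall>x\<in>X. \<forall>y\<in>X. ip (P x) y = ip x (P y)) \<and>
     (\<forall>x\<in>X. \<forall>y\<in>X. ip x (P (P y)) = ip x (P y))"

definition pvm ::
  "'s measure \<Rightarrow> 'v set \<Rightarrow> ('v \<Rightarrow> 'v \<Rightarrow> complex) \<Rightarrow> ('s set \<Rightarrow> 'v \<Rightarrow> 'v) \<Rightarrow> bool" where
  "pvm M X ip F \<longleftrightarrow>
     (\<forall>A\<in>sets M. orth_projection X ip (F A)) \<and>
     (\<forall>x\<in>X. \<forall>y\<in>X. ip x (F (space M) y) = ip x y) \<and>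
     (\<forall>A\<in>sets M. \<forall>B\<in>sets M. \<forall>x\<in>X. \<forall>y\<in>X. ip x (F (A \<inter> B) y) = ip x (F A (F B y))) \<and>
     (\<forall>A :: nat \<Rightarrow> 's set. range A \<subseteq> sets M \<longrightarrow> disjoint_family A \<longrightarrow>
        (\<forall>x\<in>X. \<forall>y\<in>X. (\<lambda>n. ip x (F (A n) y)) sums ip x (F (\<Union>n. A n) y)))"

definition pvm_measure ::
  "'s measure \<Rightarrow> ('v \<Rightarrow> 'v \<Rightarrow> complex) \<Rightarrow> ('s set \<Rightarrow> 'v \<Rightarrow> 'v) \<Rightarrow> 'v \<Rightarrow> 's measure" where
  "pvm_measure M ip F x = measure_of (space M) (sets M) (\<lambda>A. ennreal (Re (ip x (F A x))))"

text \<open>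
  \<open>has_pvm_integral M ip F k x y c\<close> says \<open>\<integral> k(s) \<langle>x, F(ds) y\<rangle> = c\<close>.  The complex measure
  \<open>\<langle>x, F(\<cdot>) y\<rangle>\<close> is expressed through positive measures by polarization:
  \<open>4 \<langle>x, F(A) y\<rangle> = \<Sum>j<4. \<i>\<^sup>-\<^sup>j \<langle>x + \<i>\<^sup>j y, F(A) (x + \<i>\<^sup>j y)\<rangle>\<close>.
\<close>

definition has_pvm_integral ::
  "'s measure \<Rightarrow> ('v::complex_vector \<Rightarrow> 'v \<Rightarrow> complex) \<Rightarrow> ('s set \<Rightarrow> 'v \<Rightarrow> 'v) \<Rightarrow>
   ('s \<Rightarrow> complex) \<Rightarrow> 'v \<Rightarrow> 'v \<Rightarrow> complex \<Rightarrow> bool" where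
  "has_pvm_integral M ip F k x y c \<longleftrightarrow>
     (\<forall>j<4. integrable (pvm_measure M ip F (x + \<i> ^ j *\<^sub>C y)) k) \<and>
     c = (\<Sum>j<4. inverse (\<i> ^ j) *
            integral\<^sup>L (pvm_measure M ip F (x + \<i> ^ j *\<^sub>C y)) k) / 4"

text \<open>
  \<open>T = \<integral>\<^sub>\<real> \<lambda> F(d\<lambda>)\<close> for a possibly unbounded operator with graph \<open>T\<close>: the domain consists of the
  \<open>x\<close> with \<open>\<integral> \<lambda>\<^sup>2 \<langle>x, F(d\<lambda>) x\<rangle> < \<infinity>\<close>.  The matrix elements are taken between vectors
  of this (dense) domain because for other \<open>y\<close> the function \<open>\<lambda>\<close> need not be integrable for the
  polarized positive measures.
\<close>

definition spectral_measure_of ::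
  "'v::complex_vector set \<Rightarrow> ('v \<Rightarrow> 'v \<Rightarrow> complex) \<Rightarrow> ('v \<times> 'v) set \<Rightarrow>
   (real set \<Rightarrow> 'v \<Rightarrow> 'v) \<Rightarrow> bool" where
  "spectral_measure_of X ip T F \<longleftrightarrow>
     pvm borel X ip F \<and>
     (\<forall>x\<in>X. x \<in> Domain T \<longleftrightarrow> integrable (pvm_measure borel ip F x) (\<lambda>l. l\<^sup>2)) \<and>
     (\<forall>(x, z)\<in>T. \<forall>y\<in>Domain T. has_pvm_integral borel ip F complex_of_real y x (ip y z))"

definition e2pi :: "real \<Rightarrow> complex" where
  "e2pi r = exp (\<i> * 2 * complex_of_real pi * complex_of_real r)"

text \<open>\<open>V = \<integral>\<^bsub>[0,1)\<^esub> e(\<lambda>) E(d\<lambda>)\<close>.\<close>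

definition spectral_resolution :: "('h::chilbert \<Rightarrow> 'h) \<Rightarrow> (real set \<Rightarrow> 'h \<Rightarrow> 'h) \<Rightarrow> bool" where
  "spectral_resolution V E \<longleftrightarrow>
     pvm (restrict_space borel {0..<1}) UNIV cinner E \<and>
     (\<forall>x y. has_pvm_integral (restrict_space borel {0..<1}) cinner E e2pi x y (cinner x (V y)))"


section \<open>The space $L^2([\alpha,\beta],H)$\<close>

text \<open>
  Bochner measurability, for which \<open>H\<close> need not be separable (the Bochner integral of the library
  needs a second countable range space).
\<close>

definition strongly_measurable :: "'s measure \<Rightarrow> ('s \<Rightarrow> 'h::topological_space) \<Rightarrow> bool" where
  "strongly_measurable M f \<longleftrightarrow>
     (\<exists>s. (\<forall>n::nat. simple_function M (s n)) \<and> (AE t in M. (\<lambda>n. s n t) \<longlonglongrightarrow> f t))"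

text \<open>
  The representatives are functions on \<open>\<real>\<close> whose values outside \<open>[\<alpha>,\<beta>]\<close> are irrelevant.
\<close>

definition L2 :: "real \<Rightarrow> real \<Rightarrow> (real \<Rightarrow> 'h::chilbert) set" where
  "L2 \<alpha> \<beta> = {f. strongly_measurable (lebesgue_on {\<alpha>..\<beta>}) f \<and>
                integrable (lebesgue_on {\<alpha>..\<beta>}) (\<lambda>t. (norm (f t))\<^sup>2)}"

definition l2_inner ::
  "real \<Rightarrow> real \<Rightarrow> (real \<Rightarrow> 'h::chilbert) \<Rightarrow> (real \<Rightarrow> 'h) \<Rightarrow> complex" where
  "l2_inner \<alpha> \<beta> f g = (LINT t|lebesgue_on {\<alpha>..\<beta>}. cinner (f t) (g t))"

definition tensor :: "(real \<Rightarrow> complex) \<Rightarrow> 'h::chilbert \<Rightarrow> real \<Rightarrow> 'h" (infixr "\<otimes>\<^sub>H" 70) where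
  "f \<otimes>\<^sub>H h = (\<lambda>t. f t *\<^sub>C h)"


section \<open>The operator $P_V$\<close>

definition test_function :: "real \<Rightarrow> real \<Rightarrow> (real \<Rightarrow> real) \<Rightarrow> bool" where
  "test_function \<alpha> \<beta> \<phi> \<longleftrightarrow>
     (\<forall>n t. ((deriv ^^ n) \<phi>) field_differentiable (at t)) \<and>
     (\<exists>a b. \<alpha> < a \<and> b < \<beta> \<and> (\<forall>t. t \<notin> {a..b} \<longrightarrow> \<phi> t = 0))"

text \<open>
  \<open>f' = g\<close> as \<open>H\<close>-valued distributions on \<open>(\<alpha>,\<beta>)\<close>; the vectors \<open>\<integral> \<phi>' f\<close> and \<open>-\<integral> \<phi> g\<close> of \<open>H\<close> are
  compared through their inner products with all \<open>h\<close>.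
\<close>

definition distr_deriv ::
  "real \<Rightarrow> real \<Rightarrow> (real \<Rightarrow> 'h::chilbert) \<Rightarrow> (real \<Rightarrow> 'h) \<Rightarrow> bool" where
  "distr_deriv \<alpha> \<beta> f g \<longleftrightarrow>
     (\<forall>\<phi> h. test_function \<alpha> \<beta> \<phi> \<longrightarrow>
        (LINT t|lebesgue_on {\<alpha>..\<beta>}. complex_of_real (deriv \<phi> t) * cinner h (f t)) =
        - (LINT t|lebesgue_on {\<alpha>..\<beta>}. complex_of_real (\<phi> t) * cinner h (g t)))"

text \<open>The endpoint values of \<open>f\<close> are those of its continuous representative \<open>u\<close>.\<close>

definition P_graph ::
  "real \<Rightarrow> real \<Rightarrow> ('h::chilbert \<Rightarrow> 'h) \<Rightarrow> ((real \<Rightarrow> 'h) \<times> (real \<Rightarrow> 'h)) set" where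
  "P_graph \<alpha> \<beta> V =
     {(f, inverse (\<i> * 2 * complex_of_real pi) *\<^sub>C g) | f g.
        f \<in> L2 \<alpha> \<beta> \<and> g \<in> L2 \<alpha> \<beta> \<and> distr_deriv \<alpha> \<beta> f g \<and>
        (\<exists>u. continuous_on {\<alpha>..\<beta>} u \<and> (AE t in lebesgue_on {\<alpha>..\<beta>}. f t = u t) \<and>
             u \<beta> = V (u \<alpha>))}"


section \<open>The operator-valued integral\<close>

definition fourier_proj ::
  "real \<Rightarrow> real \<Rightarrow> real \<Rightarrow> (real \<Rightarrow> complex) \<Rightarrow> real \<Rightarrow> complex" where
  "fourier_proj \<alpha> \<beta> r f = (\<lambda>t. inverse (complex_of_real (\<beta> - \<alpha>)) *
     (LINT s|lebesgue_on {\<alpha>..\<beta>}. f s * e2pi (- r * s)) * e2pi (r * t))"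

text \<open>
  \<open>\<Sum>\<^bsub>m\<in>\<int>\<^esub> w((\<lambda>+m)/(\<beta>-\<alpha>)) E\<^bsub>(\<lambda>+m)/(\<beta>-\<alpha>)\<^esub>\<close>; in all uses \<open>w\<close> has bounded support, so that the sum is
  finite.
\<close>

definition fourier_sum ::
  "real \<Rightarrow> real \<Rightarrow> (real \<Rightarrow> real) \<Rightarrow> real \<Rightarrow> (real \<Rightarrow> complex) \<Rightarrow> real \<Rightarrow> complex" where
  "fourier_sum \<alpha> \<beta> w l f = (\<lambda>t. \<Sum>\<^sub>\<infinity>m::int.
     complex_of_real (w ((l + real_of_int m) / (\<beta> - \<alpha>))) *
     fourier_proj \<alpha> \<beta> ((l + real_of_int m) / (\<beta> - \<alpha>)) f t)"

text \<open>
  \<open>T = \<integral>\<^bsub>[0,1)\<^esub> K(\<lambda>) \<otimes> E(d\<lambda>)\<close> in the weak sense, for an operator \<open>T\<close> on \<open>L\<^sup>2([\<alpha>,\<beta>],H)\<close>.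
\<close>

definition has_tensor_integral ::
  "real \<Rightarrow> real \<Rightarrow> (real set \<Rightarrow> 'h::chilbert \<Rightarrow> 'h) \<Rightarrow>
   (real \<Rightarrow> (real \<Rightarrow> complex) \<Rightarrow> real \<Rightarrow> complex) \<Rightarrow>
   ((real \<Rightarrow> 'h) \<Rightarrow> real \<Rightarrow> 'h) \<Rightarrow> bool" where
  "has_tensor_integral \<alpha> \<beta> E K T \<longleftrightarrow>
     (\<forall>f\<in>L2 \<alpha> \<beta>. \<forall>f'\<in>L2 \<alpha> \<beta>. \<forall>g g'.
        has_pvm_integral (restrict_space borel {0..<1}) cinner E
          (\<lambda>l. l2_inner \<alpha> \<beta> f (K l f')) g g'
          (l2_inner \<alpha> \<beta> (f \<otimes>\<^sub>H g) (T (f' \<otimes>\<^sub>H g'))))"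

text \<open>
  The indicator function of an interval with endpoints \<open>\<mu>\<close> and \<open>\<nu>\<close>, with value \<open>1/2\<close> at the
  endpoints, as it arises in Stone's formula.
\<close>

definition half_indicator :: "real \<Rightarrow> real \<Rightarrow> real \<Rightarrow> real" where
  "half_indicator \<mu> \<nu> x = (indicator {\<mu><..<\<nu>} x + indicator {\<mu>..\<nu>} x) / 2"

end

theory Submission
  imports Defs
begin

text \<open>
  For non-real \<open>z\<close> the resolvent \<open>(P\<^sub>V - z)\<^sup>-\<^sup>1\<close> applied to \<open>f' \<otimes> g'\<close> solves a first order boundary value
  problem explicitly in terms of \<open>(e(-z(\<beta>-\<alpha>)) V - 1)\<^sup>-\<^sup>1 g'\<close>.  Hence its matrix elements are integrals
  against \<open>E(d\<lambda>)\<close> of those of the scalar resolvent with boundary condition \<open>u(\<beta>) = e(\<lambda>) u(\<alpha>)\<close>, and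
  expanding the latter in the Fourier basis \<open>e\<^bsub>(\<lambda>+m)/(\<beta>-\<alpha>)\<^esub>\<close> gives the identity
  \<open>\<integral> \<phi> dF = \<integral> \<Sum>\<^sub>m \<phi>((\<lambda>+m)/(\<beta>-\<alpha>)) E\<^bsub>(\<lambda>+m)/(\<beta>-\<alpha>)\<^esub> \<otimes> E(d\<lambda>)\<close> for \<open>\<phi>(s) = 1/(s - z)\<close>.  The functions
  \<open>\<phi>\<close> satisfying this identity form a linear space closed under bounded pointwise limits.  It therefore
  contains the Poisson kernels, their integrals over \<open>(\<mu>,\<nu>)\<close> (as limits of Riemann sums), and the limit
  of these as the Poisson kernels concentrate, which is the half-weighted indicator function of
  \<open>(\<mu>,\<nu>)\<close> (Stone's formula).  The Fourier expansion needs no density theorem in \<open>L\<^sup>2\<close>: the resolvent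
  is continuous, so Stone-Weierstrass on the circle suffices.
\<close>

subsection \<open>Semi-inner products\<close>

text \<open>The half weights are forced. At an endpoint the integrated Poisson kernel tends to 1/2,
  and the mean of F over the open and over the closed interval gives an atom at an endpoint weight
  1/2 as well, whereas the indicator of the open interval gives it weight 0. The identity therefore
  holds with \<open>half_indicator\<close> in general, and with the open indicator as soon as F has
  no atom at the two endpoints; hence the two-part conclusion. The spectral hypothesis relates F to
  the operator only through matrix elements between domain vectors. Arbitrary vectors x are reached
  by testing against F(B)x with B bounded: on B the function \<open>l\<^sup>2\<close> is bounded, so
  F(B)x lies in the domain. The cutoff can be removed afterwards because 1/(s - z) is bounded for
  non-real z. The tensor structure survives because the boundary value problem involves V through a
  single vector C with (w V - 1) C = g', where w = e(-z(\<beta>-\<alpha>)). The same C gives the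
  F-side and, through the symbol w e(l) - 1 of w V - 1, the E-side.\<close>

lemma scaleC_zero_left [simp]: "0 *\<^sub>C x = (0::'v::complex_vector)"
  using scaleC_add_left[of 0 0 x] by simp

lemma scaleC_minus1 [simp]: "(-1) *\<^sub>C x = - (x::'v::complex_vector)"
proof -
  have "(-1) *\<^sub>C x + x = (-1) *\<^sub>C x + 1 *\<^sub>C x"
    by (simp add: scaleC_one)
  also have "\<dots> = 0"
    by (simp only: scaleC_add_left[symmetric]) simp
  finally show ?thesis by (simp add: eq_neg_iff_add_eq_0)
qed

text \<open>A carrier and a merely semidefinite form let one theory serve both H, with carrier
  \<open>UNIV\<close>, and functions representing elements of the \<open>L2\<close> space, where
  nonzero functions may have zero norm.\<close>

locale semi_inner =
  fixes X :: "'v::complex_vector set" and ip :: "'v \<Rightarrow> 'v \<Rightarrow> complex"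
  assumes add_closed: "x \<in> X \<Longrightarrow> y \<in> X \<Longrightarrow> x + y \<in> X"
    and scaleC_closed: "x \<in> X \<Longrightarrow> a *\<^sub>C x \<in> X"
    and ip_commute: "x \<in> X \<Longrightarrow> y \<in> X \<Longrightarrow> ip x y = cnj (ip y x)"
    and ip_add_right: "x \<in> X \<Longrightarrow> y \<in> X \<Longrightarrow> z \<in> X \<Longrightarrow> ip x (y + z) = ip x y + ip x z"
    and ip_scaleC_right: "x \<in> X \<Longrightarrow> y \<in> X \<Longrightarrow> ip x (a *\<^sub>C y) = a * ip x y"
    and ip_self_nonneg: "x \<in> X \<Longrightarrow> 0 \<le> Re (ip x x)"
begin

lemma ip_add_left: "x \<in> X \<Longrightarrow> y \<in> X \<Longrightarrow> z \<in> X \<Longrightarrow> ip (x + y) z = ip x z + ip y z"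
  using ip_commute[of "x + y" z] ip_commute[of x z] ip_commute[of y z]
  by (simp add: ip_add_right add_closed)

lemma ip_scaleC_left: "x \<in> X \<Longrightarrow> y \<in> X \<Longrightarrow> ip (a *\<^sub>C x) y = cnj a * ip x y"
  using ip_commute[of "a *\<^sub>C x" y] ip_commute[of x y]
  by (simp add: ip_scaleC_right scaleC_closed)

lemma ip_self_real: "x \<in> X \<Longrightarrow> ip x x = complex_of_real (Re (ip x x))"
  using ip_commute[of x x] by (simp add: complex_eq_iff)

text \<open>The form is nonnegative at \<open>x + w *\<^sub>C y\<close>, and the phase
  \<open>w\<close> is chosen to turn both cross terms into \<open>- cmod (ip x y)\<close>. This
  additive version of Cauchy-Schwarz never divides by a norm, which could vanish for a semidefinite
  form.\<close>

lemma norm_ip_le: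
  assumes x: "x \<in> X" and y: "y \<in> X"
  shows "2 * cmod (ip x y) \<le> Re (ip x x) + Re (ip y y)"
proof (cases "ip x y = 0")
  case True
  then show ?thesis using ip_self_nonneg[OF x] ip_self_nonneg[OF y] by simp
next
  case False
  define w where "w = - cnj (ip x y) / cmod (ip x y)"
  have w: "cnj w * w = 1" "w * ip x y = - cmod (ip x y)"
    using False complex_norm_square[of "ip x y"]
    by (simp_all add: w_def power2_eq_square mult.commute[of "cnj _"] nonzero_divide_eq_eq)
  have "cnj (w * ip x y) = cnj w * ip y x"
    using ip_commute[OF y x] by simp
  then have w3: "cnj w * ip y x = - cmod (ip x y)"
    unfolding w(2) by simp
  have "ip (x + w *\<^sub>C y) (x + w *\<^sub>C y)
      = ip x x + w * ip x y + cnj w * ip y x + (cnj w * w) * ip y y"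
    using x y by (simp add: ip_add_left ip_add_right ip_scaleC_left ip_scaleC_right add_closed
        scaleC_closed algebra_simps)
  then have "ip (x + w *\<^sub>C y) (x + w *\<^sub>C y) = ip x x + ip y y - 2 * cmod (ip x y)"
    unfolding w w3 by simp
  moreover have "0 \<le> Re (ip (x + w *\<^sub>C y) (x + w *\<^sub>C y))"
    by (intro ip_self_nonneg add_closed scaleC_closed x y)
  ultimately show ?thesis by simp
qed

text \<open>Scaling x by s and y by 1/s keeps the inner product and distributes the weight between
  the two terms. The free parameter plays the role of the product form of Cauchy-Schwarz in
  \<open>Parseval_has_sum\<close>.\<close>

lemma norm_ip_le_weighted:
  assumes x: "x \<in> X" and y: "y \<in> X" and s: "s > 0"
  shows "2 * cmod (ip x y) \<le> s\<^sup>2 * Re (ip x x) + Re (ip y y) / s\<^sup>2"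
proof -
  have "2 * cmod (ip (s *\<^sub>C x) (inverse s *\<^sub>C y))
      \<le> Re (ip (s *\<^sub>C x) (s *\<^sub>C x)) + Re (ip (inverse s *\<^sub>C y) (inverse s *\<^sub>C y))"
    by (intro norm_ip_le scaleC_closed x y)
  then show ?thesis
    using x y s
    by (simp add: ip_scaleC_left ip_scaleC_right scaleC_closed norm_mult norm_inverse
        power2_eq_square divide_simps mult_ac flip: of_real_mult)
qed

end

lemma sum4: "(\<Sum>j<4. f j) = f 0 + f 1 + f 2 + f (3::nat)"
  by (simp add: eval_nat_numeral)

lemma i_pow_simps: "\<i> ^ 2 = -1" "\<i> ^ 3 = -\<i>" 
  by (simp_all add: power3_eq_cube)

subsection \<open>Integrals with respect to projection-valued measures\<close>

text \<open>Both sums stand for a complex measure written as a finite combination of densities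
  against positive measures, the shape produced by polarization. Equality on sets extends to simple
  functions by linearity and to \<open>k\<close> by dominated convergence, with simple approximants
  bounded by twice the modulus of \<open>k\<close>.\<close>

lemma sum_integral_eqI:
  fixes h :: "'i \<Rightarrow> 's \<Rightarrow> complex" and h' :: "'j \<Rightarrow> 's \<Rightarrow> complex" and k :: "'s \<Rightarrow> complex"
  assumes fin: "finite I" "finite J"
    and sets_M: "\<And>i. i \<in> I \<Longrightarrow> sets (M i) = sets N"
    and sets_M': "\<And>j. j \<in> J \<Longrightarrow> sets (M' j) = sets N"
    and h: "\<And>i. i \<in> I \<Longrightarrow> integrable (M i) (h i)"
    and h': "\<And>j. j \<in> J \<Longrightarrow> integrable (M' j) (h' j)"
    and eq: "\<And>A. A \<in> sets N \<Longrightarrow>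
      (\<Sum>i\<in>I. \<integral>s. indicator A s * h i s \<partial>M i) = (\<Sum>j\<in>J. \<integral>s. indicator A s * h' j s \<partial>M' j)"
    and k: "k \<in> borel_measurable N"
    and kh: "\<And>i. i \<in> I \<Longrightarrow> integrable (M i) (\<lambda>s. k s * h i s)"
    and kh': "\<And>j. j \<in> J \<Longrightarrow> integrable (M' j) (\<lambda>s. k s * h' j s)"
  shows "(\<Sum>i\<in>I. \<integral>s. k s * h i s \<partial>M i) = (\<Sum>j\<in>J. \<integral>s. k s * h' j s \<partial>M' j)"
proof -
  obtain \<sigma> where \<sigma>: "\<And>n. simple_function N (\<sigma> n)"
    "\<And>s. s \<in> space N \<Longrightarrow> (\<lambda>n. \<sigma> n s) \<longlonglongrightarrow> k s"
    "\<And>n s. s \<in> space N \<Longrightarrow> dist (\<sigma> n s) 0 \<le> 2 * dist (k s) 0"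
    using borel_measurable_implies_sequence_metric[OF k, of 0] by metis
  have simp_int: "integrable K (\<lambda>s. \<sigma> n s * g s) \<and>
      (\<integral>s. \<sigma> n s * g s \<partial>K) = (\<Sum>v\<in>\<sigma> n ` space N. v * (\<integral>s. indicator (\<sigma> n -` {v} \<inter> space N) s * g s \<partial>K))"
    if K: "sets K = sets N" and g: "integrable K g" for K and g :: "'s \<Rightarrow> complex" and n
  proof -
    have sp: "space K = space N" using K by (rule sets_eq_imp_space_eq)
    have fin': "finite (\<sigma> n ` space N)"
      using \<sigma>(1)[of n] by (simp add: simple_function_def)
    have msr: "\<sigma> n -` {v} \<inter> space N \<in> sets K" for v
      using borel_measurable_simple_function[OF \<sigma>(1)[of n]] K
      by (simp add: borel_measurable_vimage)
    have i: "integrable K (\<lambda>s. v * (indicator (\<sigma> n -` {v} \<inter> space N) s * g s))" for v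
    proof (intro integrable_mult_right Bochner_Integration.integrable_bound[OF g])
      show "(\<lambda>s. indicator (\<sigma> n -` {v} \<inter> space N) s * g s) \<in> borel_measurable K"
        using g by (intro borel_measurable_times borel_measurable_indicator msr) simp
    qed (auto simp: indicator_def)
    have e: "\<sigma> n s * g s = (\<Sum>v\<in>\<sigma> n ` space N. v * (indicator (\<sigma> n -` {v} \<inter> space N) s * g s))"
      if "s \<in> space K" for s
    proof -
      have "(\<Sum>v\<in>\<sigma> n ` space N. v * (indicator (\<sigma> n -` {v} \<inter> space N) s * g s))
        = (\<Sum>v\<in>\<sigma> n ` space N. if v = \<sigma> n s then v * g s else 0)"
        using that sp by (intro sum.cong) (auto simp: indicator_def)
      also have "\<dots> = \<sigma> n s * g s"
        using that sp fin' by simp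
      finally show ?thesis by simp
    qed
    have "integrable K (\<lambda>s. \<sigma> n s * g s) \<longleftrightarrow>
      integrable K (\<lambda>s. \<Sum>v\<in>\<sigma> n ` space N. v * (indicator (\<sigma> n -` {v} \<inter> space N) s * g s))"
      by (intro Bochner_Integration.integrable_cong refl e)
    moreover have "(\<integral>s. \<sigma> n s * g s \<partial>K) =
      (\<integral>s. (\<Sum>v\<in>\<sigma> n ` space N. v * (indicator (\<sigma> n -` {v} \<inter> space N) s * g s)) \<partial>K)"
      by (intro Bochner_Integration.integral_cong refl e)
    ultimately show ?thesis
      using i by (subst (asm) Bochner_Integration.integral_sum) auto
  qed
  have lim: "(\<lambda>n. \<integral>s. \<sigma> n s * g s \<partial>K) \<longlonglongrightarrow> (\<integral>s. k s * g s \<partial>K)"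
    if K: "sets K = sets N" and g: "integrable K g" and kg: "integrable K (\<lambda>s. k s * g s)"
    for K and g :: "'s \<Rightarrow> complex"
  proof (rule integral_dominated_convergence)
    have sp: "space K = space N" using K by (rule sets_eq_imp_space_eq)
    show "integrable K (\<lambda>s. 2 * norm (k s * g s))"
      using kg by auto
    show "AE s in K. (\<lambda>n. \<sigma> n s * g s) \<longlonglongrightarrow> k s * g s"
      using \<sigma>(2) sp by (intro AE_I2 tendsto_mult tendsto_const) auto
    show "AE s in K. norm (\<sigma> n s * g s) \<le> 2 * norm (k s * g s)" for n
      using \<sigma>(3)[of _ n] sp by (intro AE_I2) (auto simp: norm_mult mult.assoc[symmetric] intro!: mult_right_mono)
    show "(\<lambda>s. \<sigma> n s * g s) \<in> borel_measurable K" for n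
      using simp_int[OF K g, of n] by auto
    show "(\<lambda>s. k s * g s) \<in> borel_measurable K" using kg by auto
  qed
  have "(\<lambda>n. \<Sum>i\<in>I. \<integral>s. \<sigma> n s * h i s \<partial>M i) \<longlonglongrightarrow> (\<Sum>i\<in>I. \<integral>s. k s * h i s \<partial>M i)"
    by (intro tendsto_sum lim sets_M h kh)
  moreover have "(\<lambda>n. \<Sum>j\<in>J. \<integral>s. \<sigma> n s * h' j s \<partial>M' j) \<longlonglongrightarrow> (\<Sum>j\<in>J. \<integral>s. k s * h' j s \<partial>M' j)"
    by (intro tendsto_sum lim sets_M' h' kh')
  moreover have "(\<Sum>i\<in>I. \<integral>s. \<sigma> n s * h i s \<partial>M i) = (\<Sum>j\<in>J. \<integral>s. \<sigma> n s * h' j s \<partial>M' j)" for n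
  proof -
    have msr: "\<sigma> n -` {v} \<inter> space N \<in> sets N" if "v \<in> \<sigma> n ` space N" for v
      using \<sigma>(1)[of n] that by (auto simp: simple_function_def)
    have "(\<Sum>i\<in>I. \<integral>s. \<sigma> n s * h i s \<partial>M i) = (\<Sum>v\<in>\<sigma> n ` space N. v * (\<Sum>i\<in>I. \<integral>s. indicator (\<sigma> n -` {v} \<inter> space N) s * h i s \<partial>M i))"
      using simp_int[OF sets_M h] by (simp add: sum_distrib_left) (rule sum.swap)
    also have "\<dots> = (\<Sum>v\<in>\<sigma> n ` space N. v * (\<Sum>j\<in>J. \<integral>s. indicator (\<sigma> n -` {v} \<inter> space N) s * h' j s \<partial>M' j))"
      by (intro sum.cong refl arg_cong2[where f="(*)"] eq msr)
    also have "\<dots> = (\<Sum>j\<in>J. \<integral>s. \<sigma> n s * h' j s \<partial>M' j)"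
      using simp_int[OF sets_M' h'] by (simp add: sum_distrib_left) (rule sum.swap)
    finally show ?thesis .
  qed
  ultimately show ?thesis using LIMSEQ_unique by auto
qed

text \<open>Among the four terms only \<open>a * b x y\<close> survives: weighted by the inverse
  powers of \<open>\<i>\<close>, the constant terms and the conjugate-linear term sum to zero.
  Sesquilinearity is requested only as this one expansion, so the lemma applies to forms that are
  sesquilinear on a carrier only.\<close>

lemma sum_polarization:
  fixes b :: "'v::complex_vector \<Rightarrow> 'v \<Rightarrow> complex"
  assumes "\<And>a. b (x + a *\<^sub>C y) (x + a *\<^sub>C y) = b x x + a * b x y + cnj a * b y x + cnj a * a * b y y"
  shows "(\<Sum>j<4. inverse (\<i> ^ j) * b (x + \<i> ^ j *\<^sub>C y) (x + \<i> ^ j *\<^sub>C y)) / 4 = b x y"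
  unfolding assms sum4 by (simp add: i_pow_simps algebra_simps)

locale pvm_space = semi_inner X ip
  for X :: "'v::complex_vector set" and ip :: "'v \<Rightarrow> 'v \<Rightarrow> complex" +
  fixes M :: "'s measure" and F :: "'s set \<Rightarrow> 'v \<Rightarrow> 'v"
  assumes pvm: "pvm M X ip F"
begin

abbreviation pm :: "'v \<Rightarrow> 's measure" where
  "pm \<equiv> pvm_measure M ip F"

text \<open>Together with \<open>pintegrable\<close> this splits the relation
  \<open>has_pvm_integral\<close> into a total function and a side condition, so that integrals can
  be computed by equations.\<close>

definition pint :: "('s \<Rightarrow> complex) \<Rightarrow> 'v \<Rightarrow> 'v \<Rightarrow> complex" where
  "pint k x y = (\<Sum>j<4. inverse (\<i> ^ j) * integral\<^sup>L (pm (x + \<i> ^ j *\<^sub>C y)) k) / 4"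

definition pintegrable :: "('s \<Rightarrow> complex) \<Rightarrow> 'v \<Rightarrow> 'v \<Rightarrow> bool" where
  "pintegrable k x y \<longleftrightarrow> (\<forall>j<4. integrable (pm (x + \<i> ^ j *\<^sub>C y)) k)"

lemma has_pvm_integral_iff: "has_pvm_integral M ip F k x y c \<longleftrightarrow> pintegrable k x y \<and> c = pint k x y"
  by (simp add: has_pvm_integral_def pint_def pintegrable_def)

lemma proj_closed: "A \<in> sets M \<Longrightarrow> x \<in> X \<Longrightarrow> F A x \<in> X"
  and proj_sym: "A \<in> sets M \<Longrightarrow> x \<in> X \<Longrightarrow> y \<in> X \<Longrightarrow> ip (F A x) y = ip x (F A y)"
  and proj_idem: "A \<in> sets M \<Longrightarrow> x \<in> X \<Longrightarrow> y \<in> X \<Longrightarrow> ip x (F A (F A y)) = ip x (F A y)"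
  and proj_space: "x \<in> X \<Longrightarrow> y \<in> X \<Longrightarrow> ip x (F (space M) y) = ip x y"
  and proj_Int: "A \<in> sets M \<Longrightarrow> B \<in> sets M \<Longrightarrow> x \<in> X \<Longrightarrow> y \<in> X \<Longrightarrow>
    ip x (F (A \<inter> B) y) = ip x (F A (F B y))"
  and proj_sums: "range C \<subseteq> sets M \<Longrightarrow> disjoint_family C \<Longrightarrow> x \<in> X \<Longrightarrow> y \<in> X \<Longrightarrow>
    (\<lambda>n. ip x (F (C n) y)) sums ip x (F (\<Union>n. C n) y)"
proof -
  have 1: "\<forall>A\<in>sets M. orth_projection X ip (F A)"
    and 2: "\<forall>x\<in>X. \<forall>y\<in>X. ip x (F (space M) y) = ip x y"
    and 3: "\<forall>A\<in>sets M. \<forall>B\<in>sets M. \<forall>x\<in>X. \<forall>y\<in>X. ip x (F (A \<inter> B) y) = ip x (F A (F B y))"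
    and 4: "\<forall>A :: nat \<Rightarrow> 's set. range A \<subseteq> sets M \<longrightarrow> disjoint_family A \<longrightarrow>
        (\<forall>x\<in>X. \<forall>y\<in>X. (\<lambda>n. ip x (F (A n) y)) sums ip x (F (\<Union>n. A n) y))"
    using pvm unfolding pvm_def by blast+
  show "A \<in> sets M \<Longrightarrow> x \<in> X \<Longrightarrow> F A x \<in> X"
    using 1 by (auto simp: orth_projection_def image_subset_iff)
  show "A \<in> sets M \<Longrightarrow> x \<in> X \<Longrightarrow> y \<in> X \<Longrightarrow> ip (F A x) y = ip x (F A y)"
    using 1 by (simp add: orth_projection_def)
  show "A \<in> sets M \<Longrightarrow> x \<in> X \<Longrightarrow> y \<in> X \<Longrightarrow> ip x (F A (F A y)) = ip x (F A y)"
    using 1 by (simp add: orth_projection_def)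
  show "x \<in> X \<Longrightarrow> y \<in> X \<Longrightarrow> ip x (F (space M) y) = ip x y"
    using 2 by simp
  show "A \<in> sets M \<Longrightarrow> B \<in> sets M \<Longrightarrow> x \<in> X \<Longrightarrow> y \<in> X \<Longrightarrow>
    ip x (F (A \<inter> B) y) = ip x (F A (F B y))"
    using 3 by simp
  show "range C \<subseteq> sets M \<Longrightarrow> disjoint_family C \<Longrightarrow> x \<in> X \<Longrightarrow> y \<in> X \<Longrightarrow>
    (\<lambda>n. ip x (F (C n) y)) sums ip x (F (\<Union>n. C n) y)"
    using 4 by blast
qed

text \<open>The empty set is a disjoint union of countably many copies of itself, and a constant
  series converges only if its term is zero.\<close>

lemma proj_empty: "x \<in> X \<Longrightarrow> y \<in> X \<Longrightarrow> ip x (F {} y) = 0"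
  using proj_sums[of "\<lambda>_. {}" x y]
  by (auto simp: disjoint_family_on_def LIMSEQ_const_iff dest!: sums_summable summable_LIMSEQ_zero)

lemma form_self: "A \<in> sets M \<Longrightarrow> x \<in> X \<Longrightarrow> ip x (F A x) = ip (F A x) (F A x)"
  using proj_sym[of A x "F A x"] by (simp add: proj_closed proj_idem)

lemma form_nonneg: "A \<in> sets M \<Longrightarrow> x \<in> X \<Longrightarrow> 0 \<le> Re (ip x (F A x))"
  by (simp add: form_self ip_self_nonneg proj_closed)

lemma form_real: "A \<in> sets M \<Longrightarrow> x \<in> X \<Longrightarrow> ip x (F A x) = complex_of_real (Re (ip x (F A x)))"
  by (simp only: form_self) (rule ip_self_real, rule proj_closed)

lemma form_add_right: "A \<in> sets M \<Longrightarrow> x \<in> X \<Longrightarrow> y \<in> X \<Longrightarrow> z \<in> X \<Longrightarrow>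
    ip x (F A (y + z)) = ip x (F A y) + ip x (F A z)"
  by (simp flip: proj_sym add: add_closed ip_add_right proj_closed)

lemma form_scaleC_right: "A \<in> sets M \<Longrightarrow> x \<in> X \<Longrightarrow> y \<in> X \<Longrightarrow>
    ip x (F A (a *\<^sub>C y)) = a * ip x (F A y)"
  by (simp flip: proj_sym add: scaleC_closed ip_scaleC_right proj_closed)

lemma form_polarization:
  assumes A: "A \<in> sets M" and x: "x \<in> X" and y: "y \<in> X"
  shows "(\<Sum>j<4. inverse (\<i> ^ j) * ip (x + \<i> ^ j *\<^sub>C y) (F A (x + \<i> ^ j *\<^sub>C y))) / 4 = ip x (F A y)"
  by (rule sum_polarization[where b="\<lambda>x y. ip x (F A y)"])
    (use A x y in \<open>simp add: form_add_right form_scaleC_right ip_add_left ip_scaleC_left add_closed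
      scaleC_closed proj_closed algebra_simps\<close>)

lemma space_pm [simp]: "space (pm x) = space M"
  and sets_pm [simp, measurable_cong]: "sets (pm x) = sets M"
  by (simp_all add: pvm_measure_def sets.space_closed sets.sigma_sets_eq)

lemma emeasure_pm:
  assumes A: "A \<in> sets M" and x: "x \<in> X"
  shows "emeasure (pm x) A = ennreal (Re (ip x (F A x)))"
proof (rule emeasure_measure_of[where \<Omega>="space M" and A="sets M"])
  show "pm x = measure_of (space M) (sets M) (\<lambda>A. ennreal (Re (ip x (F A x))))"
    by (simp add: pvm_measure_def)
  show "positive (sets (pm x)) (\<lambda>A. ennreal (Re (ip x (F A x))))"
    by (simp add: positive_def proj_empty x)
  show "countably_additive (sets (pm x)) (\<lambda>A. ennreal (Re (ip x (F A x))))"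
  proof (rule countably_additiveI)
    fix C :: "nat \<Rightarrow> 's set"
    assume C: "range C \<subseteq> sets (pm x)" "disjoint_family C"
    then have "(\<lambda>n. Re (ip x (F (C n) x))) sums Re (ip x (F (\<Union>n. C n) x))"
      by (intro sums_Re proj_sums x) auto
    then show "(\<Sum>n. ennreal (Re (ip x (F (C n) x)))) = ennreal (Re (ip x (F (\<Union>n. C n) x)))"
      using C by (intro suminf_ennreal_eq form_nonneg x) auto
  qed
qed (use A sets.space_closed in auto)

lemma finite_measure_pm: "x \<in> X \<Longrightarrow> finite_measure (pm x)"
  by (rule finite_measureI) (simp add: emeasure_pm)

lemma measure_pm: "A \<in> sets M \<Longrightarrow> x \<in> X \<Longrightarrow> measure (pm x) A = Re (ip x (F A x))"
  by (simp add: measure_def emeasure_pm form_nonneg)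

lemma polar_closed: "x \<in> X \<Longrightarrow> y \<in> X \<Longrightarrow> x + \<i> ^ j *\<^sub>C y \<in> X"
  by (intro add_closed scaleC_closed)

lemma integrable_pm_bounded:
  fixes k :: "'s \<Rightarrow> complex"
  assumes "x \<in> X" "k \<in> borel_measurable M" "\<And>s. s \<in> space M \<Longrightarrow> cmod (k s) \<le> b"
  shows "integrable (pm x) k"
  by (rule finite_measure.integrable_const_bound[OF finite_measure_pm, where B=b]) (use assms in auto)

lemma pintegrable_bounded:
  assumes "x \<in> X" "y \<in> X" "k \<in> borel_measurable M" "\<And>s. s \<in> space M \<Longrightarrow> cmod (k s) \<le> b"
  shows "pintegrable k x y"
  unfolding pintegrable_def
  by (intro allI impI integrable_pm_bounded[where b=b] polar_closed assms)

lemma pint_indicator: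
  assumes A: "A \<in> sets M" and x: "x \<in> X" and y: "y \<in> X"
  shows "pint (indicator A) x y = ip x (F A y)"
proof -
  have "integral\<^sup>L (pm (x + \<i> ^ j *\<^sub>C y)) (indicator A) = ip (x + \<i> ^ j *\<^sub>C y) (F A (x + \<i> ^ j *\<^sub>C y))" for j
  proof -
    have "has_bochner_integral (pm (x + \<i> ^ j *\<^sub>C y)) (\<lambda>s. indicator A s *\<^sub>R (1::complex))
        (measure (pm (x + \<i> ^ j *\<^sub>C y)) A *\<^sub>R 1)"
      using A by (intro has_bochner_integral_indicator)
        (simp_all add: emeasure_pm polar_closed x y)
    then have "integral\<^sup>L (pm (x + \<i> ^ j *\<^sub>C y)) (indicator A :: _ \<Rightarrow> complex) = 
        complex_of_real (measure (pm (x + \<i> ^ j *\<^sub>C y)) A)"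
      by (auto dest!: has_bochner_integral_integral_eq simp: scaleR_conv_of_real of_real_indicator)
    then show ?thesis
      using form_real[OF A polar_closed[OF x y]] by (simp add: measure_pm[OF A polar_closed[OF x y]])
  qed
  then show ?thesis
    unfolding pint_def by (simp only: form_polarization[OF A x y])
qed

lemma pint_cong: "(\<And>s. s \<in> space M \<Longrightarrow> k s = k' s) \<Longrightarrow> pint k x y = pint k' x y"
  unfolding pint_def by (intro arg_cong2[where f="(/)"] refl sum.cong arg_cong2[where f="(*)"]
      Bochner_Integration.integral_cong) auto

lemma pint_one: "x \<in> X \<Longrightarrow> y \<in> X \<Longrightarrow> pint (\<lambda>_. 1) x y = ip x y"
  using pint_cong[of "\<lambda>_. 1" "indicator (space M)" x y] pint_indicator[of "space M" x y]
  by (simp add: proj_space)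

lemma pintegrable_add: "pintegrable k x y \<Longrightarrow> pintegrable k' x y \<Longrightarrow> pintegrable (\<lambda>s. k s + k' s) x y"
  by (simp add: pintegrable_def)

lemma pintegrable_mult: "pintegrable k x y \<Longrightarrow> pintegrable (\<lambda>s. a * k s) x y"
  by (simp add: pintegrable_def)

lemma pint_add: "pintegrable k x y \<Longrightarrow> pintegrable k' x y \<Longrightarrow>
    pint (\<lambda>s. k s + k' s) x y = pint k x y + pint k' x y"
  by (simp add: pintegrable_def pint_def distrib_left sum.distrib add_divide_distrib)

lemma pint_mult: "pint (\<lambda>s. a * k s) x y = a * pint k x y"
  by (simp add: pint_def sum_distrib_left sum_divide_distrib mult_ac)

lemma pint_bounded_convergence:
  assumes x: "x \<in> X" and y: "y \<in> X"
    and k [measurable]: "\<And>n. k n \<in> borel_measurable M"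
    and l: "l \<in> borel_measurable M"
    and b: "\<And>n s. s \<in> space M \<Longrightarrow> cmod (k n s) \<le> b"
    and lim: "\<And>s. s \<in> space M \<Longrightarrow> (\<lambda>n. k n s) \<longlonglongrightarrow> l s"
  shows "(\<lambda>n. pint (k n) x y) \<longlonglongrightarrow> pint l x y"
  unfolding pint_def
proof (intro tendsto_divide tendsto_sum tendsto_mult tendsto_const)
  fix j
  interpret finite_measure "pm (x + \<i> ^ j *\<^sub>C y)"
    by (intro finite_measure_pm polar_closed x y)
  show "(\<lambda>n. integral\<^sup>L (pm (x + \<i> ^ j *\<^sub>C y)) (k n)) \<longlonglongrightarrow> integral\<^sup>L (pm (x + \<i> ^ j *\<^sub>C y)) l"
    by (rule integral_dominated_convergence[where w="\<lambda>_. b"]) (use l b lim in auto)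
qed simp

text \<open>If the complex measures with densities \<open>g\<close> and \<open>g'\<close> agree on
  sets, they agree on \<open>k\<close>. The fact \<open>alt\<close> moves the polarization weights
  into the densities, which brings both sides to the shape of
  \<open>sum_integral_eqI\<close>.\<close>

lemma pint_eqI:
  assumes "pintegrable g x y" "pintegrable g' x' y'"
    and eq: "\<And>A. A \<in> sets M \<Longrightarrow> pint (\<lambda>s. indicator A s * g s) x y = pint (\<lambda>s. indicator A s * g' s) x' y'"
    and k: "k \<in> borel_measurable M"
    and "pintegrable (\<lambda>s. k s * g s) x y" "pintegrable (\<lambda>s. k s * g' s) x' y'"
  shows "pint (\<lambda>s. k s * g s) x y = pint (\<lambda>s. k s * g' s) x' y'"
proof -
  have alt: "pint (\<lambda>s. f s * g s) x y =
    (\<Sum>j<4. \<integral>s. f s * (g s * (inverse (\<i> ^ j) / 4)) \<partial>pm (x + \<i> ^ j *\<^sub>C y))" for f g x y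
    unfolding pint_def mult.assoc[symmetric]
    by (simp only: Bochner_Integration.integral_mult_left_zero)
      (simp add: sum_distrib_right sum_divide_distrib mult_ac)
  have int: "integrable (pm (x + \<i> ^ j *\<^sub>C y)) (\<lambda>s. f s * c)" if "pintegrable f x y" "j \<in> {..<4}"
    for f c j and x y :: 'v
    using that by (auto simp: pintegrable_def)
  show ?thesis
    unfolding alt
  proof (rule sum_integral_eqI[where N=M])
    show "integrable (pm (x + \<i> ^ j *\<^sub>C y)) (\<lambda>s. k s * (g s * (inverse (\<i> ^ j) / 4)))"
      if "j \<in> {..<4}" for j
      unfolding mult.assoc[symmetric] by (rule int) (use that assms in auto)
    show "integrable (pm (x' + \<i> ^ j *\<^sub>C y')) (\<lambda>s. k s * (g' s * (inverse (\<i> ^ j) / 4)))"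
      if "j \<in> {..<4}" for j
      unfolding mult.assoc[symmetric] by (rule int) (use that assms in auto)
  qed (use int assms(1,2) k eq[unfolded alt] in auto)
qed

text \<open>Since the inner product of F(B)x with F(A)u equals that of x with F(B \<inter> A)u, the
  complex measure of the pair (F(B)x, u) is that of (x, u) restricted to B. Hence a function bounded
  only on B can be integrated for the pair (x, u) after cutting it off.\<close>

lemma pint_localize:
  assumes x: "x \<in> X" and u: "u \<in> X" and B: "B \<in> sets M"
    and h: "h \<in> borel_measurable M" and hi: "pintegrable h (F B x) u"
    and b: "\<And>s. s \<in> B \<Longrightarrow> cmod (h s) \<le> b"
  shows "pint (\<lambda>s. indicator B s * h s) x u = pint h (F B x) u"
proof -
  have "pint (\<lambda>s. h s * 1) (F B x) u = pint (\<lambda>s. h s * indicator B s) x u"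
  proof (rule pint_eqI[OF _ _ _ h])
    show "pint (\<lambda>s. indicator A s * 1) (F B x) u = pint (\<lambda>s. indicator A s * indicator B s) x u"
      if A: "A \<in> sets M" for A
    proof -
      have "pint (\<lambda>s. indicator A s * 1) (F B x) u = ip (F B x) (F A u)"
        using pint_indicator[OF A proj_closed[OF B x] u] by simp
      also have "\<dots> = ip x (F (B \<inter> A) u)"
        using A B x u by (simp add: proj_sym proj_Int proj_closed)
      also have "\<dots> = pint (indicator (B \<inter> A)) x u"
        using A B x u by (simp add: pint_indicator)
      also have "\<dots> = pint (\<lambda>s. indicator A s * indicator B s) x u"
        by (intro pint_cong) (auto simp: indicator_def)
      finally show ?thesis .
    qed
    show "pintegrable (\<lambda>s. h s * indicator B s) x u"
      \<comment> \<open>Off \<open>B\<close> the integrand is zero, so the bound has to be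
        nonnegative; \<open>b\<close> itself may be negative when \<open>B\<close> is empty.\<close>
      by (rule pintegrable_bounded[OF x u, where b="max b 0"])
        (use h B b in \<open>auto simp: indicator_def le_max_iff_disj\<close>)
    show "pintegrable (\<lambda>s. indicator B s) x u"
      by (rule pintegrable_bounded[OF x u, where b=1]) (use B in \<open>auto simp: indicator_def\<close>)
    show "pintegrable (\<lambda>s. 1) (F B x) u"
      by (rule pintegrable_bounded[OF proj_closed[OF B x] u, where b=1]) auto
  qed (use hi in simp)
  then show ?thesis by (simp add: mult.commute)
qed

text \<open>
  If \<open>h\<close> is the symbol of an operator \<open>T\<close>, tested only against vectors of spectral subspaces on
  which \<open>h\<close> is bounded, then \<open>T u = y\<close> gives \<open>u = T\<^sup>-\<^sup>1 y\<close>, and \<open>1/h\<close> is the symbol of \<open>T\<^sup>-\<^sup>1\<close>.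
\<close>

lemma pint_inverse:
  assumes x: "x \<in> X" and y: "y \<in> X" and u: "u \<in> X"
    and h: "h \<in> borel_measurable M" and \<delta>: "\<delta> > 0" "\<And>s. s \<in> space M \<Longrightarrow> \<delta> \<le> cmod (h s)"
    and C: "\<And>n::nat. C n \<in> sets M" "\<And>s. s \<in> space M \<Longrightarrow> eventually (\<lambda>n. s \<in> C n) sequentially"
    and b: "\<And>n s. s \<in> C n \<Longrightarrow> cmod (h s) \<le> b n"
    and eq: "\<And>n B. B \<in> sets M \<Longrightarrow> B \<subseteq> C n \<Longrightarrow> pintegrable h (F B x) u \<and> pint h (F B x) u = ip (F B x) y"
  shows "pint (\<lambda>s. inverse (h s)) x y = ip x u"
proof -
  note [measurable] = C(1) h
  have nz: "h s \<noteq> 0" if "s \<in> space M" for s using \<delta>(1) \<delta>(2)[OF that] by auto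
  have inv_le: "cmod (inverse (h s)) \<le> inverse \<delta>" if "s \<in> space M" for s
    unfolding norm_inverse using \<delta>(1) \<delta>(2)[OF that] by (intro le_imp_inverse_le)
  have ind: "pintegrable (indicator (C n)) x' y'" if "x' \<in> X" "y' \<in> X" for n x' y'
    by (rule pintegrable_bounded[where b=1]) (use that in \<open>auto simp: indicator_def\<close>)
  \<comment> \<open>On subsets of \<open>C n\<close> the hypothesis \<open>eq\<close> says that
    \<open>h\<close> times the measure of (x, u) is the measure of (x, y). Multiplying by the
    bounded function 1/h cancels \<open>h\<close> and leaves the indicator of \<open>C n\<close>,
    which is then let grow to 1.\<close>
  have step: "pint (indicator (C n)) x u = pint (\<lambda>s. inverse (h s) * indicator (C n) s) x y" for n
  proof -
    have hC: "pintegrable (\<lambda>s. indicator (C n) s * h s) x u"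
      by (rule pintegrable_bounded[OF x u, where b="max (b n) 0"])
        (use b in \<open>auto simp: indicator_def le_max_iff_disj\<close>)
    have "pint (\<lambda>s. inverse (h s) * (indicator (C n) s * h s)) x u
      = pint (\<lambda>s. inverse (h s) * indicator (C n) s) x y"
    proof (rule pint_eqI)
      show "pint (\<lambda>s. indicator A s * (indicator (C n) s * h s)) x u
        = pint (\<lambda>s. indicator A s * indicator (C n) s) x y" if A[measurable]: "A \<in> sets M" for A
      proof -
        have B: "A \<inter> C n \<in> sets M" by measurable
        have "pint (\<lambda>s. indicator A s * (indicator (C n) s * h s)) x u = pint (\<lambda>s. indicator (A \<inter> C n) s * h s) x u"
          by (intro pint_cong) (simp add: indicator_def)
        also have "\<dots> = pint h (F (A \<inter> C n) x) u"
          by (rule pint_localize[OF x u B h, where b="b n"]) (use eq[OF B] b in auto)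
        also have "\<dots> = ip (F (A \<inter> C n) x) y" using eq[OF B] by auto
        also have "\<dots> = pint (indicator (A \<inter> C n)) x y"
          by (simp add: pint_indicator[OF B x y] proj_sym[OF B x y])
        also have "\<dots> = pint (\<lambda>s. indicator A s * indicator (C n) s) x y"
          by (intro pint_cong) (simp add: indicator_def)
        finally show ?thesis .
      qed
      show "pintegrable (\<lambda>s. inverse (h s) * (indicator (C n) s * h s)) x u"
        by (rule pintegrable_bounded[OF x u, where b=1])
          (auto simp: indicator_def dest: nz)
      show "pintegrable (\<lambda>s. inverse (h s) * indicator (C n) s) x y"
        by (rule pintegrable_bounded[OF x y, where b="inverse \<delta>"])
          (use inv_le \<delta>(1) in \<open>auto simp: indicator_def\<close>)
    qed (use hC ind x y in auto)
    moreover have "pint (\<lambda>s. inverse (h s) * (indicator (C n) s * h s)) x u = pint (indicator (C n)) x u"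
      by (intro pint_cong) (simp add: nz)
    ultimately show ?thesis by simp
  qed
  have lim: "(\<lambda>n. indicator (C n) s) \<longlonglongrightarrow> (1::complex)" if "s \<in> space M" for s
    by (rule tendsto_eventually) (use C(2)[OF that] in \<open>auto elim: eventually_mono\<close>)
  have "(\<lambda>n. pint (indicator (C n)) x u) \<longlonglongrightarrow> pint (\<lambda>_. 1) x u"
    by (rule pint_bounded_convergence[OF x u, where b=1]) (auto simp: indicator_def intro: lim[unfolded indicator_def])
  moreover have "(\<lambda>n. pint (\<lambda>s. inverse (h s) * indicator (C n) s) x y) \<longlonglongrightarrow> pint (\<lambda>s. inverse (h s)) x y"
  proof (rule pint_bounded_convergence[OF x y, where b="inverse \<delta>"])
    show "(\<lambda>n. inverse (h s) * indicator (C n) s) \<longlonglongrightarrow> inverse (h s)" if "s \<in> space M" for s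
      using tendsto_mult[OF tendsto_const lim[OF that], of "inverse (h s)"] by simp
  qed (use inv_le \<delta>(1) in \<open>auto simp: indicator_def\<close>)
  ultimately show ?thesis
    unfolding step pint_one[OF x u] using LIMSEQ_unique by metis
qed

end

subsection \<open>The space of square integrable functions\<close>

lemma semi_inner_cinner: "semi_inner (UNIV :: 'h::chilbert set) cinner"
proof
  show "cinner x y = cnj (cinner y x)" for x y :: 'h by (rule cinner_commute)
qed (simp_all add: cinner_add_right cinner_scaleC_right cinner_self)

interpretation H: semi_inner "UNIV :: 'h::chilbert set" cinner
  by (rule semi_inner_cinner)

lemma norm_scaleC: "norm (a *\<^sub>C x) = cmod a * norm (x::'h::chilbert)"
proof -
  have "complex_of_real ((norm (a *\<^sub>C x))\<^sup>2) = (cnj a * a) * cinner x x"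
    unfolding cinner_self[symmetric] by (simp add: H.ip_scaleC_left cinner_scaleC_right)
  also have "\<dots> = complex_of_real ((cmod a * norm x)\<^sup>2)"
    using complex_norm_square[of a]
    by (simp add: cinner_self mult.commute[of "cnj a"] power_mult_distrib)
  finally have "(norm (a *\<^sub>C x))\<^sup>2 = (cmod a * norm x)\<^sup>2"
    by (simp only: of_real_eq_iff)
  then show ?thesis by (simp add: power2_eq_iff_nonneg)
qed

lemma scaleC_diff_right: "a *\<^sub>C (x - y) = a *\<^sub>C x - a *\<^sub>C (y::'v::complex_vector)"
  using scaleC_add_right[of a "x - y" y] by (simp add: eq_diff_eq)

lemma scaleC_diff_left: "(a - b) *\<^sub>C x = a *\<^sub>C x - b *\<^sub>C (x::'v::complex_vector)"
  using scaleC_add_left[of "a - b" b x] by (simp add: eq_diff_eq)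

lemma tendsto_scaleC [tendsto_intros]:
  fixes f :: "'a \<Rightarrow> complex" and x :: "'a \<Rightarrow> 'h::chilbert"
  assumes f: "(f \<longlongrightarrow> a) G" and x: "(x \<longlongrightarrow> y) G"
  shows "((\<lambda>n. f n *\<^sub>C x n) \<longlongrightarrow> a *\<^sub>C y) G"
proof (rule Lim_null[THEN iffD2], rule tendsto_norm_zero_cancel, rule Lim_null_comparison)
  show "\<forall>\<^sub>F n in G. norm (norm (f n *\<^sub>C x n - a *\<^sub>C y)) \<le> cmod (f n) * norm (x n - y) + cmod (f n - a) * norm y"
  proof (intro always_eventually allI)
    fix n
    have "f n *\<^sub>C x n - a *\<^sub>C y = f n *\<^sub>C (x n - y) + (f n - a) *\<^sub>C y"
      by (simp add: scaleC_diff_right scaleC_diff_left)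
    then show "norm (norm (f n *\<^sub>C x n - a *\<^sub>C y)) \<le> cmod (f n) * norm (x n - y) + cmod (f n - a) * norm y"
      using norm_triangle_ineq[of "f n *\<^sub>C (x n - y)" "(f n - a) *\<^sub>C y"] by (simp add: norm_scaleC)
  qed
  have "((\<lambda>n. cmod (f n) * norm (x n - y) + cmod (f n - a) * norm y) \<longlongrightarrow> cmod a * norm (y - y) + cmod (a - a) * norm y) G"
    by (intro tendsto_intros f x)
  then show "((\<lambda>n. cmod (f n) * norm (x n - y) + cmod (f n - a) * norm y) \<longlongrightarrow> 0) G" by simp
qed

lemma cinner_polarization:
  "(\<Sum>j<4. inverse (\<i> ^ j) * complex_of_real ((norm (x + \<i> ^ j *\<^sub>C y))\<^sup>2)) / 4 = cinner x (y::'h::chilbert)"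
  unfolding cinner_self[symmetric]
  by (rule sum_polarization)
    (simp add: H.ip_add_left H.ip_scaleC_left cinner_add_right cinner_scaleC_right algebra_simps)

lemma tendsto_cinner [tendsto_intros]:
  fixes x y :: "'a \<Rightarrow> 'h::chilbert"
  assumes "(x \<longlongrightarrow> a) G" and "(y \<longlongrightarrow> b) G"
  shows "((\<lambda>n. cinner (x n) (y n)) \<longlongrightarrow> cinner a b) G"
  unfolding cinner_polarization[symmetric] by (intro tendsto_intros assms) simp

text \<open>Applying the operation to the approximating simple functions only requires
  \<open>c\<close> to preserve limits of sequences. Sums, scalar multiples and inner products are
  all covered, without Borel sets of the possibly nonseparable space H.\<close>

lemma strongly_measurable_compose:
  assumes f: "strongly_measurable M f" and g: "strongly_measurable M g"
    and c: "\<And>u v x y. u \<longlonglongrightarrow> x \<Longrightarrow> v \<longlonglongrightarrow> y \<Longrightarrow> (\<lambda>n. c (u n) (v n)) \<longlonglongrightarrow> c x y"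
  shows "strongly_measurable M (\<lambda>t. c (f t) (g t))"
proof -
  from f obtain s where s: "\<And>n::nat. simple_function M (s n)" "AE t in M. (\<lambda>n. s n t) \<longlonglongrightarrow> f t"
    unfolding strongly_measurable_def by blast
  from g obtain r where r: "\<And>n::nat. simple_function M (r n)" "AE t in M. (\<lambda>n. r n t) \<longlonglongrightarrow> g t"
    unfolding strongly_measurable_def by blast
  have "simple_function M (\<lambda>t. c (s n t) (r n t))" for n
    by (rule simple_function_compose2[OF s(1) r(1)])
  moreover have "AE t in M. (\<lambda>n. c (s n t) (r n t)) \<longlonglongrightarrow> c (f t) (g t)"
    using s(2) r(2) by eventually_elim (rule c)
  ultimately show ?thesis
    unfolding strongly_measurable_def by (intro exI[of _ "\<lambda>n t. c (s n t) (r n t)"]) auto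
qed

lemma borel_measurable_imp_strongly_measurable:
  fixes f :: "'s \<Rightarrow> complex"
  assumes "f \<in> borel_measurable M"
  shows "strongly_measurable M f"
proof -
  obtain s where "\<forall>n. simple_function M (s n)" "\<forall>t\<in>space M. (\<lambda>n. s n t) \<longlonglongrightarrow> f t"
    using borel_measurable_implies_sequence_metric[OF assms, of 0] by blast
  then show ?thesis
    unfolding strongly_measurable_def by (intro exI[of _ s] conjI AE_I2) auto
qed

lemma strongly_measurable_const: "strongly_measurable M (\<lambda>_. c)"
  unfolding strongly_measurable_def by (intro exI[of _ "\<lambda>_ _. c"]) auto

locale interval =
  fixes \<alpha> \<beta> :: real
  assumes less: "\<alpha> < \<beta>"
begin

abbreviation \<mu> :: "real measure" where "\<mu> \<equiv> lebesgue_on {\<alpha>..\<beta>}"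

sublocale \<mu>: finite_measure \<mu>
  using less by (intro finite_measureI) (simp add: emeasure_restrict_space)

text \<open>Lebesgue measure is complete, so an almost everywhere limit of measurable functions is
  measurable. Extension by zero moves the question from the interval to the whole line.\<close>

lemma strongly_measurable_iff: "strongly_measurable \<mu> f \<longleftrightarrow> f \<in> borel_measurable \<mu>"
  for f :: "real \<Rightarrow> complex"
proof
  assume "strongly_measurable \<mu> f"
  then obtain s where s: "\<And>n::nat. simple_function \<mu> (s n)" "AE t in \<mu>. (\<lambda>n. s n t) \<longlonglongrightarrow> f t"
    unfolding strongly_measurable_def by blast
  define g where "g t = lim (\<lambda>n. s n t)" for t
  have "g \<in> borel_measurable \<mu>"
    unfolding g_def by (intro borel_measurable_lim_metric borel_measurable_simple_function s)
  then have "(\<lambda>t. if t \<in> {\<alpha>..\<beta>} then g t else 0) \<in> borel_measurable lebesgue"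
    by (subst borel_measurable_if) auto
  moreover have "AE t in lebesgue. (if t \<in> {\<alpha>..\<beta>} then g t else 0) = (if t \<in> {\<alpha>..\<beta>} then f t else 0)"
    using s(2) by (subst (asm) AE_restrict_space_iff) (auto simp: g_def limI elim!: eventually_mono)
  ultimately have "(\<lambda>t. if t \<in> {\<alpha>..\<beta>} then f t else 0) \<in> borel_measurable lebesgue"
    by (rule borel_measurable_AE)
  then show "f \<in> borel_measurable \<mu>"
    by (subst (asm) borel_measurable_if) auto
qed (rule borel_measurable_imp_strongly_measurable)

lemma L2_iff: "f \<in> L2 \<alpha> \<beta> \<longleftrightarrow> strongly_measurable \<mu> f \<and> integrable \<mu> (\<lambda>t. (norm (f t))\<^sup>2)"
  by (simp add: L2_def)

lemma L2_complex_iff: "f \<in> L2 \<alpha> \<beta> \<longleftrightarrow> f \<in> borel_measurable \<mu> \<and> integrable \<mu> (\<lambda>t. (norm (f t))\<^sup>2)"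
  for f :: "real \<Rightarrow> complex"
  by (simp add: L2_def strongly_measurable_iff)

lemma measurable_cinner:
  assumes "strongly_measurable \<mu> f" "strongly_measurable \<mu> g"
  shows "(\<lambda>t. cinner (f t) (g t)) \<in> borel_measurable \<mu>"
  by (subst strongly_measurable_iff[symmetric], rule strongly_measurable_compose[OF assms])
    (intro tendsto_intros)

lemma measurable_norm:
  fixes f :: "real \<Rightarrow> 'h::chilbert"
  assumes "strongly_measurable \<mu> f"
  shows "(\<lambda>t. norm (f t)) \<in> borel_measurable \<mu>"
proof -
  have "(\<lambda>t. sqrt (Re (cinner (f t) (f t)))) \<in> borel_measurable \<mu>"
    using measurable_cinner[OF assms assms] by measurable
  then show ?thesis by (simp add: cinner_self)
qed

lemma integrable_cinner:
  fixes f :: "real \<Rightarrow> 'h::chilbert"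
  assumes f: "f \<in> L2 \<alpha> \<beta>" and g: "g \<in> L2 \<alpha> \<beta>"
  shows "integrable \<mu> (\<lambda>t. cinner (f t) (g t))"
proof (rule Bochner_Integration.integrable_bound)
  show "integrable \<mu> (\<lambda>t. (norm (f t))\<^sup>2 + (norm (g t))\<^sup>2)"
    using f g by (simp add: L2_iff)
  show "(\<lambda>t. cinner (f t) (g t)) \<in> borel_measurable \<mu>"
    using f g by (intro measurable_cinner) (auto simp: L2_iff)
  have "cmod (cinner x y) \<le> (norm x)\<^sup>2 + (norm y)\<^sup>2" for x y :: 'h
    using H.norm_ip_le[OF UNIV_I UNIV_I, of x y] norm_ge_zero[of "cinner x y"] unfolding cinner_self Re_complex_of_real
    by linarith
  then show "AE t in \<mu>. norm (cinner (f t) (g t)) \<le> norm ((norm (f t))\<^sup>2 + (norm (g t))\<^sup>2)"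
    by (intro AE_I2) simp
qed

lemma L2_add:
  fixes f :: "real \<Rightarrow> 'h::chilbert"
  assumes f: "f \<in> L2 \<alpha> \<beta>" and g: "g \<in> L2 \<alpha> \<beta>"
  shows "(\<lambda>t. f t + g t) \<in> L2 \<alpha> \<beta>"
  unfolding L2_iff
proof
  show sm: "strongly_measurable \<mu> (\<lambda>t. f t + g t)"
    by (rule strongly_measurable_compose) (use f g in \<open>simp_all add: L2_iff tendsto_add\<close>)
  show "integrable \<mu> (\<lambda>t. (norm (f t + g t))\<^sup>2)"
  proof (rule Bochner_Integration.integrable_bound)
    show "integrable \<mu> (\<lambda>t. 2 * (norm (f t))\<^sup>2 + 2 * (norm (g t))\<^sup>2)"
      using f g by (simp add: L2_iff)
    show "(\<lambda>t. (norm (f t + g t))\<^sup>2) \<in> borel_measurable \<mu>"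
      using measurable_norm[OF sm] by measurable
    have "(norm (x + y))\<^sup>2 \<le> 2 * (norm x)\<^sup>2 + 2 * (norm y)\<^sup>2" for x y :: 'h
      using power_mono[OF norm_triangle_ineq[of x y], of 2] sum_squares_bound[of "norm x" "norm y"]
      by (simp add: power2_sum)
    then show "AE t in \<mu>. norm ((norm (f t + g t))\<^sup>2) \<le> norm (2 * (norm (f t))\<^sup>2 + 2 * (norm (g t))\<^sup>2)"
      by (intro AE_I2) simp
  qed
qed

lemma L2_mult:
  assumes \<phi>: "\<phi> \<in> borel_measurable \<mu>" "\<And>t. t \<in> {\<alpha>..\<beta>} \<Longrightarrow> cmod (\<phi> t) \<le> b" and f: "f \<in> L2 \<alpha> \<beta>"
  shows "(\<lambda>t. \<phi> t *\<^sub>C f t :: 'h::chilbert) \<in> L2 \<alpha> \<beta>"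
  unfolding L2_iff
proof
  show sm: "strongly_measurable \<mu> (\<lambda>t. \<phi> t *\<^sub>C f t)"
    by (rule strongly_measurable_compose)
      (use \<phi> f in \<open>simp_all add: L2_iff strongly_measurable_iff tendsto_scaleC\<close>)
  show "integrable \<mu> (\<lambda>t. (norm (\<phi> t *\<^sub>C f t))\<^sup>2)"
  proof (rule Bochner_Integration.integrable_bound)
    show "integrable \<mu> (\<lambda>t. b\<^sup>2 * (norm (f t))\<^sup>2)"
      using f by (simp add: L2_iff)
    show "(\<lambda>t. (norm (\<phi> t *\<^sub>C f t))\<^sup>2) \<in> borel_measurable \<mu>"
      using measurable_norm[OF sm] by measurable
    show "AE t in \<mu>. norm ((norm (\<phi> t *\<^sub>C f t))\<^sup>2) \<le> norm (b\<^sup>2 * (norm (f t))\<^sup>2)"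
      using \<phi>(2) by (intro AE_I2) (auto simp: norm_scaleC power_mult_distrib intro!: mult_right_mono power_mono)
  qed
qed

lemma semi_inner_L2: "semi_inner (L2 \<alpha> \<beta> :: (real \<Rightarrow> 'h::chilbert) set) (l2_inner \<alpha> \<beta>)"
proof
  fix f g h :: "real \<Rightarrow> 'h" and a :: complex
  assume f: "f \<in> L2 \<alpha> \<beta>"
  have "\<And>t. t \<in> {\<alpha>..\<beta>} \<Longrightarrow> cmod a \<le> cmod a" by simp
  then show "a *\<^sub>C f \<in> L2 \<alpha> \<beta>"
    using f unfolding scaleC_fun_def by (intro L2_mult[where b="cmod a"]) simp_all
  have "l2_inner \<alpha> \<beta> f f = (\<integral>t. complex_of_real ((norm (f t))\<^sup>2) \<partial>\<mu>)"
    unfolding l2_inner_def cinner_self ..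
  then have "l2_inner \<alpha> \<beta> f f = complex_of_real (\<integral>t. (norm (f t))\<^sup>2 \<partial>\<mu>)"
    by (simp only: integral_complex_of_real)
  then show "0 \<le> Re (l2_inner \<alpha> \<beta> f f)" by simp
  assume g: "g \<in> L2 \<alpha> \<beta>"
  show "f + g \<in> L2 \<alpha> \<beta>"
    unfolding plus_fun_def by (rule L2_add[OF f g])
  show "l2_inner \<alpha> \<beta> f g = cnj (l2_inner \<alpha> \<beta> g f)"
    using Bochner_Integration.integral_cnj[of \<mu> "\<lambda>t. cinner (g t) (f t)"]
    by (simp add: l2_inner_def flip: cinner_commute)
  show "l2_inner \<alpha> \<beta> f (a *\<^sub>C g) = a * l2_inner \<alpha> \<beta> f g"
    by (simp add: l2_inner_def scaleC_fun_def cinner_scaleC_right)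
  assume h: "h \<in> L2 \<alpha> \<beta>"
  show "l2_inner \<alpha> \<beta> f (g + h) = l2_inner \<alpha> \<beta> f g + l2_inner \<alpha> \<beta> f h"
    by (simp add: l2_inner_def plus_fun_def cinner_add_right integrable_cinner f g h)
qed

lemma tensor_L2: "f \<in> L2 \<alpha> \<beta> \<Longrightarrow> f \<otimes>\<^sub>H (g::'h::chilbert) \<in> L2 \<alpha> \<beta>"
  unfolding L2_iff tensor_def
proof (elim conjE, intro conjI)
  assume "strongly_measurable \<mu> f"
  then show "strongly_measurable \<mu> (\<lambda>t. f t *\<^sub>C g)"
    by (rule strongly_measurable_compose[OF _ strongly_measurable_const[of _ g]]) (intro tendsto_intros)
qed (simp add: norm_scaleC power_mult_distrib)

lemma l2_inner_tensor: "l2_inner \<alpha> \<beta> (f \<otimes>\<^sub>H g) (f' \<otimes>\<^sub>H g') = l2_inner \<alpha> \<beta> f f' * cinner g (g'::'h::chilbert)"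
proof -
  have "cinner ((f \<otimes>\<^sub>H g) t) ((f' \<otimes>\<^sub>H g') t) = cinner (f t) (f' t) * cinner g g'" for t
    by (simp add: tensor_def H.ip_scaleC_left cinner_scaleC_right cinner_complex_def)
  then show ?thesis by (simp add: l2_inner_def)
qed

lemma L2_integrable:
  fixes f :: "real \<Rightarrow> complex"
  assumes "f \<in> L2 \<alpha> \<beta>"
  shows "integrable \<mu> f"
proof (rule Bochner_Integration.integrable_bound)
  show "integrable \<mu> (\<lambda>t. 1 + (norm (f t))\<^sup>2)" "f \<in> borel_measurable \<mu>"
    using assms by (auto simp: L2_complex_iff)
  have "r \<le> 1 + r\<^sup>2" for r :: real
    using sum_squares_bound[of r 1] zero_le_power2[of r] unfolding mult_1_right one_power2
    by linarith
  then show "AE t in \<mu>. norm (f t) \<le> norm (1 + (norm (f t))\<^sup>2)"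
    by (intro AE_I2) simp
qed

lemma measurable_continuous:
  fixes f :: "real \<Rightarrow> complex"
  assumes "continuous_on {\<alpha>..\<beta>} f"
  shows "f \<in> borel_measurable \<mu>"
  using continuous_imp_integrable_real[OF assms] by simp

lemma bounded_continuous:
  fixes f :: "real \<Rightarrow> complex"
  assumes "continuous_on {\<alpha>..\<beta>} f"
  obtains b where "\<And>t. t \<in> {\<alpha>..\<beta>} \<Longrightarrow> cmod (f t) \<le> b"
  using compact_imp_bounded[OF compact_continuous_image[OF assms]] 
  by (auto simp: bounded_iff intro: that)

lemma L2_continuous:
  fixes f :: "real \<Rightarrow> complex"
  assumes "continuous_on {\<alpha>..\<beta>} f"
  shows "f \<in> L2 \<alpha> \<beta>"
  unfolding L2_complex_iff
  by (intro conjI measurable_continuous continuous_imp_integrable_real continuous_intros assms)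

end

subsection \<open>The resolvent of $P_V$\<close>

text \<open>The character \<open>e2pi\<close> at complex arguments: solutions of the resolvent
  equation at non-real z grow or decay exponentially.\<close>

definition e2c :: "complex \<Rightarrow> complex" where
  "e2c z = exp (\<i> * 2 * complex_of_real pi * z)"

lemma e2pi_eq: "e2pi r = e2c (complex_of_real r)"
  by (simp add: e2pi_def e2c_def)

lemma e2c_add: "e2c (z + w) = e2c z * e2c w"
  by (simp add: e2c_def exp_add distrib_left)

lemma e2c_0 [simp]: "e2c 0 = 1"
  by (simp add: e2c_def)

lemma e2c_nonzero [simp]: "e2c z \<noteq> 0"
  by (simp add: e2c_def)

lemma e2c_minus: "e2c (- z) = inverse (e2c z)"
  by (simp add: e2c_def exp_minus)

lemma e2c_int [simp]: "e2c (of_int m) = 1"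
  by (simp add: e2c_def exp_eq_1)

lemma norm_e2c: "cmod (e2c z) = exp (- 2 * pi * Im z)"
  by (simp add: e2c_def norm_exp_eq_Re)

lemma cnj_e2c: "cnj (e2c z) = e2c (- cnj z)"
  by (simp add: e2c_def exp_cnj)

lemma continuous_on_e2c [continuous_intros]: "continuous_on S f \<Longrightarrow> continuous_on S (\<lambda>t. e2c (f t))"
  unfolding e2c_def by (intro continuous_intros)

lemma has_vector_derivative_e2c:
  "((\<lambda>t. e2c (z * complex_of_real t)) has_vector_derivative
    \<i> * 2 * complex_of_real pi * z * e2c (z * complex_of_real t)) (at t within S)"
  unfolding e2c_def
  by (rule has_vector_derivative_real_field) (auto intro!: derivative_eq_intros)

section \<open>Variation of constants and weak derivatives on the interval\<close>

context interval
begin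

definition primitive :: "(real \<Rightarrow> complex) \<Rightarrow> real \<Rightarrow> complex" where
  "primitive g t = (LINT s|lebesgue_on {\<alpha>..t}. g s)"

lemma primitive_start: "primitive g \<alpha> = 0"
  unfolding primitive_def
proof (rule integral_eq_zero_AE)
  show "AE s in lebesgue_on {\<alpha>..\<alpha>}. g s = 0"
    by (rule AE_I'[of "{\<alpha>}"]) (auto simp: null_sets_restrict_space)
qed

lemma continuous_on_primitive: "integrable \<mu> g \<Longrightarrow> continuous_on {\<alpha>..\<beta>} (primitive g)"
  unfolding primitive_def by (rule indefinite_integral_continuous_real)

lemma integral_lebesgue_on_subset:
  fixes g :: "real \<Rightarrow> complex"
  assumes "S \<in> sets lebesgue" "S \<subseteq> {\<alpha>..\<beta>}"
  shows "(LINT s|lebesgue_on S. g s) = (\<integral>s. (if s \<in> S then g s else 0) \<partial>\<mu>)"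
proof -
  have "(LINT s|lebesgue_on S. g s) = (LINT s|lebesgue. indicator S s *\<^sub>R g s)"
    using assms by (simp add: integral_restrict_space)
  also have "\<dots> = (LINT s|lebesgue. indicator {\<alpha>..\<beta>} s *\<^sub>R (if s \<in> S then g s else 0))"
    using assms by (intro Bochner_Integration.integral_cong) (auto simp: indicator_def)
  also have "\<dots> = (\<integral>s. (if s \<in> S then g s else 0) \<partial>\<mu>)"
    by (simp add: integral_restrict_space)
  finally show ?thesis .
qed

lemma integrable_mult_continuous:
  fixes \<phi> g :: "real \<Rightarrow> complex"
  assumes \<phi>: "continuous_on {\<alpha>..\<beta>} \<phi>" and g: "integrable \<mu> g"
  shows "integrable \<mu> (\<lambda>s. \<phi> s * g s)"
proof -
  obtain b where b: "\<And>t. t \<in> {\<alpha>..\<beta>} \<Longrightarrow> cmod (\<phi> t) \<le> b"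
    using bounded_continuous[OF \<phi>] by blast
  note [measurable] = measurable_continuous[OF \<phi>] borel_measurable_integrable[OF g]
  show ?thesis
  proof (rule Bochner_Integration.integrable_bound)
    show "integrable \<mu> (\<lambda>s. b * cmod (g s))" using g by simp
    show "(\<lambda>s. \<phi> s * g s) \<in> borel_measurable \<mu>" by measurable
    show "AE s in \<mu>. norm (\<phi> s * g s) \<le> norm (b * cmod (g s))"
      using order_trans[OF norm_ge_zero b] b by (intro AE_I2) (auto simp: norm_mult intro!: mult_right_mono)
  qed
qed

text \<open>Fubini on the triangle s \<le> t: integrating \<open>\<phi>' t * g s\<close> over t
  first gives \<open>(\<phi> \<beta> - \<phi> s) * g s\<close>. As \<open>g\<close> is only
  integrable, its primitive need not be differentiable everywhere, so the fundamental theorem of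
  calculus is applied to \<open>\<phi>\<close> alone.\<close>

lemma integration_by_parts_primitive:
  fixes \<phi> g :: "real \<Rightarrow> complex"
  assumes g: "integrable \<mu> g"
    and \<phi>': "continuous_on {\<alpha>..\<beta>} \<phi>'"
    and D: "\<And>t. t \<in> {\<alpha>..\<beta>} \<Longrightarrow> (\<phi> has_vector_derivative \<phi>' t) (at t within {\<alpha>..\<beta>})"
  shows "(\<integral>t. \<phi>' t * primitive g t \<partial>\<mu>) = \<phi> \<beta> * primitive g \<beta> - (\<integral>t. \<phi> t * g t \<partial>\<mu>)"
proof -
  interpret P: pair_sigma_finite \<mu> \<mu>
    by (intro pair_sigma_finite.intro \<mu>.sigma_finite_measure_axioms)
  obtain b where b: "\<And>t. t \<in> {\<alpha>..\<beta>} \<Longrightarrow> cmod (\<phi>' t) \<le> b"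
    using bounded_continuous[OF \<phi>'] by blast
  have c\<phi>: "continuous_on {\<alpha>..\<beta>} \<phi>"
    using D by (rule continuous_on_vector_derivative)
  note [measurable] = measurable_continuous[OF \<phi>'] borel_measurable_integrable[OF g]
  have [measurable]: "(\<lambda>t. t) \<in> borel_measurable \<mu>"
    by (simp add: measurable_restrict_space1 measurable_completion)
  define f where "f t s = (if s \<le> t then \<phi>' t * g s else 0)" for t s
  have [measurable]: "(\<lambda>(t, s). f t s) \<in> borel_measurable (\<mu> \<Otimes>\<^sub>M \<mu>)"
    unfolding f_def by measurable
  have f_le: "cmod (f t s) \<le> b * cmod (g s)" if "t \<in> {\<alpha>..\<beta>}" for t s
    using b[OF that] order_trans[OF norm_ge_zero b[OF that]]
    by (auto simp: f_def norm_mult intro: mult_right_mono)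
  have f_int: "integrable \<mu> (f t)" if t: "t \<in> {\<alpha>..\<beta>}" for t
  proof (rule Bochner_Integration.integrable_bound)
    show "integrable \<mu> (\<lambda>s. b * cmod (g s))" using g by simp
    show "f t \<in> borel_measurable \<mu>" unfolding f_def by measurable
    show "AE s in \<mu>. norm (f t s) \<le> norm (b * cmod (g s))"
      using f_le[OF t] by (intro AE_I2) (auto intro: order_trans[OF _ abs_ge_self])
  qed
  have int: "integrable (\<mu> \<Otimes>\<^sub>M \<mu>) (\<lambda>(t, s). f t s)"
  proof (rule P.Fubini_integrable)
    show "integrable \<mu> (\<lambda>t. \<integral>s. norm (case (t, s) of (t, s) \<Rightarrow> f t s) \<partial>\<mu>)"
    proof (rule \<mu>.integrable_const_bound)
      show "AE t in \<mu>. norm (\<integral>s. norm (case (t, s) of (t, s) \<Rightarrow> f t s) \<partial>\<mu>) \<le> (\<integral>s. b * cmod (g s) \<partial>\<mu>)"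
      proof (rule AE_I2)
        fix t assume "t \<in> space \<mu>"
        then have t: "t \<in> {\<alpha>..\<beta>}" by simp
        have "(\<integral>s. norm (f t s) \<partial>\<mu>) \<le> (\<integral>s. b * cmod (g s) \<partial>\<mu>)"
          using f_int[OF t] g f_le[OF t] by (intro integral_mono) auto
        then show "norm (\<integral>s. norm (case (t, s) of (t, s) \<Rightarrow> f t s) \<partial>\<mu>) \<le> (\<integral>s. b * cmod (g s) \<partial>\<mu>)"
          by simp
      qed
    qed measurable
    show "AE t in \<mu>. integrable \<mu> (\<lambda>s. case (t, s) of (t, s) \<Rightarrow> f t s)"
      using f_int by (intro AE_I2) simp
  qed measurable
  have "(\<integral>t. \<phi>' t * primitive g t \<partial>\<mu>) = (\<integral>t. \<integral>s. f t s \<partial>\<mu> \<partial>\<mu>)"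
  proof (rule Bochner_Integration.integral_cong[OF refl])
    fix t assume "t \<in> space \<mu>"
    then have t: "t \<in> {\<alpha>..\<beta>}" by simp
    have "\<phi>' t * primitive g t = \<phi>' t * (\<integral>s. (if s \<in> {\<alpha>..t} then g s else 0) \<partial>\<mu>)"
      unfolding primitive_def using t by (subst integral_lebesgue_on_subset) auto
    also have "\<dots> = (\<integral>s. \<phi>' t * (if s \<in> {\<alpha>..t} then g s else 0) \<partial>\<mu>)"
      by simp
    also have "\<dots> = (\<integral>s. f t s \<partial>\<mu>)"
      by (intro Bochner_Integration.integral_cong) (auto simp: f_def)
    finally show "\<phi>' t * primitive g t = (\<integral>s. f t s \<partial>\<mu>)" .
  qed
  also have "\<dots> = (\<integral>s. \<integral>t. f t s \<partial>\<mu> \<partial>\<mu>)"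
    using P.Fubini_integral[OF int] by simp
  also have "\<dots> = (\<integral>s. (\<phi> \<beta> - \<phi> s) * g s \<partial>\<mu>)"
  proof (rule Bochner_Integration.integral_cong[OF refl])
    fix s assume "s \<in> space \<mu>"
    then have s: "s \<in> {\<alpha>..\<beta>}" by simp
    have "(\<phi>' has_integral \<phi> \<beta> - \<phi> s) {s..\<beta>}"
    proof (rule fundamental_theorem_of_calculus)
      fix x assume "x \<in> {s..\<beta>}"
      then show "(\<phi> has_vector_derivative \<phi>' x) (at x within {s..\<beta>})"
        using s by (intro has_vector_derivative_within_subset[OF D]) auto
    qed (use s in simp)
    moreover have "integrable (lebesgue_on {s..\<beta>}) \<phi>'"
      using s by (intro continuous_imp_integrable_real continuous_on_subset[OF \<phi>']) auto
    ultimately have "\<phi> \<beta> - \<phi> s = (LINT t|lebesgue_on {s..\<beta>}. \<phi>' t)"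
      by (simp add: lebesgue_integral_eq_integral integral_unique)
    also have "\<dots> = (\<integral>t. (if t \<in> {s..\<beta>} then \<phi>' t else 0) \<partial>\<mu>)"
      using s by (intro integral_lebesgue_on_subset) auto
    finally have "(\<phi> \<beta> - \<phi> s) * g s = (\<integral>t. (if t \<in> {s..\<beta>} then \<phi>' t else 0) * g s \<partial>\<mu>)"
      by simp
    also have "\<dots> = (\<integral>t. f t s \<partial>\<mu>)"
      by (intro Bochner_Integration.integral_cong) (auto simp: f_def)
    finally show "(\<integral>t. f t s \<partial>\<mu>) = (\<phi> \<beta> - \<phi> s) * g s" ..
  qed
  also have "\<dots> = (\<integral>s. \<phi> \<beta> * g s - \<phi> s * g s \<partial>\<mu>)"
    by (simp add: left_diff_distrib)
  also have "\<dots> = \<phi> \<beta> * (\<integral>s. g s \<partial>\<mu>) - (\<integral>s. \<phi> s * g s \<partial>\<mu>)"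
    using integrable_mult_continuous[OF c\<phi> g] g by simp
  finally show ?thesis by (simp add: primitive_def)
qed

text \<open>The variation of constants formula. Here \<open>c\<close> is the initial value up to the
  factor e(z \<alpha>). The coefficient \<open>\<gamma>\<close> of the source is a parameter because
  pairing the H-valued solution with a vector h produces the source \<open>cinner h g\<close> times
  f.\<close>

definition bvp :: "complex \<Rightarrow> complex \<Rightarrow> complex \<Rightarrow> (real \<Rightarrow> complex) \<Rightarrow> real \<Rightarrow> complex" where
  "bvp z c \<gamma> f t = e2c (z * complex_of_real t) *
     (c + \<gamma> * primitive (\<lambda>s. e2c (- z * complex_of_real s) * f s) t)"

lemma continuous_on_bvp: "integrable \<mu> f \<Longrightarrow> continuous_on {\<alpha>..\<beta>} (bvp z c \<gamma> f)"
  unfolding bvp_def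
  by (intro continuous_intros continuous_on_primitive integrable_mult_continuous)

lemma bvp_start: "bvp z c \<gamma> f \<alpha> = e2c (z * complex_of_real \<alpha>) * c"
  by (simp add: bvp_def primitive_start)

text \<open>\<open>w = bvp z c \<gamma> f\<close> is a weak solution of \<open>w' = 2 \<pi> \<i> z w + \<gamma> f\<close>.\<close>

lemma bvp_integration_by_parts:
  assumes f: "integrable \<mu> f"
    and \<phi>': "continuous_on {\<alpha>..\<beta>} \<phi>'"
    and D: "\<And>t. t \<in> {\<alpha>..\<beta>} \<Longrightarrow> (\<phi> has_vector_derivative \<phi>' t) (at t within {\<alpha>..\<beta>})"
  shows "(\<integral>t. \<phi>' t * bvp z c \<gamma> f t \<partial>\<mu>) = \<phi> \<beta> * bvp z c \<gamma> f \<beta> - \<phi> \<alpha> * bvp z c \<gamma> f \<alpha>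
    - (\<integral>t. \<phi> t * (\<i> * 2 * complex_of_real pi * z * bvp z c \<gamma> f t + \<gamma> * f t) \<partial>\<mu>)"
proof -
  define g where "g = (\<lambda>s. e2c (- z * complex_of_real s) * f s)"
  \<comment> \<open>The solution is e(zt) times \<open>c + \<gamma> * primitive g t\<close>. Moving
    the exponential into the test function makes the derivative of \<open>\<psi>\<close> collect
    both the term with the derivative of \<open>\<phi>\<close> and the zeroth order term of the
    equation.\<close>
  define \<psi> where "\<psi> t = \<phi> t * e2c (z * complex_of_real t)" for t
  define \<psi>' where "\<psi>' t = \<phi> t * (\<i> * 2 * complex_of_real pi * z * e2c (z * complex_of_real t))
    + \<phi>' t * e2c (z * complex_of_real t)" for t
  have c\<phi>: "continuous_on {\<alpha>..\<beta>} \<phi>"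
    using D by (rule continuous_on_vector_derivative)
  have g: "integrable \<mu> g"
    unfolding g_def by (intro integrable_mult_continuous f continuous_intros)
  have c\<psi>': "continuous_on {\<alpha>..\<beta>} \<psi>'"
    unfolding \<psi>'_def by (intro continuous_intros c\<phi> \<phi>')
  have D\<psi>: "(\<psi> has_vector_derivative \<psi>' t) (at t within {\<alpha>..\<beta>})" if "t \<in> {\<alpha>..\<beta>}" for t
    unfolding \<psi>_def \<psi>'_def
    by (intro has_vector_derivative_mult D that has_vector_derivative_e2c)
  have "(\<psi>' has_integral \<psi> \<beta> - \<psi> \<alpha>) {\<alpha>..\<beta>}"
    using less D\<psi> by (intro fundamental_theorem_of_calculus) auto
  then have ftc: "(\<integral>t. \<psi>' t \<partial>\<mu>) = \<psi> \<beta> - \<psi> \<alpha>"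
    using continuous_imp_integrable_real[OF c\<psi>']
    by (simp add: lebesgue_integral_eq_integral integral_unique)
  have parts: "(\<integral>t. \<psi>' t * primitive g t \<partial>\<mu>) = \<psi> \<beta> * primitive g \<beta> - (\<integral>t. \<phi> t * f t \<partial>\<mu>)"
  proof -
    have "\<psi> t * g t = \<phi> t * f t" for t
      by (simp add: \<psi>_def g_def e2c_minus field_simps)
    then show ?thesis
      using integration_by_parts_primitive[OF g c\<psi>' D\<psi>] by simp
  qed
  have i1: "integrable \<mu> \<psi>'"
    by (intro continuous_imp_integrable_real c\<psi>')
  have i2: "integrable \<mu> (\<lambda>t. \<psi>' t * primitive g t)"
    by (intro integrable_mult_continuous c\<psi>' continuous_imp_integrable_real continuous_on_primitive g)
  have i3: "integrable \<mu> (\<lambda>t. \<phi> t * bvp z c \<gamma> f t)"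
    by (intro integrable_mult_continuous c\<phi> continuous_imp_integrable_real continuous_on_bvp f)
  have i4: "integrable \<mu> (\<lambda>t. \<phi> t * f t)"
    by (intro integrable_mult_continuous c\<phi> f)
  have i5: "integrable \<mu> (\<lambda>t. \<phi>' t * bvp z c \<gamma> f t)"
    by (intro integrable_mult_continuous \<phi>' continuous_imp_integrable_real continuous_on_bvp f)
  have bvp: "bvp z c \<gamma> f t = e2c (z * complex_of_real t) * (c + \<gamma> * primitive g t)" for t
    by (simp add: bvp_def g_def)
  have "(\<integral>t. \<phi>' t * bvp z c \<gamma> f t \<partial>\<mu>) + \<i> * 2 * complex_of_real pi * z * (\<integral>t. \<phi> t * bvp z c \<gamma> f t \<partial>\<mu>)
    = (\<integral>t. \<phi>' t * bvp z c \<gamma> f t + \<i> * 2 * complex_of_real pi * z * (\<phi> t * bvp z c \<gamma> f t) \<partial>\<mu>)"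
    using i3 i5 by simp
  also have "\<dots> = (\<integral>t. c * \<psi>' t + \<gamma> * (\<psi>' t * primitive g t) \<partial>\<mu>)"
    by (intro Bochner_Integration.integral_cong) (simp_all add: bvp \<psi>'_def algebra_simps)
  also have "\<dots> = c * (\<psi> \<beta> - \<psi> \<alpha>) + \<gamma> * (\<psi> \<beta> * primitive g \<beta> - (\<integral>t. \<phi> t * f t \<partial>\<mu>))"
    using i1 i2 by (simp add: ftc parts)
  also have "\<dots> = \<phi> \<beta> * bvp z c \<gamma> f \<beta> - \<phi> \<alpha> * bvp z c \<gamma> f \<alpha> - \<gamma> * (\<integral>t. \<phi> t * f t \<partial>\<mu>)"
    by (simp add: bvp \<psi>_def primitive_start algebra_simps)
  finally have "(\<integral>t. \<phi>' t * bvp z c \<gamma> f t \<partial>\<mu>) = \<phi> \<beta> * bvp z c \<gamma> f \<beta> - \<phi> \<alpha> * bvp z c \<gamma> f \<alpha>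
    - (\<i> * 2 * complex_of_real pi * z * (\<integral>t. \<phi> t * bvp z c \<gamma> f t \<partial>\<mu>) + \<gamma> * (\<integral>t. \<phi> t * f t \<partial>\<mu>))"
    by (simp add: algebra_simps)
  also have "\<i> * 2 * complex_of_real pi * z * (\<integral>t. \<phi> t * bvp z c \<gamma> f t \<partial>\<mu>) + \<gamma> * (\<integral>t. \<phi> t * f t \<partial>\<mu>)
    = (\<integral>t. \<i> * 2 * complex_of_real pi * z * (\<phi> t * bvp z c \<gamma> f t) + \<gamma> * (\<phi> t * f t) \<partial>\<mu>)"
    using i3 i4 by simp
  also have "\<dots> = (\<integral>t. \<phi> t * (\<i> * 2 * complex_of_real pi * z * bvp z c \<gamma> f t + \<gamma> * f t) \<partial>\<mu>)"
    by (intro Bochner_Integration.integral_cong) (simp_all add: algebra_simps)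
  finally show ?thesis .
qed

end

section \<open>Resolvents of unitary operators\<close>

lemma
  assumes V: "unitary V"
  shows unitary_add: "V (x + y) = V x + V y"
    and unitary_scaleC: "V (a *\<^sub>C x) = a *\<^sub>C V x"
    and unitary_cinner: "cinner (V x) (V y) = cinner x y"
    and unitary_surj: "surj V"
  using V by (auto simp: unitary_def)

lemma unitary_diff: "unitary V \<Longrightarrow> V (x - y) = V x - V y"
  using unitary_add[of V "x - y" y] by (simp add: eq_diff_eq)

lemma unitary_norm: "unitary V \<Longrightarrow> norm (V x) = norm x"
  using unitary_cinner[of V x x] by (simp add: cinner_self del: of_real_power)

text \<open>Banach's fixed point theorem: C = w V C - g is a contraction if the modulus of w is
  below 1, and the same equation solved for C through the inverse of V is one if it is above 1.
  Completeness of H enters here. In the application w = e(-z(\<beta>-\<alpha>)), whose modulus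
  differs from 1 because z is not real.\<close>

lemma unitary_resolvent:
  fixes V :: "'h::chilbert \<Rightarrow> 'h"
  assumes V: "unitary V" and w: "cmod w \<noteq> 1"
  obtains C where "w *\<^sub>C V C - C = g"
proof (cases "cmod w < 1")
  case True
  have "\<exists>!C. w *\<^sub>C V C - g = C"
  proof (rule banach_fix_type[OF _ True], intro norm_ge_zero, intro allI)
    fix x y
    have "dist (w *\<^sub>C V x - g) (w *\<^sub>C V y - g) = norm (w *\<^sub>C V (x - y))"
      by (simp add: dist_norm scaleC_diff_right unitary_diff[OF V])
    then show "dist (w *\<^sub>C V x - g) (w *\<^sub>C V y - g) \<le> cmod w * dist x y"
      by (simp add: norm_scaleC unitary_norm[OF V] dist_norm)
  qed
  then show ?thesis using that by (metis add_diff_cancel_left' diff_add_cancel)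
next
  case False
  then have w1: "cmod (inverse w) < 1" "w \<noteq> 0"
    using w by (auto simp: norm_inverse inverse_less_1_iff)
  have VI: "V (inv V x) = x" for x
    using surj_f_inv_f[OF unitary_surj[OF V]] .
  have "\<exists>!C. inv V (inverse w *\<^sub>C (C + g)) = C"
  proof (rule banach_fix_type[OF _ w1(1)], intro norm_ge_zero, intro allI)
    fix x y
    have "norm (inv V a - inv V b) = norm (a - b)" for a b
      by (subst unitary_norm[OF V, symmetric]) (simp add: unitary_diff[OF V] VI)
    then show "dist (inv V (inverse w *\<^sub>C (x + g))) (inv V (inverse w *\<^sub>C (y + g)))
      \<le> cmod (inverse w) * dist x y"
      by (simp add: dist_norm norm_scaleC flip: scaleC_diff_right)
  qed
  then obtain C where "inv V (inverse w *\<^sub>C (C + g)) = C" by blast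
  then have "V C = inverse w *\<^sub>C (C + g)" using VI by metis
  then have "w *\<^sub>C V C = C + g" using w1 by (simp add: scaleC_scaleC scaleC_one)
  then show ?thesis by (intro that[of C]) simp
qed

abbreviation tpi :: complex where "tpi \<equiv> \<i> * 2 * complex_of_real pi"

context interval
begin

text \<open>The amount by which e(-zt) u(t) changes from \<alpha> to \<beta> for a solution u of the
  equation with source f and coefficient 1.\<close>

abbreviation jump :: "complex \<Rightarrow> (real \<Rightarrow> complex) \<Rightarrow> complex" where
  "jump z f \<equiv> primitive (\<lambda>s. e2c (- z * complex_of_real s) * f s) \<beta>"

text \<open>The function (P_V - z)^(-1) (f \<otimes> g), for C as in
  \<open>resolvent_in_graph\<close>. The factor \<open>tpi\<close> comes from P = (1/tpi) d/dt. The
  initial value is proportional to \<open>jump z f\<close>, so this scalar cancels from the boundary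
  condition and an equation for C in H remains that does not mention f.\<close>

definition resolvent :: "complex \<Rightarrow> (real \<Rightarrow> complex) \<Rightarrow> 'h::chilbert \<Rightarrow> 'h \<Rightarrow> real \<Rightarrow> 'h" where
  "resolvent z f g C = (\<lambda>t. (tpi * bvp z 0 1 f t) *\<^sub>C g + (tpi * jump z f * bvp z 1 0 f t) *\<^sub>C C)"

lemma bvp_linear: "bvp z c \<gamma> f t = \<gamma> * bvp z 0 1 f t + c * bvp z 1 0 f t"
  by (simp add: bvp_def algebra_simps)

lemma cinner_resolvent:
  "cinner h (resolvent z f g C t) = tpi * bvp z (jump z f * cinner h C) (cinner h g) f t"
  unfolding resolvent_def cinner_add_right cinner_scaleC_right
  by (subst (3) bvp_linear) (simp add: algebra_simps)

lemma test_functionD: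
  assumes "test_function \<alpha> \<beta> \<phi>"
  shows "\<phi> \<alpha> = 0" "\<phi> \<beta> = 0" "continuous_on {\<alpha>..\<beta>} (\<lambda>t. complex_of_real (deriv \<phi> t))"
    "((\<lambda>t. complex_of_real (\<phi> t)) has_vector_derivative complex_of_real (deriv \<phi> t)) (at t within S)"
proof -
  have d: "((deriv ^^ n) \<phi>) field_differentiable (at t)" for n t
    using assms by (simp add: test_function_def)
  obtain a b where "\<alpha> < a" "b < \<beta>" "\<And>t. t \<notin> {a..b} \<Longrightarrow> \<phi> t = 0"
    using assms by (auto simp: test_function_def)
  then show "\<phi> \<alpha> = 0" "\<phi> \<beta> = 0" by auto
  have "continuous (at t) (deriv \<phi>)" for t
    using d[of 1 t] by (auto intro: field_differentiable_imp_continuous_at)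
  then show "continuous_on {\<alpha>..\<beta>} (\<lambda>t. complex_of_real (deriv \<phi> t))"
    by (intro continuous_intros continuous_at_imp_continuous_on ballI)
  have "(\<phi> has_field_derivative deriv \<phi> t) (at t)"
    using d[of 0 t] by (simp add: field_differentiable_derivI)
  then show "((\<lambda>t. complex_of_real (\<phi> t)) has_vector_derivative complex_of_real (deriv \<phi> t)) (at t within S)"
    by (intro has_vector_derivative_of_real has_vector_derivative_at_within)
      (simp add: has_real_derivative_iff_has_vector_derivative)
qed

lemma continuous_on_scaleC:
  fixes f :: "real \<Rightarrow> complex" and g :: "real \<Rightarrow> 'h::chilbert"
  assumes "continuous_on S f" "continuous_on S g"
  shows "continuous_on S (\<lambda>t. f t *\<^sub>C g t)"
  using assms unfolding continuous_on_def by (auto intro: tendsto_scaleC)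

text \<open>The equation for C is the boundary condition u(\<beta>) = V u(\<alpha>) divided by the
  common scalar factors. \<open>u\<close> is continuous, hence its own continuous representative,
  and after pairing with a vector h its distributional derivative is given by the weak form of the
  scalar equation.\<close>

lemma resolvent_in_graph:
  fixes V :: "'h::chilbert \<Rightarrow> 'h"
  assumes V: "unitary V" and f: "f \<in> L2 \<alpha> \<beta>"
    and C: "e2c (- z * complex_of_real (\<beta> - \<alpha>)) *\<^sub>C V C - C = g"
  defines "u \<equiv> resolvent z f g C"
  shows "u \<in> L2 \<alpha> \<beta>" and "(u, z *\<^sub>C u + f \<otimes>\<^sub>H g) \<in> P_graph \<alpha> \<beta> V"
proof -
  interpret L2: semi_inner "L2 \<alpha> \<beta> :: (real \<Rightarrow> 'h) set" "l2_inner \<alpha> \<beta>"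
    by (rule semi_inner_L2)
  note fi = L2_integrable[OF f]
  have c: "continuous_on {\<alpha>..\<beta>} (\<lambda>t. k * bvp z c \<gamma> f t)" for k c \<gamma>
    by (intro continuous_intros continuous_on_bvp fi)
  have "u = (\<lambda>t. tpi * bvp z 0 1 f t) \<otimes>\<^sub>H g + (\<lambda>t. tpi * jump z f * bvp z 1 0 f t) \<otimes>\<^sub>H C"
    by (simp add: u_def resolvent_def tensor_def plus_fun_def)
  then show u: "u \<in> L2 \<alpha> \<beta>"
    by (simp only:) (intro L2.add_closed tensor_L2 L2_continuous c)
  define G where "G = tpi *\<^sub>C (z *\<^sub>C u + f \<otimes>\<^sub>H g)"
  have G: "G \<in> L2 \<alpha> \<beta>"
    unfolding G_def by (intro L2.add_closed L2.scaleC_closed tensor_L2 u f)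
  have cu: "continuous_on {\<alpha>..\<beta>} u"
    unfolding u_def resolvent_def by (intro continuous_on_add continuous_on_scaleC c continuous_on_const)
  have "u \<beta> = V (u \<alpha>)"
  proof -
    have "e2c (z * complex_of_real \<beta>) *\<^sub>C (g + C) = e2c (z * complex_of_real \<alpha>) *\<^sub>C V C"
    proof -
      have "g + C = e2c (- z * complex_of_real (\<beta> - \<alpha>)) *\<^sub>C V C"
        using C by (simp add: diff_eq_eq)
      then show ?thesis
        by (simp add: scaleC_scaleC e2c_add[symmetric] algebra_simps)
    qed
    moreover have "u \<alpha> = (tpi * jump z f) *\<^sub>C e2c (z * complex_of_real \<alpha>) *\<^sub>C C"
      by (simp add: u_def resolvent_def bvp_start scaleC_scaleC)
    moreover have "u \<beta> = (tpi * jump z f) *\<^sub>C e2c (z * complex_of_real \<beta>) *\<^sub>C (g + C)"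
      by (simp add: u_def resolvent_def bvp_def scaleC_scaleC scaleC_add_right algebra_simps)
    ultimately show ?thesis
      by (simp add: unitary_scaleC[OF V])
  qed
  moreover have "distr_deriv \<alpha> \<beta> u G"
    unfolding distr_deriv_def
  proof (intro allI impI)
    fix \<phi> and h :: 'h assume \<phi>: "test_function \<alpha> \<beta> \<phi>"
    note \<phi> = test_functionD[OF \<phi>]
    let ?w = "bvp z (jump z f * cinner h C) (cinner h g) f"
    have hu: "cinner h (u t) = tpi * ?w t" for t
      unfolding u_def by (rule cinner_resolvent)
    have hG: "cinner h (G t) = tpi * (tpi * z * ?w t + cinner h g * f t)" for t
      by (simp add: G_def scaleC_fun_def plus_fun_def tensor_def cinner_add_right cinner_scaleC_right hu
          algebra_simps)
    have "(\<integral>t. complex_of_real (deriv \<phi> t) * cinner h (u t) \<partial>\<mu>)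
      = tpi * (\<integral>t. complex_of_real (deriv \<phi> t) * ?w t \<partial>\<mu>)"
      by (simp add: hu mult.left_commute flip: integral_mult_right_zero)
    also have "\<dots> = - (tpi * (\<integral>t. complex_of_real (\<phi> t) * (tpi * z * ?w t + cinner h g * f t) \<partial>\<mu>))"
      by (subst bvp_integration_by_parts[OF fi \<phi>(3) \<phi>(4)]) (simp add: \<phi>)
    also have "\<dots> = - (\<integral>t. complex_of_real (\<phi> t) * cinner h (G t) \<partial>\<mu>)"
      by (simp add: hG mult.left_commute flip: integral_mult_right_zero)
    finally show "(\<integral>t. complex_of_real (deriv \<phi> t) * cinner h (u t) \<partial>\<mu>)
      = - (\<integral>t. complex_of_real (\<phi> t) * cinner h (G t) \<partial>\<mu>)" .
  qed
  ultimately have "(u, inverse tpi *\<^sub>C G) \<in> P_graph \<alpha> \<beta> V"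
    unfolding P_graph_def using u G cu by blast
  then show "(u, z *\<^sub>C u + f \<otimes>\<^sub>H g) \<in> P_graph \<alpha> \<beta> V"
    unfolding G_def scaleC_scaleC by (subst (asm) left_inverse) (simp_all add: scaleC_one)
qed

end

section \<open>Matrix elements of the resolvent of P_V, computed through F and through E\<close>

context pvm_space
begin

text \<open>For bounded \<open>B\<close> this makes \<open>l\<^sup>2\<close> integrable for the
  vector \<open>F B x\<close>, which is how vectors of the operator domain are produced.\<close>

lemma AE_pm_proj:
  assumes B: "B \<in> sets M" and x: "x \<in> X"
  shows "AE s in pm (F B x). s \<in> B"
proof (rule AE_I[where N="space M - B"])
  have "ip (F B x) (F (space M - B) (F B x)) = ip (F B x) (F ((space M - B) \<inter> B) x)"
    using B x by (subst proj_Int) (auto intro: proj_closed)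
  also have "\<dots> = 0"
    using B x by (simp add: Diff_Int_distrib2 proj_empty proj_closed)
  finally show "emeasure (pm (F B x)) (space M - B) = 0"
    using B x by (subst emeasure_pm) (auto intro: proj_closed)
qed (use B in auto)

lemma pint_const_add:
  assumes x: "x \<in> X" and y: "y \<in> X" and k: "pintegrable k x y"
  shows "pintegrable (\<lambda>s. a * k s + c) x y" "pint (\<lambda>s. a * k s + c) x y = a * pint k x y + c * ip x y"
proof -
  have 1: "pintegrable (\<lambda>_. 1) x y"
    by (rule pintegrable_bounded[OF x y, where b=1]) auto
  show "pintegrable (\<lambda>s. a * k s + c) x y"
    using pintegrable_add[OF pintegrable_mult[OF k, of a] pintegrable_mult[OF 1, of c]] by simp
  show "pint (\<lambda>s. a * k s + c) x y = a * pint k x y + c * ip x y"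
    using pint_add[OF pintegrable_mult[OF k, of a] pintegrable_mult[OF 1, of c]]
      pint_mult[of c "\<lambda>_. 1" x y]
    by (simp add: pint_mult pint_one[OF x y])
qed

end

context interval
begin

text \<open>The function s - z is the symbol of P_V - z, which sends the resolvent function to f
  \<otimes> g, and \<open>pint_inverse\<close> inverts it. It is bounded below by the modulus of Im
  z and bounded above on each [-n, n]; for B inside such an interval F(B)x lies in the domain, so
  the spectral hypothesis applies.\<close>

lemma pint_resolvent_F:
  fixes V :: "'h::chilbert \<Rightarrow> 'h"
  assumes V: "unitary V"
    and F: "spectral_measure_of (L2 \<alpha> \<beta>) (l2_inner \<alpha> \<beta>) (P_graph \<alpha> \<beta> V) F"
    and z: "Im z \<noteq> 0"
    and x: "x \<in> L2 \<alpha> \<beta>" and f: "f \<in> L2 \<alpha> \<beta>"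
    and C: "e2c (- z * complex_of_real (\<beta> - \<alpha>)) *\<^sub>C V C - C = g"
  shows "pvm_space.pint (l2_inner \<alpha> \<beta>) borel F (\<lambda>s. inverse (complex_of_real s - z)) x (f \<otimes>\<^sub>H g)
    = l2_inner \<alpha> \<beta> x (resolvent z f g C)"
proof -
  interpret L2: semi_inner "L2 \<alpha> \<beta> :: (real \<Rightarrow> 'h) set" "l2_inner \<alpha> \<beta>"
    by (rule semi_inner_L2)
  interpret pvm_space "L2 \<alpha> \<beta> :: (real \<Rightarrow> 'h) set" "l2_inner \<alpha> \<beta>" borel F
    by unfold_locales (use F in \<open>simp add: spectral_measure_of_def\<close>)
  define u where "u = resolvent z f g C"
  have u: "u \<in> L2 \<alpha> \<beta>" and graph: "(u, z *\<^sub>C u + f \<otimes>\<^sub>H g) \<in> P_graph \<alpha> \<beta> V"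
    unfolding u_def by (rule resolvent_in_graph[OF V f C])+
  have fg: "f \<otimes>\<^sub>H g \<in> L2 \<alpha> \<beta>" by (rule tensor_L2[OF f])
  have "pint (\<lambda>s. inverse (complex_of_real s - z)) x (f \<otimes>\<^sub>H g) = l2_inner \<alpha> \<beta> x u"
  proof (rule pint_inverse[OF x fg u, where \<delta>="\<bar>Im z\<bar>" and C="\<lambda>n. {- real n..real n}" and b="\<lambda>n. real n + cmod z"])
    show "(\<lambda>s. complex_of_real s - z) \<in> borel_measurable borel" by measurable
    show "\<bar>Im z\<bar> \<le> cmod (complex_of_real s - z)" for s
      using abs_Im_le_cmod[of "complex_of_real s - z"] by simp
    show "eventually (\<lambda>n. s \<in> {- real n..real n}) sequentially" for s
    proof (rule eventually_sequentiallyI[of "nat \<lceil>\<bar>s\<bar>\<rceil>"])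
      fix n assume "nat \<lceil>\<bar>s\<bar>\<rceil> \<le> n"
      then have "\<bar>s\<bar> \<le> real n" by linarith
      then show "s \<in> {- real n..real n}" by auto
    qed
    show "cmod (complex_of_real s - z) \<le> real n + cmod z" if "s \<in> {- real n..real n}" for n s
      using norm_triangle_ineq4[of "complex_of_real s" z] that by (auto simp: abs_le_iff)
    show "pintegrable (\<lambda>s. complex_of_real s - z) (F B x) u \<and>
      pint (\<lambda>s. complex_of_real s - z) (F B x) u = l2_inner \<alpha> \<beta> (F B x) (f \<otimes>\<^sub>H g)"
      if B: "B \<in> sets borel" "B \<subseteq> {- real n..real n}" for B n
    proof -
      note x' = proj_closed[OF B(1) x]
      interpret P: finite_measure "pm (F B x)" by (rule finite_measure_pm[OF x'])
      have "integrable (pm (F B x)) (\<lambda>l. l\<^sup>2)"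
      proof (rule P.integrable_const_bound[where B="(real n)\<^sup>2"])
        show "AE l in pm (F B x). norm (l\<^sup>2) \<le> (real n)\<^sup>2"
          using AE_pm_proj[OF B(1) x]
        proof eventually_elim
          case (elim l)
          then have "l \<in> {- real n..real n}" using B(2) by blast
          then have "\<bar>l\<bar> \<le> \<bar>real n\<bar>" by auto
          then show ?case using abs_le_square_iff[of l "real n"] by simp
        qed
      qed measurable
      then have "F B x \<in> Domain (P_graph \<alpha> \<beta> V)"
        using F x' unfolding spectral_measure_of_def by blast
      then have "has_pvm_integral borel (l2_inner \<alpha> \<beta>) F complex_of_real (F B x) u
          (l2_inner \<alpha> \<beta> (F B x) (z *\<^sub>C u + f \<otimes>\<^sub>H g))"
        using F graph unfolding spectral_measure_of_def by blast
      then have 1: "pintegrable complex_of_real (F B x) u"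
        and 2: "pint complex_of_real (F B x) u = l2_inner \<alpha> \<beta> (F B x) (z *\<^sub>C u + f \<otimes>\<^sub>H g)"
        unfolding has_pvm_integral_iff by auto
      show ?thesis
        using pint_const_add[OF x' u 1, of 1 "- z"]
        by (simp add: 2 L2.ip_add_right L2.ip_scaleC_right L2.scaleC_closed x' u fg)
    qed
  qed (use z in auto)
  then show ?thesis by (simp add: u_def)
qed

text \<open>This is \<open>resolvent\<close> for the one-dimensional space H and V = e(l), where the
  equation for C has the solution 1/(e(l - z(\<beta>-\<alpha>)) - 1).\<close>

definition scalar_resolvent :: "complex \<Rightarrow> real \<Rightarrow> (real \<Rightarrow> complex) \<Rightarrow> real \<Rightarrow> complex" where
  "scalar_resolvent z l f = (\<lambda>t. tpi *
     bvp z (jump z f * inverse (e2c (complex_of_real l - z * complex_of_real (\<beta> - \<alpha>)) - 1)) 1 f t)"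

text \<open>The modulus of e(l - z(\<beta>-\<alpha>)) does not depend on the real number l. The
  bound is therefore uniform in l, and the inverse is a bounded function on [0,1).\<close>

lemma norm_e2c_shift_ge:
  "\<bar>exp (2 * pi * Im z * (\<beta> - \<alpha>)) - 1\<bar> \<le> cmod (e2c (complex_of_real l - z * complex_of_real (\<beta> - \<alpha>)) - 1)"
  using norm_triangle_ineq3[of "e2c (complex_of_real l - z * complex_of_real (\<beta> - \<alpha>))" 1]
  by (simp add: norm_e2c mult.assoc)

lemma exp_shift_neq: "Im z \<noteq> 0 \<Longrightarrow> exp (2 * pi * Im z * (\<beta> - \<alpha>)) \<noteq> 1"
  using less by simp

text \<open>The scalar resolvent depends on l affinely through the factor 1/(w e(l) - 1). This
  factor is the symbol of the inverse of w V - 1, so its E-integral between g and g' is the inner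
  product of g with C.\<close>

lemma pint_resolvent_E:
  fixes V :: "'h::chilbert \<Rightarrow> 'h"
  assumes V: "unitary V"
    and E: "spectral_resolution V E"
    and z: "Im z \<noteq> 0"
    and f: "f \<in> L2 \<alpha> \<beta>" and f': "f' \<in> L2 \<alpha> \<beta>"
    and C: "e2c (- z * complex_of_real (\<beta> - \<alpha>)) *\<^sub>C V C - C = g'"
  shows "pvm_space.pint cinner (restrict_space borel {0..<1}) E (\<lambda>l. l2_inner \<alpha> \<beta> f (scalar_resolvent z l f')) g g'
    = l2_inner \<alpha> \<beta> (f \<otimes>\<^sub>H g) (resolvent z f' g' C)"
proof -
  interpret pvm_space "UNIV :: 'h set" cinner "restrict_space borel {0..<1}" E
    by (intro pvm_space.intro pvm_space_axioms.intro semi_inner_cinner)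
      (use E in \<open>simp add: spectral_resolution_def\<close>)
  define w where "w = e2c (- z * complex_of_real (\<beta> - \<alpha>))"
  have e: "e2c (complex_of_real l - z * complex_of_real (\<beta> - \<alpha>)) = w * e2pi l" for l
    unfolding w_def e2pi_eq by (simp flip: e2c_add)
  define \<delta> where "\<delta> = \<bar>exp (2 * pi * Im z * (\<beta> - \<alpha>)) - 1\<bar>"
  have \<delta>: "\<delta> > 0" using exp_shift_neq[OF z] by (simp add: \<delta>_def)
  have \<delta>_le: "\<delta> \<le> cmod (w * e2pi l - 1)" for l
    using norm_e2c_shift_ge[of z l] unfolding e \<delta>_def .
  have [measurable]: "e2pi \<in> borel_measurable (restrict_space borel {0..<1})"
    by (intro measurable_restrict_space1 borel_measurable_continuous_onI)
      (simp only: e2pi_eq[abs_def], intro continuous_intros)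
  have n1: "cmod (e2pi l) = 1" for l by (simp add: e2pi_eq norm_e2c)
  have inv: "pint (\<lambda>l. inverse (w * e2pi l - 1)) g g' = cinner g C"
  \<comment> \<open>Here the symbol is bounded above, so every exhausting set can be the whole
    interval.\<close>
  proof (rule pint_inverse[OF _ _ _ _ \<delta>, where C="\<lambda>_. {0..<1}" and b="\<lambda>_. cmod w + 1"])
    show "cmod (w * e2pi l - 1) \<le> cmod w + 1" for l
      using norm_triangle_ineq4[of "w * e2pi l" 1] by (simp add: norm_mult n1)
    show "pintegrable (\<lambda>l. w * e2pi l - 1) (E B g) C \<and> pint (\<lambda>l. w * e2pi l - 1) (E B g) C = cinner (E B g) g'" for B
    proof -
      have "has_pvm_integral (restrict_space borel {0..<1}) cinner E e2pi (E B g) C (cinner (E B g) (V C))"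
        using E unfolding spectral_resolution_def by blast
      then have 1: "pintegrable e2pi (E B g) C" and 2: "pint e2pi (E B g) C = cinner (E B g) (V C)"
        unfolding has_pvm_integral_iff by auto
      have "g' = w *\<^sub>C V C + (- 1) *\<^sub>C C"
        using C by (simp add: w_def)
      then show ?thesis
        using pint_const_add[OF UNIV_I UNIV_I 1, of w "- 1"]
        by (simp add: 2 cinner_add_right cinner_scaleC_right del: scaleC_minus1)
    qed
  qed (use \<delta>_le sets.top[of "restrict_space borel {0..<1::real}"] in auto)
  define w0 where "w0 = l2_inner \<alpha> \<beta> f (\<lambda>t. tpi * bvp z 0 1 f' t)"
  define w1 where "w1 = l2_inner \<alpha> \<beta> f (\<lambda>t. tpi * jump z f' * bvp z 1 0 f' t)"
  have cL2: "(\<lambda>t. k * bvp z c \<gamma> f' t) \<in> L2 \<alpha> \<beta>" for k c \<gamma>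
    by (intro L2_continuous continuous_intros continuous_on_bvp L2_integrable f')
  interpret L2c: semi_inner "L2 \<alpha> \<beta> :: (real \<Rightarrow> complex) set" "l2_inner \<alpha> \<beta>"
    by (rule semi_inner_L2)
  interpret L2: semi_inner "L2 \<alpha> \<beta> :: (real \<Rightarrow> 'h) set" "l2_inner \<alpha> \<beta>"
    by (rule semi_inner_L2)
  have s: "l2_inner \<alpha> \<beta> f (scalar_resolvent z l f') = w1 * inverse (w * e2pi l - 1) + w0" for l
  proof -
    have "scalar_resolvent z l f' = (\<lambda>t. tpi * bvp z 0 1 f' t)
      + inverse (w * e2pi l - 1) *\<^sub>C (\<lambda>t. tpi * jump z f' * bvp z 1 0 f' t)"
      unfolding scalar_resolvent_def e scaleC_fun_def plus_fun_def scaleC_complex_def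
      by (subst bvp_linear) (simp add: algebra_simps)
    then show ?thesis
      using f cL2 by (simp add: L2c.ip_add_right L2c.ip_scaleC_right L2c.scaleC_closed w0_def w1_def)
  qed
  have bi: "pintegrable (\<lambda>l. inverse (w * e2pi l - 1)) g g'"
  proof (rule pintegrable_bounded[where b="inverse \<delta>"])
    show "cmod (inverse (w * e2pi l - 1)) \<le> inverse \<delta>" for l
      unfolding norm_inverse by (intro le_imp_inverse_le \<delta>_le \<delta>)
  qed auto
  have "pint (\<lambda>l. l2_inner \<alpha> \<beta> f (scalar_resolvent z l f')) g g' = w1 * cinner g C + w0 * cinner g g'"
    unfolding s using pint_const_add(2)[OF UNIV_I UNIV_I bi, of w1 w0] by (simp add: inv)
  also have "\<dots> = l2_inner \<alpha> \<beta> (f \<otimes>\<^sub>H g) ((\<lambda>t. tpi * bvp z 0 1 f' t) \<otimes>\<^sub>H g' + (\<lambda>t. tpi * jump z f' * bvp z 1 0 f' t) \<otimes>\<^sub>H C)"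
    by (simp add: L2.ip_add_right tensor_L2 f cL2 l2_inner_tensor w0_def w1_def)
  also have "(\<lambda>t. tpi * bvp z 0 1 f' t) \<otimes>\<^sub>H g' + (\<lambda>t. tpi * jump z f' * bvp z 1 0 f' t) \<otimes>\<^sub>H C = resolvent z f' g' C"
    by (simp add: resolvent_def tensor_def plus_fun_def)
  finally show ?thesis .
qed

lemma resolvent_eq:
  fixes V :: "'h::chilbert \<Rightarrow> 'h"
  assumes V: "unitary V"
    and E: "spectral_resolution V E"
    and F: "spectral_measure_of (L2 \<alpha> \<beta>) (l2_inner \<alpha> \<beta>) (P_graph \<alpha> \<beta> V) F"
    and z: "Im z \<noteq> 0"
    and f: "f \<in> L2 \<alpha> \<beta>" and f': "f' \<in> L2 \<alpha> \<beta>"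
  shows "pvm_space.pint (l2_inner \<alpha> \<beta>) borel F (\<lambda>s. inverse (complex_of_real s - z)) (f \<otimes>\<^sub>H g) (f' \<otimes>\<^sub>H g')
    = pvm_space.pint cinner (restrict_space borel {0..<1}) E (\<lambda>l. l2_inner \<alpha> \<beta> f (scalar_resolvent z l f')) g g'"
proof -
  have "cmod (e2c (- z * complex_of_real (\<beta> - \<alpha>))) \<noteq> 1"
    using exp_shift_neq[OF z] by (simp add: norm_e2c)
  from unitary_resolvent[OF V this, of g'] obtain C
    where C: "e2c (- z * complex_of_real (\<beta> - \<alpha>)) *\<^sub>C V C - C = g'" .
  show ?thesis
    unfolding pint_resolvent_E[OF V E z f f' C] by (rule pint_resolvent_F[OF V F z tensor_L2[OF f] f' C])
qed

end

subsection \<open>Fourier series\<close>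

context semi_inner
begin

lemma ip_minus_right: "x \<in> X \<Longrightarrow> y \<in> X \<Longrightarrow> z \<in> X \<Longrightarrow> ip x (y + (- a) *\<^sub>C z) = ip x y - a * ip x z"
  by (simp add: ip_add_right ip_scaleC_right scaleC_closed)

text \<open>Induction on the index set: subtracting from x its component along \<open>b i\<close>
  lowers the square norm by the squared modulus of the coefficient and leaves all other coefficients
  unchanged.\<close>

lemma Bessel_inequality:
  assumes fin: "finite M" and x: "x \<in> X"
    and b: "\<And>i. b i \<in> X" and on: "\<And>i j. ip (b i) (b j) = (if i = j then 1 else 0)"
  shows "(\<Sum>i\<in>M. (cmod (ip (b i) x))\<^sup>2) \<le> Re (ip x x)"
  using fin x
proof (induction M arbitrary: x)
  case empty
  then show ?case by (simp add: ip_self_nonneg)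
next
  case (insert i M)
  define a where "a = ip (b i) x"
  define y where "y = x + (- a) *\<^sub>C b i"
  have y: "y \<in> X" unfolding y_def by (intro add_closed scaleC_closed insert.prems b)
  have bi: "ip (b j) y = ip (b j) x - a * (if j = i then 1 else 0)" for j
    unfolding y_def by (simp add: ip_minus_right insert.prems b on)
  have "ip y y = ip y x - a * ip y (b i)"
    by (subst (2) y_def) (rule ip_minus_right[OF y insert.prems b])
  also have "ip y (b i) = 0"
    using ip_commute[OF y b[of i]] bi[of i] by (simp add: a_def)
  also have "ip y x = ip x x - cnj a * a"
    using ip_commute[OF y insert.prems] ip_commute[OF insert.prems b, of i] ip_self_real[OF insert.prems]
    by (simp add: y_def ip_minus_right insert.prems b a_def) (metis complex_cnj_complex_of_real)
  finally have "ip y y = ip x x - complex_of_real ((cmod a)\<^sup>2)"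
    unfolding complex_norm_square by (simp add: mult.commute)
  then have "Re (ip y y) = Re (ip x x) - (cmod a)\<^sup>2"
    by simp
  moreover have "(\<Sum>j\<in>M. (cmod (ip (b j) y))\<^sup>2) = (\<Sum>j\<in>M. (cmod (ip (b j) x))\<^sup>2)"
    using insert.hyps by (intro sum.cong) (auto simp: bi)
  ultimately show ?case
    using insert.IH[OF y] insert.hyps by (simp add: a_def)
qed

text \<open>Only the single vector u has to be approximable by vectors with a finite expansion, not
  every vector of the space. The error d = u - p enters the partial sums and the limit, and Bessel's
  inequality for x and for d controls it uniformly in the finite index set.\<close>

lemma Parseval_has_sum:
  assumes x: "x \<in> X" and u: "u \<in> X"
    and b: "\<And>i. b i \<in> X" and on: "\<And>i j. ip (b i) (b j) = (if i = j then 1 else 0)"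
    and approx: "\<And>\<epsilon>. \<epsilon> > 0 \<Longrightarrow> \<exists>p\<in>X. Re (ip (u + (-1) *\<^sub>C p) (u + (-1) *\<^sub>C p)) \<le> \<epsilon> \<and>
      (\<exists>M. finite M \<and> (\<forall>M'. finite M' \<longrightarrow> M \<subseteq> M' \<longrightarrow> ip x p = (\<Sum>i\<in>M'. ip x (b i) * ip (b i) p)))"
  shows "((\<lambda>i. ip x (b i) * ip (b i) u) has_sum ip x u) UNIV"
  unfolding has_sum_def
proof (rule tendstoI)
  fix \<epsilon> :: real assume \<epsilon>: "\<epsilon> > 0"
  define q where "q = Re (ip x x)"
  have q: "q \<ge> 0" using ip_self_nonneg[OF x] by (simp add: q_def)
  \<comment> \<open>The weight makes \<open>s\<^sup>2 * q\<close> at most \<epsilon>/2, and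
    approximation to within \<open>s\<^sup>2 * (\<epsilon> / 4)\<close> makes the other term at most
    \<epsilon>/4. Adding 1 to \<open>q\<close> covers the case q = 0.\<close>
  define s where "s = sqrt (\<epsilon> / (2 * (q + 1)))"
  have s2: "s\<^sup>2 = \<epsilon> / (2 * (q + 1))" and s: "s > 0"
    using \<epsilon> q by (simp_all add: s_def)
  have "s\<^sup>2 * (\<epsilon> / 4) > 0" using s \<epsilon> by simp
  from approx[OF this] obtain p M where p: "p \<in> X"
    and qp: "Re (ip (u + (-1) *\<^sub>C p) (u + (-1) *\<^sub>C p)) \<le> s\<^sup>2 * (\<epsilon> / 4)"
    and M: "finite M" "\<And>M'. finite M' \<Longrightarrow> M \<subseteq> M' \<Longrightarrow> ip x p = (\<Sum>i\<in>M'. ip x (b i) * ip (b i) p)"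
    by blast
  define d where "d = u + (-1) *\<^sub>C p"
  have d: "d \<in> X" unfolding d_def by (intro add_closed scaleC_closed u p)
  have qd: "Re (ip d d) / s\<^sup>2 \<le> \<epsilon> / 4"
    using qp s by (simp add: d_def divide_le_eq mult.commute)
  have dist_le: "dist (\<Sum>i\<in>M'. ip x (b i) * ip (b i) u) (ip x u) < \<epsilon>" if M': "finite M'" "M \<subseteq> M'" for M'
  proof -
    have e: "ip y d = ip y u - ip y p" if "y \<in> X" for y
      using ip_minus_right[of y u p 1] that u p by (simp add: d_def)
    have "(\<Sum>i\<in>M'. ip x (b i) * ip (b i) u) - ip x u
      = (\<Sum>i\<in>M'. ip x (b i) * ip (b i) d) - ip x d"
      using M(2)[OF M'] by (simp add: e b x algebra_simps sum_subtractf)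
    then have "dist (\<Sum>i\<in>M'. ip x (b i) * ip (b i) u) (ip x u)
      \<le> cmod (\<Sum>i\<in>M'. ip x (b i) * ip (b i) d) + cmod (ip x d)"
      by (simp add: dist_norm norm_triangle_ineq4)
    also have "cmod (\<Sum>i\<in>M'. ip x (b i) * ip (b i) d)
      \<le> (\<Sum>i\<in>M'. (s\<^sup>2 * (cmod (ip (b i) x))\<^sup>2 + (cmod (ip (b i) d))\<^sup>2 / s\<^sup>2) / 2)"
    proof (rule order_trans[OF norm_sum], rule sum_mono)
      fix i
      have "cmod (ip x (b i)) = cmod (ip (b i) x)"
        using ip_commute[OF x b, of i] by simp
      moreover have "v * w \<le> (s\<^sup>2 * v\<^sup>2 + w\<^sup>2 / s\<^sup>2) / 2" for v w :: real
        using sum_squares_bound[of "s * v" "w / s"] s by (simp add: power_mult_distrib power_divide)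
      ultimately show "norm (ip x (b i) * ip (b i) d) \<le> (s\<^sup>2 * (cmod (ip (b i) x))\<^sup>2 + (cmod (ip (b i) d))\<^sup>2 / s\<^sup>2) / 2"
        by (simp only: norm_mult)
    qed
    also have "\<dots> = (s\<^sup>2 * (\<Sum>i\<in>M'. (cmod (ip (b i) x))\<^sup>2) + (\<Sum>i\<in>M'. (cmod (ip (b i) d))\<^sup>2) / s\<^sup>2) / 2"
      by (simp add: sum.distrib sum_distrib_left flip: sum_divide_distrib)
    also have "\<dots> \<le> (s\<^sup>2 * q + Re (ip d d) / s\<^sup>2) / 2"
      unfolding q_def using Bessel_inequality[OF M'(1) x b on] Bessel_inequality[OF M'(1) d b on]
      by (intro divide_right_mono add_mono mult_left_mono) auto
    also have "cmod (ip x d) \<le> (s\<^sup>2 * q + Re (ip d d) / s\<^sup>2) / 2"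
      using norm_ip_le_weighted[OF x d s] by (simp add: q_def)
    finally have "dist (\<Sum>i\<in>M'. ip x (b i) * ip (b i) u) (ip x u) \<le> s\<^sup>2 * q + Re (ip d d) / s\<^sup>2"
      by simp
    moreover have "s\<^sup>2 * q \<le> \<epsilon> / 2"
      using q \<epsilon> by (simp add: s2 field_simps)
    ultimately show ?thesis using qd \<epsilon> by linarith
  qed
  show "\<forall>\<^sub>F M in finite_subsets_at_top UNIV. dist (\<Sum>i\<in>M. ip x (b i) * ip (b i) u) (ip x u) < \<epsilon>"
    unfolding eventually_finite_subsets_at_top using M(1) dist_le by auto
qed

end

text \<open>Finite combinations of the exponentials with frequencies in (l + \<int>)/L, all of which
  satisfy p(t + L) = e(l) p(t). Shifts add under products, so only the case l = 0 is an
  algebra.\<close>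

inductive trig_poly :: "real \<Rightarrow> real \<Rightarrow> (real \<Rightarrow> complex) \<Rightarrow> bool" for L l where
  monomial: "trig_poly L l (\<lambda>t. c * e2c (complex_of_real ((l + of_int m) / L) * complex_of_real t))"
| add: "trig_poly L l p \<Longrightarrow> trig_poly L l q \<Longrightarrow> trig_poly L l (\<lambda>t. p t + q t)"

lemma trig_poly_mult:
  assumes "trig_poly L l p" and "trig_poly L k q"
  shows "trig_poly L (l + k) (\<lambda>t. p t * q t)"
  using assms(1)
proof induction
  case (monomial c m)
  from assms(2) show ?case
  proof induction
    case (monomial c' m')
    have "c * e2c (complex_of_real ((l + of_int m) / L) * complex_of_real t) *
        (c' * e2c (complex_of_real ((k + of_int m') / L) * complex_of_real t))
      = (c * c') * e2c (complex_of_real ((l + k + of_int (m + m')) / L) * complex_of_real t)" for t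
      by (simp add: e2c_add[symmetric] add_divide_distrib algebra_simps)
    then show ?case by (simp only:) (rule trig_poly.monomial)
  next
    case (add p q)
    from trig_poly.add[OF add.IH] show ?case by (simp add: algebra_simps)
  qed
next
  case (add p q)
  from trig_poly.add[OF add.IH] show ?case by (simp add: algebra_simps)
qed

lemma trig_poly_const: "trig_poly L 0 (\<lambda>t. c)"
  using trig_poly.monomial[of L 0 c 0] by simp

text \<open>A real linear functional of \<zeta> is a complex combination of \<zeta> and its
  conjugate, which on the unit circle are the monomials with m = 1 and m = -1. Products and sums
  then follow the inductive structure of real polynomials.\<close>

lemma trig_poly_real_polynomial:
  assumes "real_polynomial_function h"
  shows "trig_poly L 0 (\<lambda>t. complex_of_real (h (e2c (complex_of_real (t / L)))))"
  using assms
proof induction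
  case (linear h)
  interpret h: bounded_linear h by (rule linear)
  define a where "a = complex_of_real (h 1)"
  define b where "b = complex_of_real (h \<i>)"
  have h: "complex_of_real (h \<zeta>) = (a - \<i> * b) / 2 * \<zeta> + (a + \<i> * b) / 2 * cnj \<zeta>" for \<zeta>
  proof -
    have "h \<zeta> = h (Re \<zeta> *\<^sub>R 1 + Im \<zeta> *\<^sub>R \<i>)"
      by (rule arg_cong[of _ _ h]) (simp add: complex_eq_iff)
    also have "\<dots> = Re \<zeta> * h 1 + Im \<zeta> * h \<i>"
      by (simp add: h.add h.scaleR)
    finally show ?thesis by (simp add: a_def b_def complex_eq_iff field_simps)
  qed
  have c: "cnj (e2c (complex_of_real (t / L))) = e2c (- complex_of_real (t / L))" for t
    by (simp add: cnj_e2c)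
  show ?case
    using trig_poly.add[OF trig_poly.monomial[of L 0 "(a - \<i> * b) / 2" 1] trig_poly.monomial[of L 0 "(a + \<i> * b) / 2" "-1"]]
    unfolding h c by simp
next
  case (const c)
  show ?case by (rule trig_poly_const)
next
  case (add f g)
  from trig_poly.add[OF add.IH] show ?case by simp
next
  case (mult f g)
  from trig_poly_mult[OF mult.IH] show ?case by simp
qed

section \<open>Uniform approximation by trigonometric polynomials\<close>

context interval
begin

text \<open>The winding map \<open>p\<close> identifies at most the two endpoints, where
  \<open>v\<close> agrees, so \<open>v\<close> factors through its image. The factor is continuous
  because preimages of closed sets are images under \<open>p\<close> of compact sets.\<close>

lemma continuous_on_circle:
  fixes v :: "real \<Rightarrow> complex"
  assumes v: "continuous_on {\<alpha>..\<beta>} v" and ends: "v \<alpha> = v \<beta>"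
  defines "p \<equiv> \<lambda>t. e2c (complex_of_real (t / (\<beta> - \<alpha>)))"
  obtains w where "continuous_on (p ` {\<alpha>..\<beta>}) w" "\<And>t. t \<in> {\<alpha>..\<beta>} \<Longrightarrow> w (p t) = v t"
proof -
  have p: "continuous_on {\<alpha>..\<beta>} p"
    unfolding p_def by (intro continuous_intros) (use less in auto)
  have inj: "v s = v t" if st: "s \<in> {\<alpha>..\<beta>}" "t \<in> {\<alpha>..\<beta>}" "p s = p t" for s t
  proof -
    from st(3) have "e2c (complex_of_real ((s - t) / (\<beta> - \<alpha>))) = 1"
      by (simp add: p_def diff_divide_distrib e2c_def exp_diff right_diff_distrib)
    then obtain m :: int where m: "2 * pi * ((s - t) / (\<beta> - \<alpha>)) = of_int (2 * m) * pi"
      by (auto simp: e2c_def exp_eq_1)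
    then have "2 * pi * ((s - t) / (\<beta> - \<alpha>)) = 2 * pi * of_int m" by simp
    then have "(s - t) / (\<beta> - \<alpha>) = of_int m" unfolding mult_cancel_left by simp
    then have m: "s - t = of_int m * (\<beta> - \<alpha>)" using less by (simp add: field_simps)
    have "\<bar>s - t\<bar> \<le> \<beta> - \<alpha>" using st by auto
    then have "\<bar>real_of_int m\<bar> \<le> 1"
      using less unfolding m by (simp add: abs_mult)
    then have "m = 0 \<or> m = 1 \<or> m = -1" by linarith
    then show ?thesis
    proof (elim disjE)
      assume "m = 1"
      then have "s = \<beta>" "t = \<alpha>" using m st by auto
      then show ?thesis using ends by simp
    next
      assume "m = -1"
      then have "s = \<alpha>" "t = \<beta>" using m st by auto
      then show ?thesis using ends by simp
    qed (use m in simp)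
  qed
  define w where "w \<zeta> = v (SOME t. t \<in> {\<alpha>..\<beta>} \<and> p t = \<zeta>)" for \<zeta>
  have w: "w (p t) = v t" if t: "t \<in> {\<alpha>..\<beta>}" for t
  proof -
    have "(SOME s. s \<in> {\<alpha>..\<beta>} \<and> p s = p t) \<in> {\<alpha>..\<beta>} \<and> p (SOME s. s \<in> {\<alpha>..\<beta>} \<and> p s = p t) = p t"
      by (rule someI[of _ t]) (use t in simp)
    then show ?thesis unfolding w_def using inj t by blast
  qed
  have "continuous_on (p ` {\<alpha>..\<beta>}) w"
    unfolding continuous_on_closed_vimage[OF compact_imp_closed[OF compact_continuous_image[OF p compact_Icc]]]
  proof (intro allI impI)
    fix B :: "complex set" assume "closed B"
    then have "closed (v -` B \<inter> {\<alpha>..\<beta>})"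
      using v by (simp add: continuous_on_closed_vimage)
    then have "compact (v -` B \<inter> {\<alpha>..\<beta>})"
      using compact_Int_closed[OF compact_Icc, of "v -` B \<inter> {\<alpha>..\<beta>}" \<alpha> \<beta>] by (simp add: Int_absorb1)
    then have "compact (p ` (v -` B \<inter> {\<alpha>..\<beta>}))"
      by (intro compact_continuous_image continuous_on_subset[OF p]) auto
    moreover have "w -` B \<inter> p ` {\<alpha>..\<beta>} = p ` (v -` B \<inter> {\<alpha>..\<beta>})"
      using w by auto
    ultimately show "closed (w -` B \<inter> p ` {\<alpha>..\<beta>})"
      by (simp add: compact_imp_closed)
  qed
  then show ?thesis using w that by blast
qed

text \<open>Multiplication by the conjugate of \<open>ch\<close> turns the boundary condition with
  factor e(l) into periodicity. Stone-Weierstrass then applies on the circle, and multiplying back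
  by \<open>ch\<close>, which has modulus 1, preserves the error.\<close>

lemma trig_poly_approx:
  fixes u :: "real \<Rightarrow> complex"
  assumes u: "continuous_on {\<alpha>..\<beta>} u" and ends: "u \<beta> = e2pi l * u \<alpha>" and \<epsilon>: "\<epsilon> > 0"
  obtains q where "trig_poly (\<beta> - \<alpha>) l q" "\<And>t. t \<in> {\<alpha>..\<beta>} \<Longrightarrow> cmod (u t - q t) < \<epsilon>"
proof -
  define p where "p = (\<lambda>t. e2c (complex_of_real (t / (\<beta> - \<alpha>))))"
  define ch where "ch t = e2c (complex_of_real (l / (\<beta> - \<alpha>)) * complex_of_real t)" for t
  have nch: "cmod (ch t) = 1" for t by (simp add: ch_def norm_e2c)
  define v where "v t = cnj (ch t) * u t" for t
  have cch: "continuous_on {\<alpha>..\<beta>} ch" unfolding ch_def by (intro continuous_intros)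
  have v: "continuous_on {\<alpha>..\<beta>} v"
    unfolding v_def by (intro continuous_intros cch u)
  have "complex_of_real (l / (\<beta> - \<alpha>)) * complex_of_real \<beta> = complex_of_real (l / (\<beta> - \<alpha>)) * complex_of_real \<alpha> + complex_of_real l"
    using less by (simp add: field_simps flip: of_real_mult of_real_add of_real_divide of_real_diff)
  then have "ch \<beta> = ch \<alpha> * e2pi l"
    by (simp add: ch_def e2pi_eq e2c_add)
  moreover have "cnj (e2pi l) * e2pi l = 1"
    using complex_norm_square[of "e2pi l"] by (simp add: e2pi_eq norm_e2c mult.commute)
  ultimately have "v \<alpha> = v \<beta>"
    by (simp add: v_def ends)
  then obtain w where w: "continuous_on (p ` {\<alpha>..\<beta>}) w" "\<And>t. t \<in> {\<alpha>..\<beta>} \<Longrightarrow> w (p t) = v t"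
    using continuous_on_circle[OF v] unfolding p_def by blast
  have "compact (p ` {\<alpha>..\<beta>})"
    unfolding p_def by (intro compact_continuous_image continuous_intros) (use less in auto)
  from Stone_Weierstrass_polynomial_function[OF this w(1) \<epsilon>]
  obtain g where g: "polynomial_function g" "\<And>\<zeta>. \<zeta> \<in> p ` {\<alpha>..\<beta>} \<Longrightarrow> cmod (w \<zeta> - g \<zeta>) < \<epsilon>"
    by blast
  have "trig_poly (\<beta> - \<alpha>) 0 (\<lambda>t. g (p t))"
  proof -
    have re: "real_polynomial_function (\<lambda>\<zeta>. Re (g \<zeta>))" and im: "real_polynomial_function (\<lambda>\<zeta>. Im (g \<zeta>))"
      using g(1) bounded_linear_Re bounded_linear_Im unfolding polynomial_function_def by (auto simp: o_def)
    have "trig_poly (\<beta> - \<alpha>) (0 + 0) (\<lambda>t. \<i> * complex_of_real (Im (g (p t))))"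
      unfolding p_def by (intro trig_poly_mult trig_poly_const trig_poly_real_polynomial im)
    from trig_poly.add[OF trig_poly_real_polynomial[OF re, of "\<beta> - \<alpha>"] this[unfolded p_def, simplified]]
    show ?thesis
      by (simp add: p_def complex_eq mult.commute cong: if_cong flip: complex_eq)
  qed
  from trig_poly_mult[OF trig_poly.monomial[of "\<beta> - \<alpha>" l 1 0] this]
  have "trig_poly (\<beta> - \<alpha>) l (\<lambda>t. ch t * g (p t))" by (simp add: ch_def)
  moreover have "cmod (u t - ch t * g (p t)) < \<epsilon>" if t: "t \<in> {\<alpha>..\<beta>}" for t
  proof -
    have "u t = ch t * v t"
      using complex_norm_square[of "ch t"] by (simp add: v_def nch mult.assoc[symmetric])
    then have "u t - ch t * g (p t) = ch t * (w (p t) - g (p t))"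
      using w(2)[OF t] by (simp add: right_diff_distrib)
    then show ?thesis using g(2)[of "p t"] t by (simp add: norm_mult nch)
  qed
  ultimately show ?thesis using that by blast
qed

end

section \<open>Fourier expansion adapted to the boundary condition u(\<beta>) = e(l)
  u(\<alpha>)\<close>

context interval
begin

definition fourier_basis :: "real \<Rightarrow> int \<Rightarrow> real \<Rightarrow> complex" where
  "fourier_basis l m t = complex_of_real (1 / sqrt (\<beta> - \<alpha>)) *
     e2c (complex_of_real ((l + of_int m) / (\<beta> - \<alpha>)) * complex_of_real t)"

lemma continuous_on_fourier_basis: "continuous_on S (fourier_basis l m)"
  unfolding fourier_basis_def by (intro continuous_intros)

lemma fourier_basis_L2: "fourier_basis l m \<in> L2 \<alpha> \<beta>"
  by (intro L2_continuous continuous_on_fourier_basis)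

lemma fourier_basis_end: "fourier_basis l m \<beta> = e2pi l * fourier_basis l m \<alpha>"
proof -
  define r where "r = (l + of_int m) / (\<beta> - \<alpha>)"
  have "r * \<beta> = l + of_int m + r * \<alpha>"
    using less by (simp add: r_def field_simps)
  then have "complex_of_real r * complex_of_real \<beta> = complex_of_real l + of_int m + complex_of_real r * complex_of_real \<alpha>"
    by (metis of_real_add of_real_mult of_real_of_int_eq)
  then show ?thesis unfolding fourier_basis_def r_def[symmetric] by (simp add: e2pi_eq e2c_add)
qed

lemma l2_inner_fourier_basis:
  "l2_inner \<alpha> \<beta> (fourier_basis l m) f = complex_of_real (1 / sqrt (\<beta> - \<alpha>)) *
    (\<integral>t. e2c (- complex_of_real ((l + of_int m) / (\<beta> - \<alpha>)) * complex_of_real t) * f t \<partial>\<mu>)"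
  by (simp add: l2_inner_def cinner_complex_def fourier_basis_def cnj_e2c mult.assoc)

lemma integral_e2c:
  assumes "z * complex_of_real (\<beta> - \<alpha>) = of_int k" "k \<noteq> 0"
  shows "(\<integral>t. e2c (z * complex_of_real t) \<partial>\<mu>) = 0"
proof -
  have z: "z \<noteq> 0" using assms by auto
  let ?e = "\<lambda>t. e2c (z * complex_of_real t)"
  have "((\<lambda>t. tpi * z * ?e t) has_integral ?e \<beta> - ?e \<alpha>) {\<alpha>..\<beta>}"
    using less has_vector_derivative_e2c by (intro fundamental_theorem_of_calculus) auto
  moreover have "integrable \<mu> (\<lambda>t. tpi * z * ?e t)"
    by (intro continuous_imp_integrable_real continuous_intros)
  ultimately have "(\<integral>t. tpi * z * ?e t \<partial>\<mu>) = ?e \<beta> - ?e \<alpha>"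
    by (subst lebesgue_integral_eq_integral) (simp_all only: integral_unique, simp)
  also have "?e \<beta> = e2c (z * complex_of_real (\<beta> - \<alpha>)) * ?e \<alpha>"
    by (simp add: e2c_add[symmetric] algebra_simps)
  finally show ?thesis using z assms(1) by simp
qed

lemma fourier_basis_orthonormal: "l2_inner \<alpha> \<beta> (fourier_basis l m) (fourier_basis l n) = (if m = n then 1 else 0)"
proof -
  define z where "z = complex_of_real (of_int (n - m) / (\<beta> - \<alpha>))"
  have "l2_inner \<alpha> \<beta> (fourier_basis l m) (fourier_basis l n) = complex_of_real (1 / sqrt (\<beta> - \<alpha>)) * complex_of_real (1 / sqrt (\<beta> - \<alpha>)) *
    (\<integral>t. e2c (z * complex_of_real t) \<partial>\<mu>)"
  proof -
    have "e2c (- complex_of_real ((l + of_int m) / (\<beta> - \<alpha>)) * complex_of_real t) * fourier_basis l n t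
      = complex_of_real (1 / sqrt (\<beta> - \<alpha>)) * e2c (z * complex_of_real t)" for t
    proof -
      have "z * complex_of_real t = - complex_of_real ((l + of_int m) / (\<beta> - \<alpha>)) * complex_of_real t
        + complex_of_real ((l + of_int n) / (\<beta> - \<alpha>)) * complex_of_real t"
        by (simp add: z_def add_divide_distrib diff_divide_distrib algebra_simps)
      then show ?thesis by (simp only: fourier_basis_def e2c_add) (simp only: mult_ac)
    qed
    then show ?thesis unfolding l2_inner_fourier_basis by (simp add: mult.assoc)
  qed
  moreover have "complex_of_real (1 / sqrt (\<beta> - \<alpha>)) * complex_of_real (1 / sqrt (\<beta> - \<alpha>)) = complex_of_real (1 / (\<beta> - \<alpha>))"
    using less by (simp flip: of_real_mult)
  moreover have "(\<integral>t. e2c (z * complex_of_real t) \<partial>\<mu>) = (if m = n then complex_of_real (\<beta> - \<alpha>) else 0)"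
  proof (cases "m = n")
    case True
    then show ?thesis using less by (simp add: z_def measure_restrict_space scaleR_conv_of_real)
  next
    case False
    have "z * complex_of_real (\<beta> - \<alpha>) = of_int (n - m)"
      using less by (simp add: z_def flip: of_real_mult)
    then show ?thesis using integral_e2c[of z "n - m"] False by simp
  qed
  ultimately show ?thesis using less by (simp flip: of_real_mult)
qed

lemma trig_poly_continuous: "trig_poly L l q \<Longrightarrow> continuous_on S q"
  by (induction rule: trig_poly.induct) (intro continuous_intros; assumption?)+

text \<open>\<open>M\<close> is the set of frequencies that occur; by orthonormality further indices
  contribute nothing. All finite supersets are included since unconditional summation tests exactly
  these.\<close>

lemma trig_poly_expansion:
  assumes q: "trig_poly (\<beta> - \<alpha>) l q" and f: "f \<in> L2 \<alpha> \<beta>"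
  shows "\<exists>M. finite M \<and> (\<forall>M'. finite M' \<longrightarrow> M \<subseteq> M' \<longrightarrow>
    l2_inner \<alpha> \<beta> f q = (\<Sum>m\<in>M'. l2_inner \<alpha> \<beta> f (fourier_basis l m) * l2_inner \<alpha> \<beta> (fourier_basis l m) q))"
proof -
  interpret L2: semi_inner "L2 \<alpha> \<beta> :: (real \<Rightarrow> complex) set" "l2_inner \<alpha> \<beta>"
    by (rule semi_inner_L2)
  show ?thesis
    using q
  proof induction
    case (monomial c m)
    define a where "a = c * complex_of_real (sqrt (\<beta> - \<alpha>))"
    have e: "(\<lambda>t. c * e2c (complex_of_real ((l + of_int m) / (\<beta> - \<alpha>)) * complex_of_real t)) = a *\<^sub>C fourier_basis l m"
      using less by (simp add: a_def fourier_basis_def fun_eq_iff scaleC_fun_def scaleC_complex_def)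
    have ip: "l2_inner \<alpha> \<beta> g (a *\<^sub>C fourier_basis l m) = a * l2_inner \<alpha> \<beta> g (fourier_basis l m)" if "g \<in> L2 \<alpha> \<beta>" for g
      using that by (simp add: L2.ip_scaleC_right fourier_basis_L2)
    show ?case
      unfolding e
    proof (intro exI[of _ "{m}"] conjI allI impI)
      fix M' :: "int set" assume M': "finite M'" "{m} \<subseteq> M'"
      have "(\<Sum>n\<in>M'. l2_inner \<alpha> \<beta> f (fourier_basis l n) * l2_inner \<alpha> \<beta> (fourier_basis l n) (a *\<^sub>C fourier_basis l m))
        = (\<Sum>n\<in>M'. if n = m then a * l2_inner \<alpha> \<beta> f (fourier_basis l n) else 0)"
        by (intro sum.cong) (auto simp: ip fourier_basis_L2 fourier_basis_orthonormal)
      then show "l2_inner \<alpha> \<beta> f (a *\<^sub>C fourier_basis l m) =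
        (\<Sum>n\<in>M'. l2_inner \<alpha> \<beta> f (fourier_basis l n) * l2_inner \<alpha> \<beta> (fourier_basis l n) (a *\<^sub>C fourier_basis l m))"
        using M' by (simp add: ip[OF f])
    qed simp
  next
    case (add p q)
    obtain M where M: "finite M" "\<And>M'. finite M' \<Longrightarrow> M \<subseteq> M' \<Longrightarrow>
      l2_inner \<alpha> \<beta> f p = (\<Sum>m\<in>M'. l2_inner \<alpha> \<beta> f (fourier_basis l m) * l2_inner \<alpha> \<beta> (fourier_basis l m) p)"
      using add.IH(1) by blast
    obtain N where N: "finite N" "\<And>M'. finite M' \<Longrightarrow> N \<subseteq> M' \<Longrightarrow>
      l2_inner \<alpha> \<beta> f q = (\<Sum>m\<in>M'. l2_inner \<alpha> \<beta> f (fourier_basis l m) * l2_inner \<alpha> \<beta> (fourier_basis l m) q)"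
      using add.IH(2) by blast
    have pq: "p \<in> L2 \<alpha> \<beta>" "q \<in> L2 \<alpha> \<beta>"
      using add.hyps by (auto intro: L2_continuous trig_poly_continuous)
    have ip: "l2_inner \<alpha> \<beta> g (\<lambda>t. p t + q t) = l2_inner \<alpha> \<beta> g p + l2_inner \<alpha> \<beta> g q" if "g \<in> L2 \<alpha> \<beta>" for g
      using L2.ip_add_right[OF that pq] by (simp add: plus_fun_def)
    show ?case
    proof (intro exI[of _ "M \<union> N"] conjI allI impI)
      fix M' assume "finite M'" "M \<union> N \<subseteq> M'"
      then show "l2_inner \<alpha> \<beta> f (\<lambda>t. p t + q t) =
        (\<Sum>m\<in>M'. l2_inner \<alpha> \<beta> f (fourier_basis l m) * l2_inner \<alpha> \<beta> (fourier_basis l m) (\<lambda>t. p t + q t))"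
        using M(2)[of M'] N(2)[of M'] by (simp add: ip f fourier_basis_L2 distrib_left sum.distrib)
    qed (use M N in simp)
  qed
qed

lemma Fourier_has_sum:
  assumes f: "f \<in> L2 \<alpha> \<beta>" and u: "continuous_on {\<alpha>..\<beta>} u" and ends: "u \<beta> = e2pi l * u \<alpha>"
  shows "((\<lambda>m. l2_inner \<alpha> \<beta> f (fourier_basis l m) * l2_inner \<alpha> \<beta> (fourier_basis l m) u) has_sum l2_inner \<alpha> \<beta> f u) UNIV"
proof -
  interpret L2: semi_inner "L2 \<alpha> \<beta> :: (real \<Rightarrow> complex) set" "l2_inner \<alpha> \<beta>"
    by (rule semi_inner_L2)
  note uL2 = L2_continuous[OF u]
  show ?thesis
  proof (rule L2.Parseval_has_sum[OF f uL2 fourier_basis_L2 fourier_basis_orthonormal])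
    fix \<epsilon> :: real assume \<epsilon>: "\<epsilon> > 0"
    \<comment> \<open>A uniform error \<eta> on an interval of length \<beta> - \<alpha> gives a
      squared norm of at most \<epsilon>.\<close>
    define \<eta> where "\<eta> = sqrt (\<epsilon> / (\<beta> - \<alpha>))"
    have \<eta>: "\<eta> > 0" "\<eta>\<^sup>2 = \<epsilon> / (\<beta> - \<alpha>)" using \<epsilon> less by (simp_all add: \<eta>_def)
    obtain q where q: "trig_poly (\<beta> - \<alpha>) l q" and le: "\<And>t. t \<in> {\<alpha>..\<beta>} \<Longrightarrow> cmod (u t - q t) < \<eta>"
      using trig_poly_approx[OF u ends \<eta>(1)] by blast
    have cq: "continuous_on {\<alpha>..\<beta>} q" by (rule trig_poly_continuous[OF q])
    have "l2_inner \<alpha> \<beta> (u + (-1) *\<^sub>C q) (u + (-1) *\<^sub>C q) = (\<integral>t. complex_of_real ((cmod (u t - q t))\<^sup>2) \<partial>\<mu>)"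
      unfolding l2_inner_def cinner_self by (simp add: plus_fun_def)
    also have "\<dots> = complex_of_real (\<integral>t. (cmod (u t - q t))\<^sup>2 \<partial>\<mu>)"
      by (rule integral_complex_of_real)
    also have "Re \<dots> \<le> (\<integral>t. \<eta>\<^sup>2 \<partial>\<mu>)"
      unfolding Re_complex_of_real
    proof (rule integral_mono)
      show "integrable \<mu> (\<lambda>t. (cmod (u t - q t))\<^sup>2)"
        by (intro continuous_imp_integrable_real continuous_intros u cq)
    qed (use le in \<open>auto intro!: power_mono simp: less_imp_le\<close>)
    also have "\<dots> = \<epsilon>" using less by (simp add: \<eta>(2) measure_restrict_space)
    finally have "Re (l2_inner \<alpha> \<beta> (u + (-1) *\<^sub>C q) (u + (-1) *\<^sub>C q)) \<le> \<epsilon>" .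
    then show "\<exists>p\<in>L2 \<alpha> \<beta>. Re (l2_inner \<alpha> \<beta> (u + (-1) *\<^sub>C p) (u + (-1) *\<^sub>C p)) \<le> \<epsilon> \<and>
      (\<exists>M. finite M \<and> (\<forall>M'. finite M' \<longrightarrow> M \<subseteq> M' \<longrightarrow>
        l2_inner \<alpha> \<beta> f p = (\<Sum>i\<in>M'. l2_inner \<alpha> \<beta> f (fourier_basis l i) * l2_inner \<alpha> \<beta> (fourier_basis l i) p)))"
      using trig_poly_expansion[OF q f] L2_continuous[OF cq] by blast
  qed
qed

section \<open>The scalar resolvent in the Fourier basis\<close>

lemma scalar_resolvent_continuous: "f \<in> L2 \<alpha> \<beta> \<Longrightarrow> continuous_on {\<alpha>..\<beta>} (scalar_resolvent z l f)"
  unfolding scalar_resolvent_def by (intro continuous_intros continuous_on_bvp L2_integrable)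

lemma scalar_resolvent_end:
  assumes z: "Im z \<noteq> 0"
  shows "scalar_resolvent z l f \<beta> = e2pi l * scalar_resolvent z l f \<alpha>"
proof -
  define e where "e = e2c (complex_of_real l - z * complex_of_real (\<beta> - \<alpha>))"
  have e1: "e - 1 \<noteq> 0"
    using norm_e2c_shift_ge[of z l] exp_shift_neq[OF z] by (auto simp: e_def)
  have e2: "e2c (z * complex_of_real \<beta>) * e = e2pi l * e2c (z * complex_of_real \<alpha>)"
    unfolding e_def e2pi_eq by (simp add: e2c_add[symmetric] algebra_simps)
  have "scalar_resolvent z l f \<beta> = tpi * e2c (z * complex_of_real \<beta>) * (jump z f * (inverse (e - 1) + 1))"
    by (simp add: scalar_resolvent_def bvp_def e_def algebra_simps)
  \<comment> \<open>The term 1 is the jump across the interval, added to the initial value 1/(e -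
    1). This initial value was chosen so that the sum is the initial value times
    \<open>e\<close>.\<close>
  also have "inverse (e - 1) + 1 = e * inverse (e - 1)"
    using e1 by (simp add: field_simps)
  also have "tpi * e2c (z * complex_of_real \<beta>) * (jump z f * (e * inverse (e - 1)))
    = tpi * (e2c (z * complex_of_real \<beta>) * e) * (jump z f * inverse (e - 1))"
    by (simp only: mult_ac)
  also have "\<dots> = e2pi l * scalar_resolvent z l f \<alpha>"
    unfolding e2 by (simp add: scalar_resolvent_def bvp_start e_def)
  finally show ?thesis .
qed

text \<open>A basis function is an eigenfunction of P with eigenvalue r = (l + m)/(\<beta> -
  \<alpha>). Integration by parts against its conjugate leaves no boundary terms, since both
  functions pick up the same factor e(l) of modulus 1 from \<alpha> to \<beta>.\<close>

lemma l2_inner_fourier_basis_scalar_resolvent: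
  assumes z: "Im z \<noteq> 0" and f: "f \<in> L2 \<alpha> \<beta>"
  shows "l2_inner \<alpha> \<beta> (fourier_basis l m) (scalar_resolvent z l f)
    = inverse (complex_of_real ((l + of_int m) / (\<beta> - \<alpha>)) - z) * l2_inner \<alpha> \<beta> (fourier_basis l m) f"
proof -
  define r where "r = complex_of_real ((l + of_int m) / (\<beta> - \<alpha>))"
  have rz: "r - z \<noteq> 0" using z by (auto simp: r_def)
  define c where "c = jump z f * inverse (e2c (complex_of_real l - z * complex_of_real (\<beta> - \<alpha>)) - 1)"
  let ?w = "bvp z c 1 f"
  define \<phi> where "\<phi> t = e2c (- r * complex_of_real t)" for t
  have u: "scalar_resolvent z l f t = tpi * ?w t" for t
    by (simp add: scalar_resolvent_def c_def)
  have c\<phi>: "continuous_on {\<alpha>..\<beta>} \<phi>" unfolding \<phi>_def by (intro continuous_intros)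
  note fi = L2_integrable[OF f]
  have i1: "integrable \<mu> (\<lambda>t. \<phi> t * ?w t)"
    by (intro integrable_mult_continuous c\<phi> continuous_imp_integrable_real continuous_on_bvp fi)
  have i2: "integrable \<mu> (\<lambda>t. \<phi> t * f t)"
    by (intro integrable_mult_continuous c\<phi> fi)
  have ends: "\<phi> \<beta> * ?w \<beta> = \<phi> \<alpha> * ?w \<alpha>"
  proof -
    have "cnj (fourier_basis l m \<beta>) * scalar_resolvent z l f \<beta> = cnj (fourier_basis l m \<alpha>) * scalar_resolvent z l f \<alpha>"
      using complex_norm_square[of "e2pi l"]
      unfolding fourier_basis_end scalar_resolvent_end[OF z] by (simp add: e2pi_eq norm_e2c mult_ac)
    moreover have "cnj (fourier_basis l m t) = complex_of_real (1 / sqrt (\<beta> - \<alpha>)) * \<phi> t" for t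
      by (simp add: fourier_basis_def cnj_e2c \<phi>_def r_def)
    ultimately show ?thesis using less by (simp add: u)
  qed
  have "(\<integral>t. (tpi * (- r) * \<phi> t) * ?w t \<partial>\<mu>) = \<phi> \<beta> * ?w \<beta> - \<phi> \<alpha> * ?w \<alpha>
    - (\<integral>t. \<phi> t * (tpi * z * ?w t + 1 * f t) \<partial>\<mu>)"
  proof (rule bvp_integration_by_parts[OF fi])
    show "continuous_on {\<alpha>..\<beta>} (\<lambda>t. tpi * (- r) * \<phi> t)" by (intro continuous_intros c\<phi>)
    show "(\<phi> has_vector_derivative tpi * (- r) * \<phi> t) (at t within {\<alpha>..\<beta>})" for t
      unfolding \<phi>_def by (rule has_vector_derivative_e2c)
  qed
  also have "(\<integral>t. \<phi> t * (tpi * z * ?w t + 1 * f t) \<partial>\<mu>) = (\<integral>t. tpi * z * (\<phi> t * ?w t) + \<phi> t * f t \<partial>\<mu>)"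
    by (intro Bochner_Integration.integral_cong) (simp_all add: algebra_simps)
  also have "\<dots> = tpi * z * (\<integral>t. \<phi> t * ?w t \<partial>\<mu>) + (\<integral>t. \<phi> t * f t \<partial>\<mu>)"
    using i1 i2 by simp
  also have "(\<integral>t. (tpi * (- r) * \<phi> t) * ?w t \<partial>\<mu>) = tpi * (- r) * (\<integral>t. \<phi> t * ?w t \<partial>\<mu>)"
    by (simp only: mult.assoc integral_mult_right_zero)
  finally have "tpi * (r - z) * (\<integral>t. \<phi> t * ?w t \<partial>\<mu>) = (\<integral>t. \<phi> t * f t \<partial>\<mu>)"
    unfolding ends by (simp add: algebra_simps)
  then have "tpi * (\<integral>t. \<phi> t * ?w t \<partial>\<mu>) = inverse (r - z) * (\<integral>t. \<phi> t * f t \<partial>\<mu>)"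
    using rz by (simp add: field_simps)
  moreover have "(\<integral>t. \<phi> t * scalar_resolvent z l f t \<partial>\<mu>) = tpi * (\<integral>t. \<phi> t * ?w t \<partial>\<mu>)"
    unfolding u by (simp only: mult.left_commute[of _ tpi] integral_mult_right_zero)
  moreover have "l2_inner \<alpha> \<beta> (fourier_basis l m) h = complex_of_real (1 / sqrt (\<beta> - \<alpha>)) * (\<integral>t. \<phi> t * h t \<partial>\<mu>)" for h
    by (simp only: l2_inner_fourier_basis \<phi>_def r_def)
  ultimately show ?thesis
    by (simp only: mult.left_commute r_def)
qed

definition fourier_coef :: "(real \<Rightarrow> complex) \<Rightarrow> (real \<Rightarrow> complex) \<Rightarrow> real \<Rightarrow> int \<Rightarrow> complex" where
  "fourier_coef f f' l m = l2_inner \<alpha> \<beta> f (fourier_basis l m) * l2_inner \<alpha> \<beta> (fourier_basis l m) f'"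

lemma l2_inner_fourier_proj:
  "l2_inner \<alpha> \<beta> f (fourier_proj \<alpha> \<beta> ((l + of_int m) / (\<beta> - \<alpha>)) f') = fourier_coef f f' l m"
proof -
  let ?r = "(l + of_int m) / (\<beta> - \<alpha>)"
  have sq: "inverse (complex_of_real (\<beta> - \<alpha>)) = complex_of_real (1 / sqrt (\<beta> - \<alpha>)) * complex_of_real (1 / sqrt (\<beta> - \<alpha>))"
    using less by (simp add: field_simps flip: of_real_mult of_real_inverse)
  have "l2_inner \<alpha> \<beta> (fourier_basis l m) f' = complex_of_real (1 / sqrt (\<beta> - \<alpha>)) * (\<integral>s. f' s * e2pi (- ?r * s) \<partial>\<mu>)"
    unfolding l2_inner_fourier_basis e2pi_eq by (simp add: mult.commute)
  then have "fourier_proj \<alpha> \<beta> ?r f' t = l2_inner \<alpha> \<beta> (fourier_basis l m) f' * fourier_basis l m t" for t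
    unfolding fourier_proj_def fourier_basis_def e2pi_eq sq by (simp add: mult_ac)
  then have "l2_inner \<alpha> \<beta> f (fourier_proj \<alpha> \<beta> ?r f') = (\<integral>t. l2_inner \<alpha> \<beta> (fourier_basis l m) f' * (cnj (f t) * fourier_basis l m t) \<partial>\<mu>)"
    by (simp add: l2_inner_def[of _ _ f] cinner_complex_def mult_ac)
  also have "\<dots> = l2_inner \<alpha> \<beta> (fourier_basis l m) f' * l2_inner \<alpha> \<beta> f (fourier_basis l m)"
    by (simp add: l2_inner_def[of _ _ f] cinner_complex_def)
  finally show ?thesis by (simp add: fourier_coef_def mult.commute)
qed

lemma scalar_resolvent_has_sum:
  assumes z: "Im z \<noteq> 0" and f: "f \<in> L2 \<alpha> \<beta>" and f': "f' \<in> L2 \<alpha> \<beta>"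
  shows "((\<lambda>m. inverse (complex_of_real ((l + of_int m) / (\<beta> - \<alpha>)) - z) * fourier_coef f f' l m)
    has_sum l2_inner \<alpha> \<beta> f (scalar_resolvent z l f')) UNIV"
  using Fourier_has_sum[OF f scalar_resolvent_continuous[OF f'] scalar_resolvent_end[OF z], of l]
  by (simp add: l2_inner_fourier_basis_scalar_resolvent[OF z f'] fourier_coef_def mult.left_commute)

end

subsection \<open>Stone's formula\<close>

text \<open>On each subinterval the mean value theorem replaces the increment of \<open>P\<close> by
  the step times a value of \<open>p\<close>, and uniform continuity compares this value with the
  one at the left end. Explicit finite sums are used because the functions of interest form a class
  closed under finite sums and pointwise limits of sequences.\<close>

lemma Riemann_sums_tendsto:
  fixes P p :: "real \<Rightarrow> real"
  assumes ab: "a < b"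
    and D: "\<And>t. (P has_real_derivative p t) (at t)"
    and p: "continuous_on {a..b} p"
  shows "(\<lambda>n. \<Sum>k<Suc n. (b - a) / real (Suc n) * p (a + real k * ((b - a) / real (Suc n)))) \<longlonglongrightarrow> P b - P a"
proof (rule tendstoI)
  fix \<epsilon> :: real assume \<epsilon>: "\<epsilon> > 0"
  define \<eta> where "\<eta> = \<epsilon> / (2 * (b - a))"
  have \<eta>: "\<eta> > 0" using \<epsilon> ab by (simp add: \<eta>_def)
  have "uniformly_continuous_on {a..b} p"
    by (rule compact_uniformly_continuous[OF p compact_Icc])
  then obtain d where d: "d > 0"
    "\<And>s t. s \<in> {a..b} \<Longrightarrow> t \<in> {a..b} \<Longrightarrow> dist s t < d \<Longrightarrow> dist (p s) (p t) < \<eta>"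
    unfolding uniformly_continuous_on_def using \<eta> by metis
  have "(\<lambda>n. (b - a) / real (Suc n)) \<longlonglongrightarrow> 0"
    using LIMSEQ_Suc[OF lim_const_over_n[of "b - a"]] .
  then have "\<forall>\<^sub>F n in sequentially. (b - a) / real (Suc n) < d"
    by (rule order_tendstoD) (rule d)
  then show "\<forall>\<^sub>F n in sequentially.
    dist (\<Sum>k<Suc n. (b - a) / real (Suc n) * p (a + real k * ((b - a) / real (Suc n)))) (P b - P a) < \<epsilon>"
  proof eventually_elim
    case (elim n)
    define h where "h = (b - a) / real (Suc n)"
    define t where "t k = a + real k * h" for k
    have h: "h > 0" "h < d" "real (Suc n) * h = b - a"
      using elim ab by (simp_all add: h_def del: of_nat_Suc)
    have t_in: "t k \<in> {a..b}" if "k \<le> Suc n" for k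
    proof -
      have "real k * h \<le> real (Suc n) * h" using that h(1) by (intro mult_right_mono) auto
      then have "a + real k * h \<le> b" unfolding h(3) by linarith
      then show ?thesis using h(1) by (simp add: t_def)
    qed
    have tele: "(\<Sum>k<Suc n. P (t (Suc k)) - P (t k)) = P b - P a"
      using h(3) by (subst sum_lessThan_telescope[of "\<lambda>k. P (t k)"]) (simp add: t_def del: of_nat_Suc)
    have step: "\<bar>h * p (t k) - (P (t (Suc k)) - P (t k))\<bar> \<le> h * \<eta>" if k: "k < Suc n" for k
    proof -
      have tk: "t (Suc k) = t k + h" by (simp add: t_def algebra_simps)
      then have lt: "t k < t (Suc k)" using h by simp
      obtain \<xi> where \<xi>: "t k < \<xi>" "\<xi> < t (Suc k)" "P (t (Suc k)) - P (t k) = (t (Suc k) - t k) * p \<xi>"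
        using MVT2[OF lt, of P p] D by auto
      have "dist (p (t k)) (p \<xi>) < \<eta>"
        using d(2)[of "t k" \<xi>] t_in[of k] t_in[of "Suc k"] k \<xi>(1,2) h(2) tk by (auto simp: dist_real_def)
      moreover have "h * p (t k) - (P (t (Suc k)) - P (t k)) = h * (p (t k) - p \<xi>)"
        using \<xi>(3) tk by (simp add: algebra_simps)
      ultimately show ?thesis
        using h(1) by (simp add: abs_mult dist_real_def less_imp_le)
    qed
    have "\<bar>(\<Sum>k<Suc n. h * p (t k)) - (P b - P a)\<bar> = \<bar>\<Sum>k<Suc n. h * p (t k) - (P (t (Suc k)) - P (t k))\<bar>"
      unfolding tele[symmetric] by (simp only: sum_subtractf)
    also have "\<dots> \<le> (\<Sum>k<Suc n. h * \<eta>)"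
      by (rule order_trans[OF sum_abs], rule sum_mono) (use step in auto)
    also have "\<dots> = (real (Suc n) * h) * \<eta>" by simp
    also have "\<dots> = \<epsilon> / 2" unfolding h(3) \<eta>_def using ab by (simp add: field_simps)
    also have "\<dots> < \<epsilon>" using \<epsilon> by simp
    finally show ?case by (simp only: dist_real_def h_def t_def)
  qed
qed

text \<open>The value 0 of \<open>sgn\<close> at c = 0 is the source of the weight 1/2 at the
  endpoints.\<close>

lemma arctan_scaled_tendsto: "(\<lambda>n. arctan (c * real (Suc n))) \<longlonglongrightarrow> sgn c * (pi / 2)"
proof -
  have pos: "(\<lambda>n. arctan (c * real (Suc n))) \<longlonglongrightarrow> pi / 2" if "c > 0" for c
    by (rule filterlim_compose[OF tendsto_arctan_at_top])
      (intro filterlim_tendsto_pos_mult_at_top[OF tendsto_const that]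
        filterlim_compose[OF filterlim_real_sequentially filterlim_Suc])
  consider "c > 0" | "c = 0" | "c < 0" by linarith
  then show ?thesis
  proof cases
    case 3
    then show ?thesis using tendsto_minus[OF pos[of "- c"]] by (simp add: arctan_minus)
  qed (use pos in auto)
qed

section \<open>Multipliers in the Fourier basis for fixed l\<close>

context interval
begin

lemma fourier_coef_measurable [measurable]:
  assumes f: "f \<in> L2 \<alpha> \<beta>" and f': "f' \<in> L2 \<alpha> \<beta>"
  shows "(\<lambda>l. fourier_coef f f' l m) \<in> borel_measurable borel"
proof -
  have ip: "(\<lambda>l. l2_inner \<alpha> \<beta> (fourier_basis l m) g) \<in> borel_measurable borel" if g: "g \<in> L2 \<alpha> \<beta>" for g
  proof -
    have [measurable]: "g \<in> borel_measurable \<mu>" using g by (simp add: L2_complex_iff)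
    have [measurable]: "(\<lambda>t. t) \<in> borel_measurable \<mu>"
      by (simp add: measurable_restrict_space1 measurable_completion)
    have "e2c \<in> borel_measurable borel"
      by (intro borel_measurable_continuous_onI continuous_on_e2c continuous_on_id)
    note [measurable] = measurable_compose[OF _ this]
    show ?thesis
      unfolding l2_inner_fourier_basis
      by (intro borel_measurable_times borel_measurable_const \<mu>.borel_measurable_lebesgue_integral) measurable
  qed
  interpret L2: semi_inner "L2 \<alpha> \<beta> :: (real \<Rightarrow> complex) set" "l2_inner \<alpha> \<beta>"
    by (rule semi_inner_L2)
  have "fourier_coef f f' l m = cnj (l2_inner \<alpha> \<beta> (fourier_basis l m) f) * l2_inner \<alpha> \<beta> (fourier_basis l m) f'" for l
    unfolding fourier_coef_def using L2.ip_commute[OF f fourier_basis_L2] by simp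
  moreover have "(\<lambda>l. cnj (l2_inner \<alpha> \<beta> (fourier_basis l m) f)) \<in> borel_measurable borel"
    using ip[OF f] by (intro measurable_compose[OF _ borel_measurable_continuous_onI[OF continuous_on_cnj[OF continuous_on_id]]])
  ultimately show ?thesis using ip[OF f'] by simp
qed

text \<open>A bound for the absolute sum of the coefficients over m, from Bessel's inequality for f
  and for f'. It does not depend on l, so it also gives the bound needed when integrating over l
  against E.\<close>

definition fourier_coef_bound :: "(real \<Rightarrow> complex) \<Rightarrow> (real \<Rightarrow> complex) \<Rightarrow> real" where
  "fourier_coef_bound f f' = (Re (l2_inner \<alpha> \<beta> f f) + Re (l2_inner \<alpha> \<beta> f' f')) / 2"

lemma fourier_coef_summable:
  assumes f: "f \<in> L2 \<alpha> \<beta>" and f': "f' \<in> L2 \<alpha> \<beta>"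
  shows "integrable (count_space UNIV) (fourier_coef f f' l)"
    and "(\<integral>m. cmod (fourier_coef f f' l m) \<partial>count_space UNIV) \<le> fourier_coef_bound f f'"
proof -
  interpret L2: semi_inner "L2 \<alpha> \<beta> :: (real \<Rightarrow> complex) set" "l2_inner \<alpha> \<beta>"
    by (rule semi_inner_L2)
  have fin: "(\<Sum>m\<in>M. cmod (fourier_coef f f' l m)) \<le> fourier_coef_bound f f'" if M: "finite M" for M
  proof -
    have "cmod (fourier_coef f f' l m) \<le> ((cmod (l2_inner \<alpha> \<beta> (fourier_basis l m) f))\<^sup>2 + (cmod (l2_inner \<alpha> \<beta> (fourier_basis l m) f'))\<^sup>2) / 2" for m
      using sum_squares_bound[of "cmod (l2_inner \<alpha> \<beta> (fourier_basis l m) f)" "cmod (l2_inner \<alpha> \<beta> (fourier_basis l m) f')"]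
        L2.ip_commute[OF f fourier_basis_L2, of l m]
      by (simp add: fourier_coef_def norm_mult)
    then have "(\<Sum>m\<in>M. cmod (fourier_coef f f' l m))
      \<le> (\<Sum>m\<in>M. ((cmod (l2_inner \<alpha> \<beta> (fourier_basis l m) f))\<^sup>2 + (cmod (l2_inner \<alpha> \<beta> (fourier_basis l m) f'))\<^sup>2) / 2)"
      by (rule sum_mono)
    also have "\<dots> \<le> fourier_coef_bound f f'"
      unfolding fourier_coef_bound_def sum_divide_distrib[symmetric] sum.distrib
      by (intro divide_right_mono add_mono L2.Bessel_inequality M f f' fourier_basis_L2 fourier_basis_orthonormal) auto
    finally show ?thesis .
  qed
  have sm: "(\<lambda>m. cmod (fourier_coef f f' l m)) summable_on UNIV"
    using fin by (intro nonneg_bdd_above_summable_on bdd_aboveI[of _ "fourier_coef_bound f f'"]) auto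
  then show int: "integrable (count_space UNIV) (fourier_coef f f' l)"
    using abs_summable_equivalent[of "fourier_coef f f' l" UNIV] by (simp add: Infinite_Set_Sum.abs_summable_on_def)
  have "(\<integral>m. cmod (fourier_coef f f' l m) \<partial>count_space UNIV) = infsetsum (\<lambda>m. cmod (fourier_coef f f' l m)) UNIV"
    by (simp add: infsetsum_def)
  also have "\<dots> = (\<Sum>\<^sub>\<infinity>m. cmod (fourier_coef f f' l m))"
    using int by (intro infsetsum_infsum) (simp add: Infinite_Set_Sum.abs_summable_on_def)
  also have "\<dots> \<le> fourier_coef_bound f f'"
    by (intro infsum_le_finite_sums sm fin)
  finally show "(\<integral>m. cmod (fourier_coef f f' l m) \<partial>count_space UNIV) \<le> fourier_coef_bound f f'" .
qed

text \<open>The matrix element between f and f' of \<phi>(P) for the operator P with boundary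
  condition u(\<beta>) = e(l) u(\<alpha>). Writing the sum over m as an integral for counting
  measure makes dominated convergence and measurability in l available.\<close>

definition fiber :: "(real \<Rightarrow> complex) \<Rightarrow> (real \<Rightarrow> complex) \<Rightarrow> (real \<Rightarrow> complex) \<Rightarrow> real \<Rightarrow> complex" where
  "fiber \<phi> f f' l = (\<integral>m. \<phi> ((l + of_int m) / (\<beta> - \<alpha>)) * fourier_coef f f' l m \<partial>count_space UNIV)"

context
  fixes f f' :: "real \<Rightarrow> complex"
  assumes f: "f \<in> L2 \<alpha> \<beta>" and f': "f' \<in> L2 \<alpha> \<beta>"
begin

lemma fiber_integrable:
  assumes "\<And>t. cmod (\<phi> t) \<le> b"
  shows "integrable (count_space UNIV) (\<lambda>m. \<phi> ((l + of_int m) / (\<beta> - \<alpha>)) * fourier_coef f f' l m)"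
proof (rule Bochner_Integration.integrable_bound)
  show "integrable (count_space UNIV) (\<lambda>m. b * cmod (fourier_coef f f' l m))"
    using fourier_coef_summable(1)[OF f f'] by simp
  show "AE m in count_space UNIV. norm (\<phi> ((l + of_int m) / (\<beta> - \<alpha>)) * fourier_coef f f' l m) \<le> norm (b * cmod (fourier_coef f f' l m))"
    using assms order_trans[OF norm_ge_zero assms] by (intro AE_I2) (auto simp: norm_mult intro!: mult_right_mono)
qed simp

lemma fiber_bound:
  assumes "\<And>t. cmod (\<phi> t) \<le> b"
  shows "cmod (fiber \<phi> f f' l) \<le> b * fourier_coef_bound f f'"
proof -
  have "cmod (fiber \<phi> f f' l) \<le> (\<integral>m. cmod (\<phi> ((l + of_int m) / (\<beta> - \<alpha>)) * fourier_coef f f' l m) \<partial>count_space UNIV)"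
    unfolding fiber_def by (rule integral_norm_bound)
  also have "\<dots> \<le> (\<integral>m. b * cmod (fourier_coef f f' l m) \<partial>count_space UNIV)"
    using fourier_coef_summable(1)[OF f f'] assms
    by (intro integral_mono integrable_norm fiber_integrable[of _ b]) (auto simp: norm_mult intro!: mult_right_mono)
  also have "\<dots> \<le> b * fourier_coef_bound f f'"
    using fourier_coef_summable(2)[OF f f', of l] order_trans[OF norm_ge_zero assms] by (simp add: mult_left_mono)
  finally show ?thesis .
qed

lemma fiber_measurable:
  assumes [measurable]: "\<phi> \<in> borel_measurable borel"
  shows "fiber \<phi> f f' \<in> borel_measurable borel"
proof -
  interpret sigma_finite_measure "count_space (UNIV :: int set)"
    by (rule sigma_finite_measure_count_space)
  note [measurable] = fourier_coef_measurable[OF f f']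
  have "(\<lambda>(m, l). \<phi> ((l + of_int m) / (\<beta> - \<alpha>)) * fourier_coef f f' l m) \<in> borel_measurable (count_space UNIV \<Otimes>\<^sub>M borel)"
    by (rule measurable_pair_measure_countable1) (auto, measurable)
  then have "(\<lambda>(l, m). \<phi> ((l + of_int m) / (\<beta> - \<alpha>)) * fourier_coef f f' l m) \<in> borel_measurable (borel \<Otimes>\<^sub>M count_space UNIV)"
    by (subst measurable_pair_swap_iff) (simp add: case_prod_beta')
  then show ?thesis
    unfolding fiber_def by (rule borel_measurable_lebesgue_integral)
qed

lemma fiber_tendsto:
  assumes b: "\<And>n t. cmod (\<phi> n t) \<le> b" and lim: "\<And>t. (\<lambda>n. \<phi> n t) \<longlonglongrightarrow> \<psi> t"
  shows "(\<lambda>n. fiber (\<phi> n) f f' l) \<longlonglongrightarrow> fiber \<psi> f f' l"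
  unfolding fiber_def
proof (rule integral_dominated_convergence)
  show "integrable (count_space UNIV) (\<lambda>m. b * cmod (fourier_coef f f' l m))"
    using fourier_coef_summable(1)[OF f f'] by simp
  show "AE m in count_space UNIV. norm (\<phi> n ((l + of_int m) / (\<beta> - \<alpha>)) * fourier_coef f f' l m) \<le> b * cmod (fourier_coef f f' l m)" for n
    using b by (intro AE_I2) (auto simp: norm_mult intro!: mult_right_mono)
  show "AE m in count_space UNIV. (\<lambda>n. \<phi> n ((l + of_int m) / (\<beta> - \<alpha>)) * fourier_coef f f' l m)
    \<longlonglongrightarrow> \<psi> ((l + of_int m) / (\<beta> - \<alpha>)) * fourier_coef f f' l m"
    by (intro AE_I2 tendsto_intros lim)
qed simp_all

lemma fiber_resolvent:
  assumes z: "Im z \<noteq> 0"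
  shows "fiber (\<lambda>s. inverse (complex_of_real s - z)) f f' l = l2_inner \<alpha> \<beta> f (scalar_resolvent z l f')"
proof -
  have b: "cmod (inverse (complex_of_real s - z)) \<le> inverse \<bar>Im z\<bar>" for s
    unfolding norm_inverse using z abs_Im_le_cmod[of "complex_of_real s - z"]
    by (intro le_imp_inverse_le) auto
  have "fiber (\<lambda>s. inverse (complex_of_real s - z)) f f' l
    = infsetsum (\<lambda>m. inverse (complex_of_real ((l + of_int m) / (\<beta> - \<alpha>)) - z) * fourier_coef f f' l m) UNIV"
    by (simp add: fiber_def infsetsum_def)
  also have "\<dots> = (\<Sum>\<^sub>\<infinity>m. inverse (complex_of_real ((l + of_int m) / (\<beta> - \<alpha>)) - z) * fourier_coef f f' l m)"
    using fiber_integrable[of "\<lambda>s. inverse (complex_of_real s - z)", OF b]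
    by (intro infsetsum_infsum) (simp add: Infinite_Set_Sum.abs_summable_on_def)
  also have "\<dots> = l2_inner \<alpha> \<beta> f (scalar_resolvent z l f')"
    by (intro infsumI scalar_resolvent_has_sum z f f')
  finally show ?thesis .
qed

text \<open>Bounded support leaves finitely many m. The sum in \<open>fourier_sum\<close>, which is
  taken pointwise in t, is then finite over an index set independent of t and commutes with the
  integral defining the inner product.\<close>

lemma fiber_eq_fourier_sum:
  assumes supp: "\<And>s. s \<notin> {a..b} \<Longrightarrow> w s = 0"
  shows "l2_inner \<alpha> \<beta> f (fourier_sum \<alpha> \<beta> w l f') = fiber (\<lambda>s. complex_of_real (w s)) f f' l"
proof -
  define N where "N = {m. w ((l + of_int m) / (\<beta> - \<alpha>)) \<noteq> 0}"
  have "N \<subseteq> {\<lceil>a * (\<beta> - \<alpha>) - l\<rceil>..\<lfloor>b * (\<beta> - \<alpha>) - l\<rfloor>}"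
  proof
    fix m assume "m \<in> N"
    then have "(l + of_int m) / (\<beta> - \<alpha>) \<in> {a..b}" using supp by (auto simp: N_def)
    then have "a * (\<beta> - \<alpha>) \<le> l + of_int m" "l + of_int m \<le> b * (\<beta> - \<alpha>)"
      using less by (simp_all add: field_simps)
    then show "m \<in> {\<lceil>a * (\<beta> - \<alpha>) - l\<rceil>..\<lfloor>b * (\<beta> - \<alpha>) - l\<rfloor>}"
      by (simp add: ceiling_le_iff le_floor_iff)
  qed
  then have N: "finite N" by (rule finite_subset) simp
  have proj: "fourier_proj \<alpha> \<beta> r f' \<in> L2 \<alpha> \<beta>" for r
    unfolding fourier_proj_def e2pi_eq by (intro L2_continuous continuous_intros)
  have "fourier_sum \<alpha> \<beta> w l f' t = (\<Sum>m\<in>N. complex_of_real (w ((l + of_int m) / (\<beta> - \<alpha>))) *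
      fourier_proj \<alpha> \<beta> ((l + of_int m) / (\<beta> - \<alpha>)) f' t)" for t
    unfolding fourier_sum_def infsum_finite[OF N, symmetric]
    by (rule infsum_cong_neutral) (auto simp: N_def)
  then have "l2_inner \<alpha> \<beta> f (fourier_sum \<alpha> \<beta> w l f') = (\<integral>t. (\<Sum>m\<in>N. complex_of_real (w ((l + of_int m) / (\<beta> - \<alpha>))) *
      cinner (f t) (fourier_proj \<alpha> \<beta> ((l + of_int m) / (\<beta> - \<alpha>)) f' t)) \<partial>\<mu>)"
    by (simp add: l2_inner_def cinner_complex_def sum_distrib_left mult.left_commute)
  also have "\<dots> = (\<Sum>m\<in>N. complex_of_real (w ((l + of_int m) / (\<beta> - \<alpha>))) * fourier_coef f f' l m)"
    by (subst Bochner_Integration.integral_sum)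
      (auto intro!: integrable_cinner f proj simp: l2_inner_fourier_proj[symmetric] l2_inner_def)
  also have "\<dots> = (\<Sum>m | m \<in> UNIV \<and> complex_of_real (w ((l + of_int m) / (\<beta> - \<alpha>))) * fourier_coef f f' l m \<noteq> 0.
      complex_of_real (w ((l + of_int m) / (\<beta> - \<alpha>))) * fourier_coef f f' l m)"
    using N by (intro sum.mono_neutral_right) (auto simp: N_def)
  also have "\<dots> = fiber (\<lambda>s. complex_of_real (w s)) f f' l"
    unfolding fiber_def
    by (intro lebesgue_integral_count_space_finite_support[symmetric] finite_subset[OF _ N]) (auto simp: N_def)
  finally show ?thesis .
qed

end

end

section \<open>The class of functions on which the two functional calculi agree\<close>

locale spectral_setup = interval +
  fixes V :: "'h::chilbert \<Rightarrow> 'h"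
    and E :: "real set \<Rightarrow> 'h \<Rightarrow> 'h"
    and F :: "real set \<Rightarrow> (real \<Rightarrow> 'h) \<Rightarrow> real \<Rightarrow> 'h"
  assumes V: "unitary V"
    and E: "spectral_resolution V E"
    and F: "spectral_measure_of (L2 \<alpha> \<beta>) (l2_inner \<alpha> \<beta>) (P_graph \<alpha> \<beta> V) F"
begin

sublocale PE: pvm_space "UNIV :: 'h set" cinner "restrict_space borel {0..<1}" E
  by (intro pvm_space.intro pvm_space_axioms.intro semi_inner_cinner)
    (use E in \<open>simp add: spectral_resolution_def\<close>)

sublocale PF: pvm_space "L2 \<alpha> \<beta> :: (real \<Rightarrow> 'h) set" "l2_inner \<alpha> \<beta>" borel F
  by (intro pvm_space.intro pvm_space_axioms.intro semi_inner_L2)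
    (use F in \<open>simp add: spectral_measure_of_def\<close>)

text \<open>Measurability and boundedness are part of the notion because they give integrability on
  both sides, which the closure under sums and limits relies on.\<close>

definition intertwined :: "(real \<Rightarrow> complex) \<Rightarrow> bool" where
  "intertwined \<phi> \<longleftrightarrow> \<phi> \<in> borel_measurable borel \<and> (\<exists>b. \<forall>t. cmod (\<phi> t) \<le> b) \<and>
    (\<forall>f\<in>L2 \<alpha> \<beta>. \<forall>f'\<in>L2 \<alpha> \<beta>. \<forall>g g'.
      PF.pint \<phi> (f \<otimes>\<^sub>H g) (f' \<otimes>\<^sub>H g') = PE.pint (fiber \<phi> f f') g g')"

lemma fiber_pintegrable:
  assumes "\<phi> \<in> borel_measurable borel" "\<And>t. cmod (\<phi> t) \<le> b" "f \<in> L2 \<alpha> \<beta>" "f' \<in> L2 \<alpha> \<beta>"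
  shows "PE.pintegrable (fiber \<phi> f f') g g'"
  by (rule PE.pintegrable_bounded[OF UNIV_I UNIV_I _ fiber_bound[OF assms(3,4,2)]])
    (intro measurable_restrict_space1 fiber_measurable assms)

lemma intertwined_resolvent:
  assumes z: "Im z \<noteq> 0"
  shows "intertwined (\<lambda>s. inverse (complex_of_real s - z))"
  unfolding intertwined_def
proof (intro conjI exI[of _ "inverse \<bar>Im z\<bar>"] allI ballI)
  show "(\<lambda>s. inverse (complex_of_real s - z)) \<in> borel_measurable borel" by measurable
  show "cmod (inverse (complex_of_real s - z)) \<le> inverse \<bar>Im z\<bar>" for s
    unfolding norm_inverse using z abs_Im_le_cmod[of "complex_of_real s - z"]
    by (intro le_imp_inverse_le) auto
  show "PF.pint (\<lambda>s. inverse (complex_of_real s - z)) (f \<otimes>\<^sub>H g) (f' \<otimes>\<^sub>H g')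
    = PE.pint (fiber (\<lambda>s. inverse (complex_of_real s - z)) f f') g g'"
    if "f \<in> L2 \<alpha> \<beta>" "f' \<in> L2 \<alpha> \<beta>" for f f' g g'
    using resolvent_eq[OF V E F z that] fiber_resolvent[OF that z] by (simp add: fun_eq_iff[symmetric] cong: PE.pint_cong)
qed

lemma intertwined_mult: "intertwined \<phi> \<Longrightarrow> intertwined (\<lambda>s. a * \<phi> s)"
proof -
  assume \<phi>: "intertwined \<phi>"
  then obtain b where b: "\<And>t. cmod (\<phi> t) \<le> b" and [measurable]: "\<phi> \<in> borel_measurable borel"
    by (auto simp: intertwined_def)
  have "fiber (\<lambda>s. a * \<phi> s) f f' = (\<lambda>l. a * fiber \<phi> f f' l)" for f f'
    by (simp add: fun_eq_iff fiber_def mult.assoc)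
  moreover have "cmod (a * \<phi> t) \<le> cmod a * b" for t
    using b by (simp add: norm_mult mult_left_mono)
  ultimately show ?thesis
    using \<phi> unfolding intertwined_def by (auto simp: PF.pint_mult PE.pint_mult)
qed

lemma intertwined_add:
  assumes \<phi>: "intertwined \<phi>" and \<psi>: "intertwined \<psi>"
  shows "intertwined (\<lambda>s. \<phi> s + \<psi> s)"
proof -
  obtain b where b: "\<And>t. cmod (\<phi> t) \<le> b" and m1: "\<phi> \<in> borel_measurable borel"
    and e1: "\<And>f f' g g'. f \<in> L2 \<alpha> \<beta> \<Longrightarrow> f' \<in> L2 \<alpha> \<beta> \<Longrightarrow>
      PF.pint \<phi> (f \<otimes>\<^sub>H g) (f' \<otimes>\<^sub>H g') = PE.pint (fiber \<phi> f f') g g'"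
    using \<phi> by (auto simp: intertwined_def)
  obtain c where c: "\<And>t. cmod (\<psi> t) \<le> c" and m2: "\<psi> \<in> borel_measurable borel"
    and e2: "\<And>f f' g g'. f \<in> L2 \<alpha> \<beta> \<Longrightarrow> f' \<in> L2 \<alpha> \<beta> \<Longrightarrow>
      PF.pint \<psi> (f \<otimes>\<^sub>H g) (f' \<otimes>\<^sub>H g') = PE.pint (fiber \<psi> f f') g g'"
    using \<psi> by (auto simp: intertwined_def)
  show ?thesis
    unfolding intertwined_def
  proof (intro conjI exI[of _ "b + c"] allI ballI)
    show "cmod (\<phi> t + \<psi> t) \<le> b + c" for t
      by (intro norm_triangle_mono b c)
    fix f f' :: "real \<Rightarrow> complex" and g g' :: 'h
    assume f: "f \<in> L2 \<alpha> \<beta>" and f': "f' \<in> L2 \<alpha> \<beta>"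
    have "fiber (\<lambda>s. \<phi> s + \<psi> s) f f' = (\<lambda>l. fiber \<phi> f f' l + fiber \<psi> f f' l)"
      using fiber_integrable[OF f f', of \<phi>, OF b] fiber_integrable[OF f f', of \<psi>, OF c]
      by (simp add: fun_eq_iff fiber_def distrib_right)
    then have "PE.pint (fiber (\<lambda>s. \<phi> s + \<psi> s) f f') g g' = PE.pint (fiber \<phi> f f') g g' + PE.pint (fiber \<psi> f f') g g'"
      using PE.pint_add[OF fiber_pintegrable[OF m1 b f f'] fiber_pintegrable[OF m2 c f f']] by simp
    moreover have "PF.pint (\<lambda>s. \<phi> s + \<psi> s) (f \<otimes>\<^sub>H g) (f' \<otimes>\<^sub>H g')
      = PF.pint \<phi> (f \<otimes>\<^sub>H g) (f' \<otimes>\<^sub>H g') + PF.pint \<psi> (f \<otimes>\<^sub>H g) (f' \<otimes>\<^sub>H g')"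
      by (rule PF.pint_add; rule PF.pintegrable_bounded[OF tensor_L2[OF f] tensor_L2[OF f']]) (use m1 m2 b c in auto)
    ultimately show "PF.pint (\<lambda>s. \<phi> s + \<psi> s) (f \<otimes>\<^sub>H g) (f' \<otimes>\<^sub>H g') = PE.pint (fiber (\<lambda>s. \<phi> s + \<psi> s) f f') g g'"
      using e1[OF f f'] e2[OF f f'] by simp
  qed (use m1 m2 in measurable)
qed

text \<open>Dominated convergence acts on two levels of the E-side: over m inside
  \<open>fiber\<close>, and over l for the measures of E, where \<open>fiber_bound\<close> gives a
  bound independent of n and l.\<close>

lemma intertwined_lim:
  assumes \<phi>: "\<And>n. intertwined (\<phi> n)" and b: "\<And>n t. cmod (\<phi> n t) \<le> b"
    and lim: "\<And>t. (\<lambda>n. \<phi> n t) \<longlonglongrightarrow> \<psi> t"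
  shows "intertwined \<psi>"
proof -
  have m: "\<phi> n \<in> borel_measurable borel"
    and e: "\<And>f f' g g'. f \<in> L2 \<alpha> \<beta> \<Longrightarrow> f' \<in> L2 \<alpha> \<beta> \<Longrightarrow>
      PF.pint (\<phi> n) (f \<otimes>\<^sub>H g) (f' \<otimes>\<^sub>H g') = PE.pint (fiber (\<phi> n) f f') g g'" for n
    using \<phi>[of n] by (auto simp: intertwined_def)
  have m': "\<psi> \<in> borel_measurable borel"
    by (rule borel_measurable_LIMSEQ_metric[OF m lim])
  show ?thesis
    unfolding intertwined_def
  proof (intro conjI exI[of _ b] allI ballI)
    show "cmod (\<psi> t) \<le> b" for t
      by (rule LIMSEQ_le_const2[OF tendsto_norm[OF lim]]) (use b in auto)
    fix f f' :: "real \<Rightarrow> complex" and g g' :: 'h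
    assume f: "f \<in> L2 \<alpha> \<beta>" and f': "f' \<in> L2 \<alpha> \<beta>"
    have "(\<lambda>n. PF.pint (\<phi> n) (f \<otimes>\<^sub>H g) (f' \<otimes>\<^sub>H g')) \<longlonglongrightarrow> PF.pint \<psi> (f \<otimes>\<^sub>H g) (f' \<otimes>\<^sub>H g')"
      by (rule PF.pint_bounded_convergence[OF tensor_L2[OF f] tensor_L2[OF f'] m m' b lim])
    moreover have "(\<lambda>n. PE.pint (fiber (\<phi> n) f f') g g') \<longlonglongrightarrow> PE.pint (fiber \<psi> f f') g g'"
      by (rule PE.pint_bounded_convergence[OF UNIV_I UNIV_I _ _ fiber_bound[OF f f' b] fiber_tendsto[OF f f' b lim]])
        (intro measurable_restrict_space1 fiber_measurable f f' m m')+
    ultimately show "PF.pint \<psi> (f \<otimes>\<^sub>H g) (f' \<otimes>\<^sub>H g') = PE.pint (fiber \<psi> f f') g g'"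
      unfolding e[OF f f'] by (rule LIMSEQ_unique)
  qed (rule m')
qed

lemma intertwined_sum: "(\<And>k. intertwined (\<phi> k)) \<Longrightarrow> intertwined (\<lambda>s. \<Sum>k<n. \<phi> k s)" for n :: nat
proof (induction n)
  case 0
  \<comment> \<open>The zero function is obtained as 0 times a resolvent function.\<close>
  from intertwined_mult[OF intertwined_resolvent[of \<i>], of 0] show ?case by simp
next
  case (Suc n)
  from intertwined_add[OF Suc.IH[OF Suc.prems] Suc.prems] show ?case by simp
qed

text \<open>The Poisson kernel is the imaginary part of 1/(s - z) for z = t + \<i> y, so it combines
  the resolvents at z and at its conjugate.\<close>

lemma intertwined_poisson:
  assumes y: "y > 0"
  shows "intertwined (\<lambda>s. complex_of_real (y / ((s - t)\<^sup>2 + y\<^sup>2)))"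
proof -
  define z where "z = complex_of_real t + \<i> * complex_of_real y"
  have "complex_of_real (y / ((s - t)\<^sup>2 + y\<^sup>2)) =
    inverse (2 * \<i>) * (inverse (complex_of_real s - z) + (-1) * inverse (complex_of_real s - cnj z))" for s
  proof -
    have nz: "complex_of_real s - z \<noteq> 0" "complex_of_real s - cnj z \<noteq> 0"
      using y by (auto simp: z_def complex_eq_iff)
    have "(complex_of_real s - z) * (complex_of_real s - cnj z) = complex_of_real ((s - t)\<^sup>2 + y\<^sup>2)"
      by (simp add: z_def complex_eq_iff power2_eq_square algebra_simps)
    moreover have "inverse (complex_of_real s - z) + (-1) * inverse (complex_of_real s - cnj z)
      = (z - cnj z) / ((complex_of_real s - z) * (complex_of_real s - cnj z))"
      using nz by (simp add: field_simps)
    moreover have "z - cnj z = 2 * \<i> * complex_of_real y"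
      by (simp add: z_def complex_eq_iff)
    ultimately show ?thesis by simp
  qed
  moreover have "intertwined (\<lambda>s. inverse (2 * \<i>) * (inverse (complex_of_real s - z) + (-1) * inverse (complex_of_real s - cnj z)))"
    by (intro intertwined_mult intertwined_add intertwined_resolvent) (use y in \<open>simp_all add: z_def\<close>)
  ultimately show ?thesis by simp
qed

text \<open>The Poisson kernel integrated over t from a to b, at fixed height y. Each kernel is at
  most 1/y and the steps add up to b - a, which bounds all Riemann sums. This bound blows up as y
  tends to 0, so that limit is taken separately.\<close>

lemma intertwined_arctan:
  assumes y: "y > 0" and ab: "a < b"
  shows "intertwined (\<lambda>s. complex_of_real (arctan ((b - s) / y) - arctan ((a - s) / y)))"
proof (rule intertwined_lim)
  define h where "h n = (b - a) / real (Suc n)" for n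
  define \<phi> where "\<phi> n s = (\<Sum>k<Suc n. complex_of_real (h n) *
    complex_of_real (y / ((s - (a + real k * h n))\<^sup>2 + y\<^sup>2)))" for n s
  show "intertwined (\<phi> n)" for n
    unfolding \<phi>_def by (intro intertwined_sum intertwined_mult intertwined_poisson y)
  have h: "h n > 0" "real (Suc n) * h n = b - a" for n
    using ab by (simp_all add: h_def del: of_nat_Suc)
  show "cmod (\<phi> n s) \<le> (b - a) * (1 / y)" for n s
  proof -
    have "cmod (\<phi> n s) \<le> (\<Sum>k<Suc n. h n * (1 / y))"
      unfolding \<phi>_def
    proof (rule order_trans[OF norm_sum], rule sum_mono)
      fix k
      have "y / ((s - (a + real k * h n))\<^sup>2 + y\<^sup>2) \<le> y / y\<^sup>2"
        using y by (intro divide_left_mono mult_pos_pos add_nonneg_pos) auto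
      then have "\<bar>y / ((s - (a + real k * h n))\<^sup>2 + y\<^sup>2)\<bar> \<le> 1 / y"
        using y by (simp add: power2_eq_square abs_of_nonneg)
      then show "cmod (complex_of_real (h n) * complex_of_real (y / ((s - (a + real k * h n))\<^sup>2 + y\<^sup>2))) \<le> h n * (1 / y)"
        using h(1)[of n] unfolding norm_mult norm_of_real
        by (intro mult_mono) auto
    qed
    also have "\<dots> = (b - a) * (1 / y)" using h(2)[of n] by simp
    finally show ?thesis .
  qed
  show "(\<lambda>n. \<phi> n s) \<longlonglongrightarrow> complex_of_real (arctan ((b - s) / y) - arctan ((a - s) / y))" for s
  proof -
    have D: "((\<lambda>t. arctan ((t - s) / y)) has_real_derivative y / ((s - t)\<^sup>2 + y\<^sup>2)) (at t)" for t
    proof -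
      have "1 + ((t - s) / y)\<^sup>2 = ((s - t)\<^sup>2 + y\<^sup>2) / y\<^sup>2"
        using y by (simp add: power_divide power2_commute field_simps)
      then have "inverse (1 + ((t - s) / y)\<^sup>2) * (1 / y) = y / ((s - t)\<^sup>2 + y\<^sup>2)"
        using y by (simp add: power2_eq_square)
      moreover have "((\<lambda>t. arctan ((t - s) / y)) has_real_derivative inverse (1 + ((t - s) / y)\<^sup>2) * (1 / y)) (at t)"
        by (rule DERIV_chain2[OF DERIV_arctan]) (use y in \<open>auto intro!: derivative_eq_intros\<close>)
      ultimately show ?thesis by simp
    qed
    have "(s - t)\<^sup>2 + y\<^sup>2 \<noteq> 0" for t
      using y sum_power2_gt_zero_iff[of "s - t" y] by simp
    then have "continuous_on {a..b} (\<lambda>t. y / ((s - t)\<^sup>2 + y\<^sup>2))"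
      by (intro continuous_intros) blast
    from tendsto_of_real[OF Riemann_sums_tendsto[OF ab D this], where 'a=complex]
    show ?thesis by (simp add: \<phi>_def h_def del: of_nat_Suc sum.lessThan_Suc)
  qed
qed

text \<open>Stone's limit with heights y = 1/(n + 1). The factor 1/pi normalizes the total mass of
  the kernel, and as two values of arctan differ by at most pi, the bound 1 is independent of the
  height. At s = a or s = b one of the two arctan terms is 0, which leaves the value 1/2.\<close>

lemma intertwined_half_indicator:
  assumes ab: "a < b"
  shows "intertwined (\<lambda>s. complex_of_real (half_indicator a b s))"
proof (rule intertwined_lim)
  define \<phi> where "\<phi> n s = complex_of_real (1 / pi) *
    complex_of_real (arctan ((b - s) / (1 / real (Suc n))) - arctan ((a - s) / (1 / real (Suc n))))" for n s
  show "intertwined (\<phi> n)" for n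
    unfolding \<phi>_def by (intro intertwined_mult intertwined_arctan ab) simp
  show "cmod (\<phi> n s) \<le> 1" for n s
  proof -
    have "\<bar>arctan x - arctan y\<bar> \<le> pi" for x y
      using arctan_bounded[of x] arctan_bounded[of y] by linarith
    then show ?thesis unfolding \<phi>_def norm_mult norm_of_real by (simp add: field_simps)
  qed
  show "(\<lambda>n. \<phi> n s) \<longlonglongrightarrow> complex_of_real (half_indicator a b s)" for s
  proof -
    have "(\<lambda>n. complex_of_real (1 / pi) * complex_of_real (arctan ((b - s) * real (Suc n)) - arctan ((a - s) * real (Suc n))))
      \<longlonglongrightarrow> complex_of_real (1 / pi) * complex_of_real (sgn (b - s) * (pi / 2) - sgn (a - s) * (pi / 2))"
      by (intro tendsto_intros arctan_scaled_tendsto)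
    also have "complex_of_real (1 / pi) * complex_of_real (sgn (b - s) * (pi / 2) - sgn (a - s) * (pi / 2))
      = complex_of_real (half_indicator a b s)"
      using ab by (auto simp: half_indicator_def sgn_real_def indicator_def simp flip: of_real_mult)
    finally show ?thesis by (simp add: \<phi>_def del: of_nat_Suc)
  qed
qed

text \<open>Intervals shrinking to a contain a in their interior, where the half indicator is 1, and
  eventually exclude any other point together with their endpoints.\<close>

lemma intertwined_singleton: "intertwined (\<lambda>s. complex_of_real (indicator {a} s))"
proof (rule intertwined_lim)
  show "intertwined (\<lambda>s. complex_of_real (half_indicator (a - 1 / real (Suc n)) (a + 1 / real (Suc n)) s))" for n
    by (intro intertwined_half_indicator) (simp add: field_simps)
  show "cmod (complex_of_real (half_indicator c d s)) \<le> 1" for c d s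
    by (simp add: half_indicator_def indicator_def)
  show "(\<lambda>n. complex_of_real (half_indicator (a - 1 / real (Suc n)) (a + 1 / real (Suc n)) s))
    \<longlonglongrightarrow> complex_of_real (indicator {a} s)" for s
  proof (cases "s = a")
    case True
    have "half_indicator (a - 1 / real (Suc n)) (a + 1 / real (Suc n)) a = 1" for n
      by (simp add: half_indicator_def)
    then show ?thesis using True by simp
  next
    case False
    have "(\<lambda>n. 1 / real (Suc n)) \<longlonglongrightarrow> 0"
      by (rule LIMSEQ_Suc[OF lim_const_over_n])
    then have "\<forall>\<^sub>F n in sequentially. 1 / real (Suc n) < \<bar>s - a\<bar>"
      by (rule order_tendstoD) (use False in simp)
    then have "\<forall>\<^sub>F n in sequentially. complex_of_real (half_indicator (a - 1 / real (Suc n)) (a + 1 / real (Suc n)) s)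
      = complex_of_real (indicator {a} s)"
    proof eventually_elim
      case (elim n)
      then have "s \<notin> {a - 1 / real (Suc n)..a + 1 / real (Suc n)}" by auto
      then show ?case using False by (auto simp: half_indicator_def indicator_def)
    qed
    then show ?thesis by (rule tendsto_eventually)
  qed
qed

section \<open>Passage to the weak operator integral, and the open interval\<close>

lemma has_tensor_integral_iff:
  assumes w: "intertwined (\<lambda>s. complex_of_real (w s))" and supp: "\<And>s. s \<notin> {a..b} \<Longrightarrow> w s = 0"
  shows "has_tensor_integral \<alpha> \<beta> E (fourier_sum \<alpha> \<beta> w) T \<longleftrightarrow>
    (\<forall>f\<in>L2 \<alpha> \<beta>. \<forall>f'\<in>L2 \<alpha> \<beta>. \<forall>g g'. l2_inner \<alpha> \<beta> (f \<otimes>\<^sub>H g) (T (f' \<otimes>\<^sub>H g'))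
      = PF.pint (\<lambda>s. complex_of_real (w s)) (f \<otimes>\<^sub>H g) (f' \<otimes>\<^sub>H g'))"
proof -
  obtain c where c: "\<And>t. cmod (complex_of_real (w t)) \<le> c" and m: "(\<lambda>s. complex_of_real (w s)) \<in> borel_measurable borel"
    and e: "\<And>f f' g g'. f \<in> L2 \<alpha> \<beta> \<Longrightarrow> f' \<in> L2 \<alpha> \<beta> \<Longrightarrow>
      PF.pint (\<lambda>s. complex_of_real (w s)) (f \<otimes>\<^sub>H g) (f' \<otimes>\<^sub>H g') = PE.pint (fiber (\<lambda>s. complex_of_real (w s)) f f') g g'"
    using w unfolding intertwined_def by blast
  \<comment> \<open>With the integrand identified as \<open>fiber\<close>, the integral against E is
    by \<open>w\<close> an integral against F, and the claim concerns F alone.\<close>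
  have "(\<lambda>l. l2_inner \<alpha> \<beta> f (fourier_sum \<alpha> \<beta> w l f')) = fiber (\<lambda>s. complex_of_real (w s)) f f'"
    if "f \<in> L2 \<alpha> \<beta>" "f' \<in> L2 \<alpha> \<beta>" for f f'
    using fiber_eq_fourier_sum[OF that supp] by (simp add: fun_eq_iff)
  then show ?thesis
    unfolding has_tensor_integral_def PE.has_pvm_integral_iff
    using fiber_pintegrable[OF m c] e by simp
qed

lemma half_sum_eq_pint:
  assumes x: "x \<in> L2 \<alpha> \<beta>" and y: "y \<in> L2 \<alpha> \<beta>"
  shows "l2_inner \<alpha> \<beta> x ((1 / 2) *\<^sub>C (F {a<..<b} y + F {a..b} y))
    = PF.pint (\<lambda>s. complex_of_real (half_indicator a b s)) x y"
proof -
  have i: "PF.pintegrable (indicator A) x y" if "A \<in> sets borel" for A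
    by (rule PF.pintegrable_bounded[OF x y, where b=1]) (use that in \<open>auto simp: indicator_def\<close>)
  have "PF.pint (\<lambda>s. complex_of_real (half_indicator a b s)) x y
    = PF.pint (\<lambda>s. (1 / 2) * (indicator {a<..<b} s + indicator {a..b} s)) x y"
    by (rule PF.pint_cong) (simp add: half_indicator_def indicator_def)
  also have "\<dots> = (1 / 2) * (l2_inner \<alpha> \<beta> x (F {a<..<b} y) + l2_inner \<alpha> \<beta> x (F {a..b} y))"
    unfolding PF.pint_mult by (simp add: PF.pint_add i PF.pint_indicator x y)
  finally show ?thesis
    by (simp add: PF.ip_scaleC_right PF.ip_add_right PF.add_closed PF.proj_closed x y)
qed

lemma intertwined_open_interval:
  assumes ab: "a < b"
  shows "intertwined (\<lambda>s. complex_of_real (indicator {a<..<b} s))"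
proof -
  have "(\<lambda>s. complex_of_real (indicator {a<..<b} s)) = (\<lambda>s. complex_of_real (half_indicator a b s) +
    (- (1 / 2)) * (complex_of_real (indicator {a} s) + complex_of_real (indicator {b} s)))"
    using ab by (auto simp: fun_eq_iff half_indicator_def indicator_def)
  then show ?thesis
    by (simp only:) (intro intertwined_add intertwined_mult intertwined_half_indicator intertwined_singleton ab)
qed

text \<open>The two functions differ by half the indicators of the endpoints. Their integrals are
  matrix elements of F at single points, which vanish under \<open>null\<close>.\<close>

lemma pint_open_interval:
  assumes ab: "a < b" and x: "x \<in> L2 \<alpha> \<beta>" and y: "y \<in> L2 \<alpha> \<beta>"
    and null: "\<And>r. r \<in> {a, b} \<Longrightarrow> AE t in \<mu>. F {r} y t = 0"
  shows "PF.pint (\<lambda>s. complex_of_real (indicator {a<..<b} s)) x y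
    = PF.pint (\<lambda>s. complex_of_real (half_indicator a b s)) x y"
proof -
  have i: "PF.pintegrable (indicator A) x y" if "A \<in> sets borel" for A
    by (rule PF.pintegrable_bounded[OF x y, where b=1]) (use that in \<open>auto simp: indicator_def\<close>)
  have z: "PF.pint (indicator {r}) x y = 0" if r: "r \<in> {a, b}" for r
  proof -
    have "cinner h (0 :: 'h) = 0" for h :: 'h
      using cinner_scaleC_right[of h 0 0] by simp
    then have "l2_inner \<alpha> \<beta> x (F {r} y) = 0"
      unfolding l2_inner_def using null[OF r] by (intro integral_eq_zero_AE) (auto elim!: eventually_mono)
    then show ?thesis by (simp add: PF.pint_indicator x y)
  qed
  have "PF.pint (\<lambda>s. complex_of_real (half_indicator a b s)) x y
    = PF.pint (\<lambda>s. indicator {a<..<b} s + (1 / 2) * (indicator {a} s + indicator {b} s)) x y"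
    using ab by (intro PF.pint_cong) (auto simp: half_indicator_def indicator_def)
  also have "\<dots> = PF.pint (indicator {a<..<b}) x y + (1 / 2) * (PF.pint (indicator {a}) x y + PF.pint (indicator {b}) x y)"
    by (subst PF.pint_add, (intro i PF.pintegrable_mult PF.pintegrable_add; simp)+,
        subst PF.pint_mult, subst PF.pint_add) (simp_all add: i)
  finally show ?thesis
    by (simp add: z of_real_indicator cong: PF.pint_cong)
qed

end

theorem theorem4p3:
  fixes \<alpha> \<beta> :: real
    and V :: "'h::chilbert \<Rightarrow> 'h"
    and E :: "real set \<Rightarrow> 'h \<Rightarrow> 'h"
    and F :: "real set \<Rightarrow> (real \<Rightarrow> 'h) \<Rightarrow> real \<Rightarrow> 'h"
  assumes "\<alpha> < \<beta>"
    and "unitary V"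
    and "spectral_resolution V E"
    and "spectral_measure_of (L2 \<alpha> \<beta>) (l2_inner \<alpha> \<beta>) (P_graph \<alpha> \<beta> V) F"
  shows "\<forall>\<mu> \<nu>. \<mu> < \<nu> \<longrightarrow>
    has_tensor_integral \<alpha> \<beta> E (fourier_sum \<alpha> \<beta> (half_indicator \<mu> \<nu>))
      (\<lambda>x. (1/2) *\<^sub>C (F {\<mu><..<\<nu>} x + F {\<mu>..\<nu>} x)) \<and>
    ((\<forall>x\<in>L2 \<alpha> \<beta>. \<forall>r\<in>{\<mu>, \<nu>}. AE t in lebesgue_on {\<alpha>..\<beta>}. F {r} x t = 0) \<longrightarrow>
      has_tensor_integral \<alpha> \<beta> E (fourier_sum \<alpha> \<beta> (indicator {\<mu><..<\<nu>}))
        (\<lambda>x. (1/2) *\<^sub>C (F {\<mu><..<\<nu>} x + F {\<mu>..\<nu>} x)))"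
proof (intro allI impI conjI)
  interpret spectral_setup \<alpha> \<beta> V E F
    by unfold_locales (use assms in auto)
  fix a b :: real assume ab: "a < b"
  show "has_tensor_integral \<alpha> \<beta> E (fourier_sum \<alpha> \<beta> (half_indicator a b))
      (\<lambda>x. (1/2) *\<^sub>C (F {a<..<b} x + F {a..b} x))"
    by (subst has_tensor_integral_iff[OF intertwined_half_indicator[OF ab], of a b])
      (auto simp: half_indicator_def[of _ _ "_ :: real"] half_sum_eq_pint tensor_L2)
  assume null: "\<forall>x\<in>L2 \<alpha> \<beta>. \<forall>r\<in>{a, b}. AE t in lebesgue_on {\<alpha>..\<beta>}. F {r} x t = 0"
  show "has_tensor_integral \<alpha> \<beta> E (fourier_sum \<alpha> \<beta> (indicator {a<..<b}))
      (\<lambda>x. (1/2) *\<^sub>C (F {a<..<b} x + F {a..b} x))"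
    by (subst has_tensor_integral_iff[OF intertwined_open_interval[OF ab], of a b])
      (use null in \<open>auto simp: half_sum_eq_pint tensor_L2 intro!: pint_open_interval[OF ab, symmetric]\<close>)
qed

end
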